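(* There is an absolute constant $C>0$ such that the following two assertions hold. (i) (Principal series.) For all $s\in\mathbb{R}\setminus\{0\}$, all $\epsilon\in\{0,1\}$, all $r\in(0,+\infty)$ and all $f,g\in\mathcal{H}_{\frac12 is,\epsilon}$, \[ \left(\int_{-\pi}^{\pi}\int_{-\pi}^{\pi}\left|\langle \pi_{\frac12 is,\epsilon}(k_{\theta_1}a_rk_{\theta_2})f,g\rangle\right|^2\,\mathrm{d}\theta_1\,\mathrm{d}\theta_2\right)^{1/2}\le C\,\frac{|s|+1}{|s|}\,e^{-r}\,\|f\|_{\mathcal{H}_{\frac12 is,\epsilon}}\|g\|_{\mathcal{H}_{\frac12 is,\epsilon}} . \] (ii) (Complementary series.) For all $\lambda\in(-\frac12,0)\cup(0,\frac12)$, all $r\in(0,+\infty)$ and all $f,g\in\mathcal{H}_\lambda$, \[ \left(\int_{-\pi}^{\pi}\int_{-\pi}^{\pi}\left|\langle\langle \pi_{\lambda}(k_{\theta_1}a_rk_{\theta_2})f,g\rangle\rangle\right|^2\,\mathrm{d}\theta_1\,\mathrm{d}\theta_2\right)^{1/2}\le \frac{C}{|\lambda|}\,e^{-(1-2|\lambda|)r}\,\|f\|_{\mathcal{H}_{\lambda}}\|g\|_{\mathcal{H}_{\lambda}} . \]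
   Context: Let $G=\mathrm{SL}(2,\mathbb{R})$. For $r,\theta\in\mathbb{R}$ put \[ a_r=\begin{pmatrix}e^{-r}&0\\0&e^{r}\end{pmatrix},\qquad k_\theta=\begin{pmatrix}\cos\theta&\sin\theta\\-\sin\theta&\cos\theta\end{pmatrix}. \] Elements of $\mathbb{R}^2$ are row vectors, on which $G$ acts by right multiplication; $o$ is the origin. For $\zeta\in\mathbb{C}$ and $\epsilon\in\{0,1\}$, $\mathcal{V}_{\zeta,\epsilon}$ is the space of smooth functions $f$ on $\mathbb{R}^2\setminus\{o\}$ with $f(\delta v)=\operatorname{sgn}(\delta)^\epsilon|\delta|^{2\zeta-1}f(v)$ for all $v\in\mathbb{R}^2\setminus\{o\}$ and $\delta\in\mathbb{R}\setminus\{0\}$, and $G$ acts on it by $\pi_{\zeta,\epsilon}(x)f(v)=f(vx)$. For $\mu\in\mathbb{Z}$ with $\mu-\epsilon$ even, $f_{\zeta,\mu}\in\mathcal{V}_{\zeta,\epsilon}$ is the function with $f_{\zeta,\mu}(\cos\theta,\sin\theta)=\pi^{-1/2}e^{i\mu\theta}$ for all $\theta\in\mathbb{R}$. Define the pairing \[ (f,g)=\frac12\int_{-\pi}^{\pi}f(\cos\theta,\sin\theta)\,g(\cos\theta,\sin\theta)\,\mathrm{d}\theta . \] Principal series: for $s\in\mathbb{R}$, $\mathcal{H}_{\frac12 is,\epsilon}$ is the Hilbert space completion of $\mathcal{V}_{\frac12 is,\epsilon}$ for the inner product $\langle f,g\rangle=(f,\bar g)$; $\pi_{\frac12 is,\epsilon}$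 extends to a unitary representation on it. Complementary series: take $\epsilon=0$ and $\lambda\in(-\frac12,0)\cup(0,\frac12)$, and write $\pi_\lambda=\pi_{\lambda,0}$, $\mathcal{V}_\lambda=\mathcal{V}_{\lambda,0}$. The intertwining operator $J_\lambda:\mathcal{V}_\lambda\to\mathcal{V}_{-\lambda}$ is given for $\lambda\in(-\frac12,0)$ by \[ J_\lambda f(\cos\phi,\sin\phi)=\frac{1}{2c(\lambda)}\int_{-\pi}^{\pi}f(\cos\theta,\sin\theta)\,|\sin(\theta-\phi)|^{-1-2\lambda}\,\mathrm{d}\theta,\qquad c(\lambda)=\pi^{1/2}2^{-2\lambda}\frac{\Gamma(-\lambda)}{\Gamma(\frac12+\lambda)}, \] and for $\lambda\in(0,\frac12)$ by analytic continuation in the parameter; in all cases, for even $\mu$, $J_\lambda f_{\lambda,\mu}=d(\lambda,\mu)f_{-\lambda,\mu}$ with $d(\lambda,\mu)=2^{2\lambda}\,\Gamma(\frac12+\lambda+\frac\mu2)/\Gamma(\frac12-\lambda+\frac\mu2)>0$. The space $\mathcal{H}_\lambda$ is the Hilbert space completion of $\mathcal{V}_\lambda$ for the inner product $\langle\langle f,g\rangle\rangle=(J_\lambda f,\bar g)$; $\pi_\lambda$ extends to a unitary representation on it. *)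

theory Defs
  imports "HOL-Analysis.Analysis"
begin

section \<open>Smooth functions on an open set\<close>

primrec times_differentiable_on ::
  "nat \<Rightarrow> ('a::real_normed_vector \<Rightarrow> 'b::real_normed_vector) \<Rightarrow> 'a set \<Rightarrow> bool" where
  "times_differentiable_on 0 f S \<longleftrightarrow> continuous_on S f"
| "times_differentiable_on (Suc n) f S \<longleftrightarrow>
     (\<forall>x\<in>S. f differentiable (at x)) \<and>
     (\<forall>h. times_differentiable_on n (\<lambda>x. frechet_derivative f (at x) h) S)"

definition smooth_on_open ::
  "('a::real_normed_vector \<Rightarrow> 'b::real_normed_vector) \<Rightarrow> 'a set \<Rightarrow> bool" where
  "smooth_on_open f S \<longleftrightarrow> open S \<and> (\<forall>n. times_differentiable_on n f S)"

section \<open>Hilbert space completion of a space of functions\<close>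

text \<open>
  Let \<open>V\<close> be a complex vector space of functions and \<open>ip\<close> an inner product on it, linear in the
  first argument. The completion is realised as the set of Cauchy sequences in \<open>V\<close> modulo
  sequences of norm tending to zero.
\<close>

definition ip_norm :: "(('a \<Rightarrow> complex) \<Rightarrow> ('a \<Rightarrow> complex) \<Rightarrow> complex) \<Rightarrow> ('a \<Rightarrow> complex) \<Rightarrow> real" where
  "ip_norm ip f = sqrt (Re (ip f f))"

definition cauchy_seqs ::
  "('a \<Rightarrow> complex) set \<Rightarrow> (('a \<Rightarrow> complex) \<Rightarrow> ('a \<Rightarrow> complex) \<Rightarrow> complex)
    \<Rightarrow> (nat \<Rightarrow> 'a \<Rightarrow> complex) set" where
  "cauchy_seqs V ip = {F. (\<forall>n. F n \<in> V) \<and>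
     (\<forall>e>0. \<exists>N. \<forall>m\<ge>N. \<forall>n\<ge>N. ip_norm ip (\<lambda>v. F m v - F n v) < e)}"

definition cauchy_rel ::
  "('a \<Rightarrow> complex) set \<Rightarrow> (('a \<Rightarrow> complex) \<Rightarrow> ('a \<Rightarrow> complex) \<Rightarrow> complex)
    \<Rightarrow> ((nat \<Rightarrow> 'a \<Rightarrow> complex) \<times> (nat \<Rightarrow> 'a \<Rightarrow> complex)) set" where
  "cauchy_rel V ip = {(F, G). F \<in> cauchy_seqs V ip \<and> G \<in> cauchy_seqs V ip \<and>
     (\<lambda>n. ip_norm ip (\<lambda>v. F n v - G n v)) \<longlonglongrightarrow> 0}"

definition completion ::
  "('a \<Rightarrow> complex) set \<Rightarrow> (('a \<Rightarrow> complex) \<Rightarrow> ('a \<Rightarrow> complex) \<Rightarrow> complex)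
    \<Rightarrow> (nat \<Rightarrow> 'a \<Rightarrow> complex) set set" where
  "completion V ip = cauchy_seqs V ip // cauchy_rel V ip"

text \<open>
  The inner product of two classes is the limit along representatives, which does not depend
  on the choice of representatives.
\<close>

definition completion_inner ::
  "(('a \<Rightarrow> complex) \<Rightarrow> ('a \<Rightarrow> complex) \<Rightarrow> complex)
    \<Rightarrow> (nat \<Rightarrow> 'a \<Rightarrow> complex) set \<Rightarrow> (nat \<Rightarrow> 'a \<Rightarrow> complex) set \<Rightarrow> complex" where
  "completion_inner ip X Y = (THE c. \<forall>F\<in>X. \<forall>G\<in>Y. (\<lambda>n. ip (F n) (G n)) \<longlonglongrightarrow> c)"

definition completion_norm ::
  "(('a \<Rightarrow> complex) \<Rightarrow> ('a \<Rightarrow> complex) \<Rightarrow> complex) \<Rightarrow> (nat \<Rightarrow> 'a \<Rightarrow> complex) set \<Rightarrow> real" where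
  "completion_norm ip X = sqrt (Re (completion_inner ip X X))"

text \<open>
  The extension to the completion of an operator \<open>T\<close> that maps \<open>V\<close> to itself and is bounded
  for the norm of \<open>ip\<close>: the class of \<open>(F n)\<close> is sent to the class of \<open>(T (F n))\<close>.
\<close>

definition completion_ext ::
  "('a \<Rightarrow> complex) set \<Rightarrow> (('a \<Rightarrow> complex) \<Rightarrow> ('a \<Rightarrow> complex) \<Rightarrow> complex)
    \<Rightarrow> (('a \<Rightarrow> complex) \<Rightarrow> ('a \<Rightarrow> complex))
    \<Rightarrow> (nat \<Rightarrow> 'a \<Rightarrow> complex) set \<Rightarrow> (nat \<Rightarrow> 'a \<Rightarrow> complex) set" where
  "completion_ext V ip T X = cauchy_rel V ip `` ((\<lambda>F n. T (F n)) ` X)"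

section \<open>The representations of SL(2,R)\<close>

definition mat_a :: "real \<Rightarrow> real^2^2" where
  "mat_a r = vector [vector [exp (- r), 0], vector [0, exp r]]"

definition mat_k :: "real \<Rightarrow> real^2^2" where
  "mat_k \<theta> = vector [vector [cos \<theta>, sin \<theta>], vector [- sin \<theta>, cos \<theta>]]"

definition circ :: "real \<Rightarrow> real^2" where
  "circ \<theta> = vector [cos \<theta>, sin \<theta>]"

text \<open>
  A function on the punctured plane is encoded as a function on the plane that vanishes at the
  origin.
\<close>

definition Vspace :: "complex \<Rightarrow> nat \<Rightarrow> (real^2 \<Rightarrow> complex) set" where
  "Vspace \<zeta> \<epsilon> = {f. f 0 = 0 \<and> smooth_on_open f (- {0}) \<and>
     (\<forall>v \<delta>. v \<noteq> 0 \<longrightarrow> \<delta> \<noteq> 0 \<longrightarrow>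
       f (\<delta> *\<^sub>R v) = of_real (sgn \<delta>) ^ \<epsilon> * of_real \<bar>\<delta>\<bar> powr (2 * \<zeta> - 1) * f v)}"

text \<open>
  The action on all the spaces \<open>Vspace \<zeta> \<epsilon>\<close> is given by the same formula; the vector
  \<open>v\<close> is a row vector, acted upon by right multiplication.
\<close>

definition rep :: "real^2^2 \<Rightarrow> (real^2 \<Rightarrow> complex) \<Rightarrow> (real^2 \<Rightarrow> complex)" where
  "rep x f = (\<lambda>v. f (v v* x))"

definition pairing :: "(real^2 \<Rightarrow> complex) \<Rightarrow> (real^2 \<Rightarrow> complex) \<Rightarrow> complex" where
  "pairing f g = 1 / 2 * (LINT \<theta>:{-pi..pi}|lborel. f (circ \<theta>) * g (circ \<theta>))"

subsection \<open>Principal series\<close>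

definition ps_space :: "real \<Rightarrow> nat \<Rightarrow> (real^2 \<Rightarrow> complex) set" where
  "ps_space s \<epsilon> = Vspace (\<i> * of_real s / 2) \<epsilon>"

definition ps_ip :: "(real^2 \<Rightarrow> complex) \<Rightarrow> (real^2 \<Rightarrow> complex) \<Rightarrow> complex" where
  "ps_ip f g = pairing f (\<lambda>v. cnj (g v))"

definition ps_hilbert :: "real \<Rightarrow> nat \<Rightarrow> (nat \<Rightarrow> real^2 \<Rightarrow> complex) set set" where
  "ps_hilbert s \<epsilon> = completion (ps_space s \<epsilon>) ps_ip"

definition ps_rep :: "real \<Rightarrow> nat \<Rightarrow> real^2^2
    \<Rightarrow> (nat \<Rightarrow> real^2 \<Rightarrow> complex) set \<Rightarrow> (nat \<Rightarrow> real^2 \<Rightarrow> complex) set" where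
  "ps_rep s \<epsilon> x = completion_ext (ps_space s \<epsilon>) ps_ip (rep x)"

subsection \<open>Complementary series\<close>

definition c_fun :: "complex \<Rightarrow> complex" where
  "c_fun z = of_real (sqrt pi) * 2 powr (- 2 * z) * Gamma (- z) / Gamma (1 / 2 + z)"

text \<open>
  The integral below involves only the restriction of \<open>f\<close> to the unit circle, so it makes sense
  for complex \<open>z\<close> with \<open>Re z \<in> (-1/2, 0)\<close> and fixed \<open>f\<close>.
\<close>

definition J_integral :: "complex \<Rightarrow> (real^2 \<Rightarrow> complex) \<Rightarrow> real \<Rightarrow> complex" where
  "J_integral z f \<phi> = 1 / (2 * c_fun z) *
     (LINT \<theta>:{-pi..pi}|lborel. f (circ \<theta>) * of_real \<bar>sin (\<theta> - \<phi>)\<bar> powr (- 1 - 2 * z))"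

text \<open>
  For \<open>l > 0\<close> the restriction of \<open>f\<close> to the unit circle is kept fixed, and the integral is
  continued analytically in \<open>z\<close> from the left half of the strip \<open>\<bar>Re z\<bar> < 1/2\<close> to the whole strip.
\<close>

definition J_circle :: "real \<Rightarrow> (real^2 \<Rightarrow> complex) \<Rightarrow> real \<Rightarrow> complex" where
  "J_circle l f \<phi> =
     (if l < 0 then J_integral (of_real l) f \<phi>
      else (THE w. \<exists>h. h holomorphic_on {z. \<bar>Re z\<bar> < 1 / 2} \<and>
              (\<forall>z. - 1 / 2 < Re z \<and> Re z < 0 \<longrightarrow> h z = J_integral z f \<phi>) \<and>
              w = h (of_real l)))"

text \<open>
  The function on the plane, homogeneous of degree \<open>2 \<zeta> - 1\<close> under positive dilations, with
  value \<open>u \<phi>\<close> at \<open>circ \<phi>\<close>, for \<open>u\<close> of period \<open>2 * pi\<close>.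
\<close>

definition homogeneous_ext :: "real \<Rightarrow> (real \<Rightarrow> complex) \<Rightarrow> real^2 \<Rightarrow> complex" where
  "homogeneous_ext \<zeta> u v =
     (if v = 0 then 0
      else of_real (norm v powr (2 * \<zeta> - 1)) * u (Arg (Complex (v $ 1) (v $ 2))))"

lemma homogeneous_ext_circ:
  assumes "\<And>x. u (x + 2 * pi) = u x"
  shows "homogeneous_ext \<zeta> u (circ \<phi>) = u \<phi>"
proof -
  have norm: "norm (circ \<phi>) = 1"
    by (simp add: circ_def norm_vec_def L2_set_def sum_2)
  then have nz: "circ \<phi> \<noteq> 0" by auto
  have per: "u (x + 2 * pi * of_int k) = u x" for x and k :: int
  proof (induction k rule: int_induct[where k = 0])
    case base then show ?case by simp
  next
    case (step1 i) then show ?case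
      using assms[of "x + 2 * pi * of_int i"] by (simp add: algebra_simps)
  next
    case (step2 i) then show ?case
      using assms[of "x + 2 * pi * of_int (i - 1)"] by (simp add: algebra_simps)
  qed
  have "Complex (circ \<phi> $ 1) (circ \<phi> $ 2) = cis \<phi>"
    by (simp add: circ_def complex_eq_iff)
  moreover have "cis (Arg (cis \<phi>)) = cis \<phi>"
    using cis_Arg[of "cis \<phi>"] by (simp add: sgn_eq)
  then have "sin (Arg (cis \<phi>)) = sin \<phi> \<and> cos (Arg (cis \<phi>)) = cos \<phi>"
    by (metis cis.sel)
  then obtain k :: int where "Arg (cis \<phi>) = \<phi> + 2 * pi * of_int k"
    by (metis sin_cos_eq_iff)
  ultimately show ?thesis
    using norm nz per by (simp add: homogeneous_ext_def)
qed

definition J_op :: "real \<Rightarrow> (real^2 \<Rightarrow> complex) \<Rightarrow> (real^2 \<Rightarrow> complex)" where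
  "J_op l f = homogeneous_ext (- l) (J_circle l f)"

lemma J_op_circ: "J_op l f (circ \<phi>) = J_circle l f \<phi>"
proof -
  have "\<bar>sin (\<theta> - (x + 2 * pi))\<bar> = \<bar>sin (\<theta> - x)\<bar>" for \<theta> x :: real
    using sin_periodic[of "\<theta> - (x + 2 * pi)"] by simp
  then have "J_integral z f (x + 2 * pi) = J_integral z f x" for z x
    by (simp add: J_integral_def)
  then show ?thesis
    unfolding J_op_def by (intro homogeneous_ext_circ) (simp add: J_circle_def)
qed

definition cs_space :: "real \<Rightarrow> (real^2 \<Rightarrow> complex) set" where
  "cs_space l = Vspace (of_real l) 0"

definition cs_ip :: "real \<Rightarrow> (real^2 \<Rightarrow> complex) \<Rightarrow> (real^2 \<Rightarrow> complex) \<Rightarrow> complex" where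
  "cs_ip l f g = pairing (J_op l f) (\<lambda>v. cnj (g v))"

definition cs_hilbert :: "real \<Rightarrow> (nat \<Rightarrow> real^2 \<Rightarrow> complex) set set" where
  "cs_hilbert l = completion (cs_space l) (cs_ip l)"

definition cs_rep :: "real \<Rightarrow> real^2^2
    \<Rightarrow> (nat \<Rightarrow> real^2 \<Rightarrow> complex) set \<Rightarrow> (nat \<Rightarrow> real^2 \<Rightarrow> complex) set" where
  "cs_rep l x = completion_ext (cs_space l) (cs_ip l) (rep x)"

end

theory Submission
  imports Defs "HOL-Complex_Analysis.Complex_Analysis"
begin

text \<open>
  On the circle, a vector is a Fourier series and \<open>k\<^sub>\<theta>\<close> multiplies the \<open>n\<close>-th coefficient by a
  character. Parseval in \<open>\<theta>\<^sub>1\<close> and then in \<open>\<theta>\<^sub>2\<close> turns the double integral into a sum over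
  \<open>n, m\<close> of squared products of a coefficient of \<open>f\<close>, one of \<open>g\<close> and the matrix coefficient
  \<open>M(n, m)\<close> of \<open>a\<^sub>r\<close> between the \<open>K\<close>-types \<open>m\<close> and \<open>n\<close>. So it suffices to bound \<open>M(n, m)\<close>
  uniformly in \<open>n\<close> and \<open>m\<close>.

  Principal series: \<open>M(n, m)\<close> is an oscillatory integral. After the substitution
  \<open>x = arctan (e\<^sup>t\<^sup>-\<^sup>r)\<close> its phase has derivative \<open>P / (2 V\<^sup>2)\<close>, where \<open>P\<close> is a combination of \<open>1\<close>,
  \<open>cosh t\<close> and \<open>sinh t\<close> with constant term \<open>a = s sinh 2r\<close>, so that \<open>P'' = P - a\<close>. Hence at each
  point either \<open>\<bar>P\<bar> \<ge> \<bar>a\<bar> / 2\<close>, where one integrates by parts, or \<open>\<bar>P''\<bar> \<ge> \<bar>a\<bar> / 2\<close>, which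
  happens only on intervals of bounded length.

  Complementary series: absolute values give \<open>\<bar>M(n, m)\<bar> \<le> e\<^sup>-\<^sup>(\<^sup>1\<^sup>-\<^sup>2\<^sup>\<bar>\<^sup>\<lambda>\<^sup>\<bar>\<^sup>)\<^sup>r / \<bar>\<lambda>\<bar>\<close> for both signs of \<open>\<lambda>\<close>.
  The operator \<open>J\<^sub>\<lambda>\<close> is diagonal with eigenvalues \<open>d(\<lambda>, n)\<close> and intertwines the actions, so
  \<open>d(\<lambda>, n) M\<^sub>\<lambda>(n, m) = d(\<lambda>, m) M\<^sub>-\<^sub>\<lambda>(n, m)\<close>, which converts the bounds for \<open>\<lambda>\<close> and \<open>-\<lambda>\<close> into
  one for \<open>M\<^sub>\<lambda>\<close> normalised by the weights \<open>d\<close>. By density everything extends to the completion.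
\<close>

section \<open>Semi-inner products and completions\<close>

text \<open>The bound on \<open>M(n, m)\<close> must be uniform in both K-types, so stationary
  points cannot be located: they depend on \<open>n\<close> and \<open>m\<close> and may degenerate.
  Only the constant term \<open>a\<close> of \<open>P\<close> is independent of them. In the
  variable \<open>t\<close> the amplitude is at most e^(-r), so a set of bounded length contributes
  O(e^(-r)); where |P| \<ge> |a|/2, integration by parts gives O(e^r / |a|), which is O(e^(-r) /
  |s|) for r \<ge> 1 because |a| is of size |s| e^(2r). Together this is the factor (|s| + 1)/|s|.

  In the complementary series the weights tend to infinity or to zero with the frequency, so a bound
  on \<open>M(n, m)\<close> alone says little about the normalised coefficient. Its modulus,
  however, is the geometric mean of those of the coefficients for \<lambda> and -\<lambda>, and both
  have the same bound.

  For \<lambda> > 0 the operator J is only given by analytic continuation. Two integrations by parts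
  produce one formula for both signs, which reads two derivatives; hence the work is done with
  \<pi>-periodic C2 functions on the line.\<close>

locale semi_ip =
  fixes W :: "('a \<Rightarrow> complex) set" and ip :: "('a \<Rightarrow> complex) \<Rightarrow> ('a \<Rightarrow> complex) \<Rightarrow> complex"
  assumes diff_mem: "\<And>f g. f \<in> W \<Longrightarrow> g \<in> W \<Longrightarrow> (\<lambda>v. f v - g v) \<in> W"
    and scale_mem: "\<And>c f. f \<in> W \<Longrightarrow> (\<lambda>v. c * f v) \<in> W"
    and ip_diff_left: "\<And>f g h. f \<in> W \<Longrightarrow> g \<in> W \<Longrightarrow> h \<in> W \<Longrightarrow> ip (\<lambda>v. f v - g v) h = ip f h - ip g h"
    and ip_scale_left: "\<And>c f h. f \<in> W \<Longrightarrow> h \<in> W \<Longrightarrow> ip (\<lambda>v. c * f v) h = c * ip f h"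
    and ip_cnj: "\<And>f g. f \<in> W \<Longrightarrow> g \<in> W \<Longrightarrow> ip g f = cnj (ip f g)"
    and ip_pos: "\<And>f. f \<in> W \<Longrightarrow> 0 \<le> Re (ip f f)"
begin

lemma ip_diff_right:
  assumes "f \<in> W" "g \<in> W" "h \<in> W"
  shows "ip h (\<lambda>v. f v - g v) = ip h f - ip h g"
  using assms by (simp add: ip_cnj[of _ h] diff_mem ip_diff_left)

lemma ip_scale_right:
  assumes "f \<in> W" "h \<in> W"
  shows "ip h (\<lambda>v. c * f v) = cnj c * ip h f"
  using assms by (simp add: ip_cnj[of _ h] scale_mem ip_scale_left)

lemma ip_self: "f \<in> W \<Longrightarrow> ip f f = of_real ((ip_norm ip f)\<^sup>2)"
  using ip_cnj[of f f] ip_pos[of f] by (simp add: ip_norm_def complex_eq_iff)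

lemma ip_norm_nonneg: "f \<in> W \<Longrightarrow> 0 \<le> ip_norm ip f"
  by (simp add: ip_norm_def ip_pos)

lemma ip_norm_diff_sq:
  assumes "f \<in> W" "g \<in> W"
  shows "(ip_norm ip (\<lambda>v. f v - g v))\<^sup>2 = (ip_norm ip f)\<^sup>2 + (ip_norm ip g)\<^sup>2 - 2 * Re (ip f g)"
proof -
  have "ip (\<lambda>v. f v - g v) (\<lambda>v. f v - g v) = ip f f - ip f g - (cnj (ip f g) - ip g g)"
    using assms by (simp add: ip_diff_left ip_diff_right diff_mem ip_cnj[of f g] algebra_simps)
  moreover have "(ip_norm ip (\<lambda>v. f v - g v))\<^sup>2 = Re (ip (\<lambda>v. f v - g v) (\<lambda>v. f v - g v))"
    using assms by (simp add: ip_self diff_mem)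
  ultimately show ?thesis using assms by (simp add: ip_self)
qed

text \<open>The form may be degenerate. Positivity of \<open>f - t g\<close> along the line
  \<open>t = c x\<close>, with \<open>c = ip f g\<close> and \<open>x\<close> real, gives a real
  quadratic in \<open>x\<close>, which is evaluated at \<open>x = 1 / B\<close> when
  \<open>B\<close> is nonzero.\<close>

lemma cauchy_schwarz:
  assumes "f \<in> W" "g \<in> W"
  shows "cmod (ip f g) \<le> ip_norm ip f * ip_norm ip g"
proof -
  define A B c where "A = (ip_norm ip f)\<^sup>2" and "B = (ip_norm ip g)\<^sup>2" and "c = ip f g"
  have key: "0 \<le> A - 2 * x * (cmod c)\<^sup>2 + x\<^sup>2 * (cmod c)\<^sup>2 * B" for x :: real
  proof -
    define t where "t = c * of_real x"
    have gW: "(\<lambda>v. t * g v) \<in> W" using assms by (simp add: scale_mem)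
    have "(ip_norm ip (\<lambda>v. t * g v))\<^sup>2 = Re (ip (\<lambda>v. t * g v) (\<lambda>v. t * g v))"
      using gW by (simp add: ip_self)
    also have "ip (\<lambda>v. t * g v) (\<lambda>v. t * g v) = t * cnj t * of_real B"
      using assms gW by (simp add: ip_scale_left ip_scale_right ip_self B_def)
    also have "Re \<dots> = (cmod t)\<^sup>2 * B"
      by (simp add: complex_mult_cnj cmod_def)
    finally have n2: "(ip_norm ip (\<lambda>v. t * g v))\<^sup>2 = x\<^sup>2 * (cmod c)\<^sup>2 * B"
      by (simp add: t_def norm_mult power_mult_distrib)
    have "Re (ip f (\<lambda>v. t * g v)) = Re (cnj t * c)"
      using assms by (simp add: ip_scale_right c_def)
    also have "\<dots> = x * (cmod c)\<^sup>2"
      by (simp add: t_def cmod_def power2_eq_square algebra_simps)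
    finally show ?thesis
      using ip_norm_diff_sq[OF assms(1) gW] n2 zero_le_power2[of "ip_norm ip (\<lambda>v. f v - t * g v)"]
      by (simp add: A_def)
  qed
  have "(cmod c)\<^sup>2 \<le> A * B"
  proof (cases "B = 0")
    case True
    \<comment> \<open>For \<open>B = 0\<close> the quadratic degenerates to
      \<open>A - 2 x |c|^2\<close>, which would equal -1 at the \<open>x\<close> chosen
      below.\<close>
    have "c = 0"
    proof (rule ccontr)
      assume "c \<noteq> 0"
      then have "2 * ((A + 1) / (2 * (cmod c)\<^sup>2)) * (cmod c)\<^sup>2 = A + 1" by simp
      with key[of "(A + 1) / (2 * (cmod c)\<^sup>2)"] True show False by simp
    qed
    then show ?thesis using True by simp
  next
    case False
    then have "B > 0" by (simp add: B_def)
    have e: "A - 2 * (1 / B) * (cmod c)\<^sup>2 + (1 / B)\<^sup>2 * (cmod c)\<^sup>2 * B = A - (cmod c)\<^sup>2 / B"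
      using \<open>B > 0\<close> by (simp add: field_simps power2_eq_square)
    have "0 \<le> A - (cmod c)\<^sup>2 / B" using key[of "1 / B"] unfolding e .
    then show ?thesis using \<open>B > 0\<close> by (simp add: field_simps)
  qed
  then have "(cmod c)\<^sup>2 \<le> (ip_norm ip f * ip_norm ip g)\<^sup>2"
    by (simp add: A_def B_def power_mult_distrib)
  then show ?thesis
    unfolding c_def by (rule power2_le_imp_le) (simp add: assms ip_norm_nonneg)
qed

lemma ip_norm_triangle_diff:
  assumes "f \<in> W" "g \<in> W"
  shows "ip_norm ip (\<lambda>v. f v - g v) \<le> ip_norm ip f + ip_norm ip g"
proof -
  have "- Re (ip f g) \<le> ip_norm ip f * ip_norm ip g"
    using cauchy_schwarz[OF assms] abs_Re_le_cmod[of "ip f g"] by linarith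
  then have "(ip_norm ip (\<lambda>v. f v - g v))\<^sup>2 \<le> (ip_norm ip f + ip_norm ip g)\<^sup>2"
    using ip_norm_diff_sq[OF assms] by (simp add: power2_sum)
  then show ?thesis
    by (rule power2_le_imp_le) (simp add: assms ip_norm_nonneg)
qed

lemma ip_norm_minus_commute:
  assumes "f \<in> W" "g \<in> W"
  shows "ip_norm ip (\<lambda>v. f v - g v) = ip_norm ip (\<lambda>v. g v - f v)"
proof -
  have "(ip_norm ip (\<lambda>v. f v - g v))\<^sup>2 = (ip_norm ip (\<lambda>v. g v - f v))\<^sup>2"
    using assms ip_cnj[of f g] by (simp add: ip_norm_diff_sq)
  then show ?thesis
    using assms ip_norm_nonneg diff_mem by (metis power2_eq_iff_nonneg)
qed

lemma ip_norm_triangle: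
  assumes "f \<in> W" "g \<in> W" "h \<in> W"
  shows "ip_norm ip (\<lambda>v. f v - h v) \<le> ip_norm ip (\<lambda>v. f v - g v) + ip_norm ip (\<lambda>v. g v - h v)"
proof -
  have "(\<lambda>v. f v - h v) = (\<lambda>v. (f v - g v) - (h v - g v))" by auto
  then show ?thesis
    using ip_norm_triangle_diff[OF diff_mem[OF assms(1,2)] diff_mem[OF assms(3,2)]]
      ip_norm_minus_commute[OF assms(2,3)] by metis
qed

lemma ip_norm_triangle_rev:
  assumes "f \<in> W" "g \<in> W"
  shows "\<bar>ip_norm ip f - ip_norm ip g\<bar> \<le> ip_norm ip (\<lambda>v. f v - g v)"
proof -
  have "ip_norm ip f \<le> ip_norm ip (\<lambda>v. f v - g v) + ip_norm ip g" if "f \<in> W" "g \<in> W" for f g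
  proof -
    have z: "(\<lambda>v. 0 * f v) \<in> W" using that by (simp only: scale_mem)
    from ip_norm_triangle[OF that(1,2) z] show ?thesis by simp
  qed
  from this[OF assms] this[OF assms(2,1)] show ?thesis
    using ip_norm_minus_commute[OF assms] by linarith
qed

section \<open>Completion of a subset \<open>V\<close> of \<open>W\<close>; the linear structure is
  only asked of \<open>W\<close>\<close>

context
  fixes V
  assumes VW: "V \<subseteq> W"
begin

lemma cauchy_seqs_mem: "F \<in> cauchy_seqs V ip \<Longrightarrow> F n \<in> V"
  by (simp add: cauchy_seqs_def)

lemma cauchy_seqs_memW: "F \<in> cauchy_seqs V ip \<Longrightarrow> F n \<in> W"
  using VW cauchy_seqs_mem by blast

lemma cauchy_seqs_bounded:
  assumes "F \<in> cauchy_seqs V ip"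
  obtains B where "\<And>n. ip_norm ip (F n) \<le> B" "0 \<le> B"
proof -
  obtain N where N: "\<And>m n. m \<ge> N \<Longrightarrow> n \<ge> N \<Longrightarrow> ip_norm ip (\<lambda>v. F m v - F n v) < 1"
    using assms zero_less_one unfolding cauchy_seqs_def by blast
  have "ip_norm ip (F n) \<le> 1 + (\<Sum>k\<le>N. ip_norm ip (F k))" for n
  proof (cases "n \<le> N")
    case True
    then have "ip_norm ip (F n) \<le> (\<Sum>k\<le>N. ip_norm ip (F k))"
      by (intro member_le_sum) (auto intro: ip_norm_nonneg cauchy_seqs_memW assms)
    then show ?thesis by simp
  next
    case False
    have "ip_norm ip (F N) \<le> (\<Sum>k\<le>N. ip_norm ip (F k))"
      by (intro member_le_sum) (auto intro: ip_norm_nonneg cauchy_seqs_memW assms)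
    moreover have "ip_norm ip (F n) \<le> ip_norm ip (F N) + 1"
      using ip_norm_triangle_rev[of "F n" "F N"] N[of n N] False assms
      by (simp add: cauchy_seqs_memW)
    ultimately show ?thesis by simp
  qed
  moreover have "0 \<le> 1 + (\<Sum>k\<le>N. ip_norm ip (F k))"
    by (intro add_nonneg_nonneg sum_nonneg) (auto intro: ip_norm_nonneg cauchy_seqs_memW assms)
  ultimately show ?thesis using that by blast
qed

text \<open>One factor changes at a time. This yields both the convergence of inner products along
  Cauchy sequences and the independence of the limit from the representatives.\<close>

lemma ip_diff_bound:
  assumes "f \<in> W" "f' \<in> W" "g \<in> W" "g' \<in> W"
  shows "cmod (ip f g - ip f' g') \<le> ip_norm ip (\<lambda>v. f v - f' v) * ip_norm ip g
     + ip_norm ip f' * ip_norm ip (\<lambda>v. g v - g' v)"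
proof -
  have "ip f g - ip f' g' = ip (\<lambda>v. f v - f' v) g + ip f' (\<lambda>v. g v - g' v)"
    using assms by (simp add: ip_diff_left ip_diff_right)
  also have "cmod \<dots> \<le> cmod (ip (\<lambda>v. f v - f' v) g) + cmod (ip f' (\<lambda>v. g v - g' v))"
    by (rule norm_triangle_ineq)
  also have "\<dots> \<le> ip_norm ip (\<lambda>v. f v - f' v) * ip_norm ip g + ip_norm ip f' * ip_norm ip (\<lambda>v. g v - g' v)"
    using assms by (intro add_mono cauchy_schwarz) (auto simp: diff_mem)
  finally show ?thesis .
qed

lemma cauchy_ip_convergent:
  assumes F: "F \<in> cauchy_seqs V ip" and G: "G \<in> cauchy_seqs V ip"
  shows "convergent (\<lambda>n. ip (F n) (G n))"
proof -
  obtain A where A: "\<And>n. ip_norm ip (F n) \<le> A" "0 \<le> A" using cauchy_seqs_bounded[OF F] by blast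
  obtain B where B: "\<And>n. ip_norm ip (G n) \<le> B" "0 \<le> B" using cauchy_seqs_bounded[OF G] by blast
  have "Cauchy (\<lambda>n. ip (F n) (G n))"
  proof (rule metric_CauchyI)
    fix e :: real assume e: "0 < e"
    define d where "d = e / (A + B + 1)"
    have d: "d > 0" using e A B by (simp add: d_def)
    obtain M where M: "\<And>m n. m \<ge> M \<Longrightarrow> n \<ge> M \<Longrightarrow> ip_norm ip (\<lambda>v. F m v - F n v) < d"
      using F d unfolding cauchy_seqs_def by blast
    obtain N where N: "\<And>m n. m \<ge> N \<Longrightarrow> n \<ge> N \<Longrightarrow> ip_norm ip (\<lambda>v. G m v - G n v) < d"
      using G d unfolding cauchy_seqs_def by blast
    have "dist (ip (F m) (G m)) (ip (F n) (G n)) < e" if "m \<ge> max M N" "n \<ge> max M N" for m n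
    proof -
      have "cmod (ip (F m) (G m) - ip (F n) (G n)) \<le> ip_norm ip (\<lambda>v. F m v - F n v) * ip_norm ip (G m)
     + ip_norm ip (F n) * ip_norm ip (\<lambda>v. G m v - G n v)"
        using F G by (intro ip_diff_bound cauchy_seqs_memW)
      also have "\<dots> \<le> d * B + A * d"
        using M[of m n] N[of m n] that d A B F G
        by (intro add_mono mult_mono ip_norm_nonneg diff_mem cauchy_seqs_memW) auto
      also have "\<dots> < d * (A + B + 1)" using d by (simp add: algebra_simps)
      also have "\<dots> = e" using A B by (simp add: d_def)
      finally show ?thesis by (simp add: dist_norm)
    qed
    then show "\<exists>M. \<forall>m\<ge>M. \<forall>n\<ge>M. dist (ip (F m) (G m)) (ip (F n) (G n)) < e" by blast
  qed
  then show ?thesis by (simp add: Cauchy_convergent_iff)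
qed

lemma cauchy_rel_ip_limit:
  assumes "(F, F') \<in> cauchy_rel V ip" "(G, G') \<in> cauchy_rel V ip"
    "(\<lambda>n. ip (F n) (G n)) \<longlonglongrightarrow> c"
  shows "(\<lambda>n. ip (F' n) (G' n)) \<longlonglongrightarrow> c"
proof -
  have F: "F \<in> cauchy_seqs V ip" "F' \<in> cauchy_seqs V ip" "(\<lambda>n. ip_norm ip (\<lambda>v. F n v - F' n v)) \<longlonglongrightarrow> 0"
    and G: "G \<in> cauchy_seqs V ip" "G' \<in> cauchy_seqs V ip" "(\<lambda>n. ip_norm ip (\<lambda>v. G n v - G' n v)) \<longlonglongrightarrow> 0"
    using assms by (auto simp: cauchy_rel_def)
  obtain A where A: "\<And>n. ip_norm ip (F' n) \<le> A" "0 \<le> A" using cauchy_seqs_bounded[OF F(2)] by blast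
  obtain B where B: "\<And>n. ip_norm ip (G n) \<le> B" "0 \<le> B" using cauchy_seqs_bounded[OF G(1)] by blast
  have "(\<lambda>n. ip (F n) (G n) - ip (F' n) (G' n)) \<longlonglongrightarrow> 0"
  proof (rule Lim_null_comparison)
    show "(\<lambda>n. ip_norm ip (\<lambda>v. F n v - F' n v) * B + A * ip_norm ip (\<lambda>v. G n v - G' n v)) \<longlonglongrightarrow> 0"
      using F(3) G(3) by (auto intro!: tendsto_eq_intros)
    have "cmod (ip (F n) (G n) - ip (F' n) (G' n)) \<le> ip_norm ip (\<lambda>v. F n v - F' n v) * B + A * ip_norm ip (\<lambda>v. G n v - G' n v)" for n
    proof -
      have "cmod (ip (F n) (G n) - ip (F' n) (G' n)) \<le> ip_norm ip (\<lambda>v. F n v - F' n v) * ip_norm ip (G n)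
     + ip_norm ip (F' n) * ip_norm ip (\<lambda>v. G n v - G' n v)"
        using F G by (intro ip_diff_bound cauchy_seqs_memW)
      also have "\<dots> \<le> ip_norm ip (\<lambda>v. F n v - F' n v) * B + A * ip_norm ip (\<lambda>v. G n v - G' n v)"
        using A B F G by (intro add_mono mult_mono ip_norm_nonneg diff_mem cauchy_seqs_memW) auto
      finally show ?thesis .
    qed
    then show "\<forall>\<^sub>F n in sequentially. cmod (ip (F n) (G n) - ip (F' n) (G' n)) \<le> ip_norm ip (\<lambda>v. F n v - F' n v) * B + A * ip_norm ip (\<lambda>v. G n v - G' n v)"
      by simp
  qed
  from tendsto_diff[OF assms(3) this] show ?thesis by simp
qed

lemma ip_norm_zero: "f \<in> W \<Longrightarrow> ip_norm ip (\<lambda>v. f v - f v) = 0"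
  using ip_norm_diff_sq[of f f] by (simp add: ip_self del: diff_self)

lemma cauchy_rel_refl: "F \<in> cauchy_seqs V ip \<Longrightarrow> (F, F) \<in> cauchy_rel V ip"
  using ip_norm_zero[OF cauchy_seqs_memW] by (auto simp: cauchy_rel_def)

lemma cauchy_rel_trans:
  assumes "(F, G) \<in> cauchy_rel V ip" "(G, H) \<in> cauchy_rel V ip"
  shows "(F, H) \<in> cauchy_rel V ip"
proof -
  have mem: "F \<in> cauchy_seqs V ip" "G \<in> cauchy_seqs V ip" "H \<in> cauchy_seqs V ip"
    using assms by (auto simp: cauchy_rel_def)
  have "(\<lambda>n. ip_norm ip (\<lambda>v. F n v - H n v)) \<longlonglongrightarrow> 0"
  proof (rule Lim_null_comparison)
    show "(\<lambda>n. ip_norm ip (\<lambda>v. F n v - G n v) + ip_norm ip (\<lambda>v. G n v - H n v)) \<longlonglongrightarrow> 0"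
      using assms by (auto simp: cauchy_rel_def intro!: tendsto_add_zero)
    show "\<forall>\<^sub>F n in sequentially. norm (ip_norm ip (\<lambda>v. F n v - H n v))
      \<le> ip_norm ip (\<lambda>v. F n v - G n v) + ip_norm ip (\<lambda>v. G n v - H n v)"
      using mem ip_norm_triangle ip_norm_nonneg by (simp add: cauchy_seqs_memW diff_mem)
  qed
  then show ?thesis using mem by (simp add: cauchy_rel_def)
qed

lemma completion_rep:
  assumes "X \<in> completion V ip"
  obtains F where "F \<in> cauchy_seqs V ip" "X = cauchy_rel V ip `` {F}"
  using assms by (auto simp: completion_def elim: quotientE)

lemma completion_inner_limit:
  assumes F: "F \<in> cauchy_seqs V ip" and G: "G \<in> cauchy_seqs V ip"
  shows "(\<lambda>n. ip (F n) (G n)) \<longlonglongrightarrow>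
    completion_inner ip (cauchy_rel V ip `` {F}) (cauchy_rel V ip `` {G})"
proof -
  obtain c where c: "(\<lambda>n. ip (F n) (G n)) \<longlonglongrightarrow> c"
    using cauchy_ip_convergent[OF F G] by (auto simp: convergent_def)
  have "completion_inner ip (cauchy_rel V ip `` {F}) (cauchy_rel V ip `` {G}) = c"
    unfolding completion_inner_def
  proof (rule the_equality)
    show "\<forall>F'\<in>cauchy_rel V ip `` {F}. \<forall>G'\<in>cauchy_rel V ip `` {G}. (\<lambda>n. ip (F' n) (G' n)) \<longlonglongrightarrow> c"
      using cauchy_rel_ip_limit c by blast
    show "c' = c" if "\<forall>F'\<in>cauchy_rel V ip `` {F}. \<forall>G'\<in>cauchy_rel V ip `` {G}. (\<lambda>n. ip (F' n) (G' n)) \<longlonglongrightarrow> c'" for c'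
      using that cauchy_rel_refl[OF F] cauchy_rel_refl[OF G] LIMSEQ_unique[OF _ c] by blast
  qed
  with c show ?thesis by simp
qed

lemma completion_norm_limit:
  assumes F: "F \<in> cauchy_seqs V ip"
  shows "(\<lambda>n. ip_norm ip (F n)) \<longlonglongrightarrow> completion_norm ip (cauchy_rel V ip `` {F})"
  unfolding completion_norm_def ip_norm_def
  by (intro tendsto_intros completion_inner_limit F)

context
  fixes T
  assumes TV: "\<And>f. f \<in> V \<Longrightarrow> T f \<in> V"
    and T_lip: "\<And>f g. f \<in> V \<Longrightarrow> g \<in> V \<Longrightarrow> ip_norm ip (\<lambda>v. T f v - T g v) \<le> ip_norm ip (\<lambda>v. f v - g v)"
begin

lemma cauchy_seqs_operator:
  assumes "F \<in> cauchy_seqs V ip"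
  shows "(\<lambda>n. T (F n)) \<in> cauchy_seqs V ip"
proof -
  have "F n \<in> V" for n using assms by (rule cauchy_seqs_mem)
  moreover have "\<exists>N. \<forall>m\<ge>N. \<forall>n\<ge>N. ip_norm ip (\<lambda>v. T (F m) v - T (F n) v) < e" if "e > 0" for e
  proof -
    obtain N where "\<forall>m\<ge>N. \<forall>n\<ge>N. ip_norm ip (\<lambda>v. F m v - F n v) < e"
      using assms \<open>e > 0\<close> by (auto simp: cauchy_seqs_def)
    then show ?thesis
      using le_less_trans[OF T_lip[OF calculation calculation]] by blast
  qed
  ultimately show ?thesis by (simp add: cauchy_seqs_def TV)
qed

text \<open>The images \<open>T (F' n)\<close> of the members of a class need not fill a class;
  \<open>completion_ext\<close> saturates them under \<open>cauchy_rel\<close>. As \<open>T\<close>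
  is not assumed linear, a Lipschitz bound takes the place of boundedness.\<close>

lemma completion_ext_class:
  assumes F: "F \<in> cauchy_seqs V ip"
  shows "completion_ext V ip T (cauchy_rel V ip `` {F}) = cauchy_rel V ip `` {\<lambda>n. T (F n)}"
proof -
  have rel: "((\<lambda>n. T (F n)), (\<lambda>n. T (F' n))) \<in> cauchy_rel V ip" if "(F, F') \<in> cauchy_rel V ip" for F'
  proof -
    have F': "F' \<in> cauchy_seqs V ip" using that by (auto simp: cauchy_rel_def)
    have "(\<lambda>n. ip_norm ip (\<lambda>v. T (F n) v - T (F' n) v)) \<longlonglongrightarrow> 0"
    proof (rule Lim_null_comparison)
      show "(\<lambda>n. ip_norm ip (\<lambda>v. F n v - F' n v)) \<longlonglongrightarrow> 0"
        using that by (simp add: cauchy_rel_def)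
      have "T (F n) \<in> W" "T (F' n) \<in> W" for n
        using F F' TV cauchy_seqs_mem VW by blast+
      then show "\<forall>\<^sub>F n in sequentially. norm (ip_norm ip (\<lambda>v. T (F n) v - T (F' n) v))
          \<le> ip_norm ip (\<lambda>v. F n v - F' n v)"
        using T_lip cauchy_seqs_mem[OF F] cauchy_seqs_mem[OF F'] ip_norm_nonneg
        by (simp add: diff_mem)
    qed
    then show ?thesis using F F' by (simp add: cauchy_rel_def cauchy_seqs_operator)
  qed
  show ?thesis
  proof (intro equalityI subsetI)
    fix H assume "H \<in> completion_ext V ip T (cauchy_rel V ip `` {F})"
    then obtain F' where "(F, F') \<in> cauchy_rel V ip" "(\<lambda>n. T (F' n), H) \<in> cauchy_rel V ip"
      by (auto simp: completion_ext_def)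
    with rel cauchy_rel_trans show "H \<in> cauchy_rel V ip `` {\<lambda>n. T (F n)}" by blast
  next
    fix H assume "H \<in> cauchy_rel V ip `` {\<lambda>n. T (F n)}"
    then show "H \<in> completion_ext V ip T (cauchy_rel V ip `` {F})"
      using cauchy_rel_refl[OF F] by (auto simp: completion_ext_def)
  qed
qed

end

text \<open>Along representatives the coefficients converge for every \<open>p\<close>, and
  Cauchy-Schwarz with the contraction property bounds them by one constant. On a set of finite
  measure, dominated convergence carries the square integral and its bound to the limit.\<close>

lemma completion_coefficient_bound:
  fixes T :: "'p::euclidean_space \<Rightarrow> ('a \<Rightarrow> complex) \<Rightarrow> ('a \<Rightarrow> complex)"
  assumes TV: "\<And>p f. f \<in> V \<Longrightarrow> T p f \<in> V"
    and T_contr: "\<And>p f. f \<in> V \<Longrightarrow> ip_norm ip (T p f) \<le> ip_norm ip f"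
    and T_lip: "\<And>p f g. f \<in> V \<Longrightarrow> g \<in> V \<Longrightarrow>
      ip_norm ip (\<lambda>v. T p f v - T p g v) \<le> ip_norm ip (\<lambda>v. f v - g v)"
    and meas: "\<And>f g. f \<in> V \<Longrightarrow> g \<in> V \<Longrightarrow> (\<lambda>p. ip (T p f) g) \<in> borel_measurable borel"
    and bound: "\<And>f g. f \<in> V \<Longrightarrow> g \<in> V \<Longrightarrow>
      (LINT p:S|lborel. (cmod (ip (T p f) g))\<^sup>2) \<le> (B * ip_norm ip f * ip_norm ip g)\<^sup>2"
    and S: "S \<in> sets borel" "emeasure lborel S < \<infinity>" and B: "0 \<le> B"
    and X: "X \<in> completion V ip" and Y: "Y \<in> completion V ip"
  shows "set_integrable lborel S (\<lambda>p. (cmod (completion_inner ip (completion_ext V ip (T p) X) Y))\<^sup>2)"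
    and "sqrt (LINT p:S|lborel. (cmod (completion_inner ip (completion_ext V ip (T p) X) Y))\<^sup>2)
      \<le> B * completion_norm ip X * completion_norm ip Y"
proof -
  obtain F where F: "F \<in> cauchy_seqs V ip" "X = cauchy_rel V ip `` {F}"
    using completion_rep[OF X] .
  obtain G where G: "G \<in> cauchy_seqs V ip" "Y = cauchy_rel V ip `` {G}"
    using completion_rep[OF Y] .
  obtain A where A: "\<And>n. ip_norm ip (F n) \<le> A" "0 \<le> A" using cauchy_seqs_bounded[OF F(1)] by blast
  obtain A' where A': "\<And>n. ip_norm ip (G n) \<le> A'" "0 \<le> A'" using cauchy_seqs_bounded[OF G(1)] by blast
  define m where "m p = completion_inner ip (completion_ext V ip (T p) X) Y" for p
  define mn where "mn n p = ip (T p (F n)) (G n)" for n p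
  have FV: "F n \<in> V" and GV: "G n \<in> V" for n
    by (rule cauchy_seqs_mem[OF F(1)], rule cauchy_seqs_mem[OF G(1)])
  have lim: "(\<lambda>n. mn n p) \<longlonglongrightarrow> m p" for p
  proof -
    have "completion_ext V ip (T p) X = cauchy_rel V ip `` {\<lambda>n. T p (F n)}"
      unfolding F(2) by (rule completion_ext_class) (fact TV T_lip F(1))+
    moreover have "(\<lambda>n. T p (F n)) \<in> cauchy_seqs V ip"
      by (rule cauchy_seqs_operator) (fact TV T_lip F(1))+
    ultimately show ?thesis
      using completion_inner_limit[OF _ G(1)] by (simp add: m_def mn_def G(2))
  qed
  have mnm: "mn n \<in> borel_measurable borel" for n
    unfolding mn_def using meas FV GV by simp
  have mm: "m \<in> borel_measurable borel"
    by (rule borel_measurable_LIMSEQ_metric[OF mnm lim])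
  have bnd: "cmod (mn n p) \<le> A * A'" for n p
  proof -
    have "cmod (mn n p) \<le> ip_norm ip (T p (F n)) * ip_norm ip (G n)"
      unfolding mn_def by (rule cauchy_schwarz[OF subsetD[OF VW TV[OF FV]] subsetD[OF VW GV]])
    also have "\<dots> \<le> A * A'"
      by (rule mult_mono[OF order_trans[OF T_contr[OF FV] A(1)] A'(1) A(2)
            ip_norm_nonneg[OF subsetD[OF VW GV]]])
    finally show ?thesis .
  qed
  have dom: "integrable lborel (\<lambda>p. indicator S p *\<^sub>R (A * A')\<^sup>2)"
    using S by (auto simp: integrable_indicator_iff)
  have conv: "integrable lborel (\<lambda>p. indicator S p *\<^sub>R (cmod (m p))\<^sup>2)"
    "(\<lambda>n. \<integral>p. indicator S p *\<^sub>R (cmod (mn n p))\<^sup>2 \<partial>lborel) \<longlonglongrightarrow> (\<integral>p. indicator S p *\<^sub>R (cmod (m p))\<^sup>2 \<partial>lborel)"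
  proof -
    have 1: "(\<lambda>p. indicator S p *\<^sub>R (cmod (m p))\<^sup>2) \<in> borel_measurable lborel"
      "\<And>n. (\<lambda>p. indicator S p *\<^sub>R (cmod (mn n p))\<^sup>2) \<in> borel_measurable lborel"
      using mm mnm S by simp_all
    have 2: "AE p in lborel. (\<lambda>n. indicator S p *\<^sub>R (cmod (mn n p))\<^sup>2) \<longlonglongrightarrow> indicator S p *\<^sub>R (cmod (m p))\<^sup>2"
      using lim by (auto intro!: tendsto_intros)
    have 3: "AE p in lborel. norm (indicator S p *\<^sub>R (cmod (mn n p))\<^sup>2) \<le> indicator S p *\<^sub>R (A * A')\<^sup>2" for n
      using bnd[of n] by (auto simp: indicator_def intro!: power_mono)
    show "integrable lborel (\<lambda>p. indicator S p *\<^sub>R (cmod (m p))\<^sup>2)"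
      "(\<lambda>n. \<integral>p. indicator S p *\<^sub>R (cmod (mn n p))\<^sup>2 \<partial>lborel) \<longlonglongrightarrow> (\<integral>p. indicator S p *\<^sub>R (cmod (m p))\<^sup>2 \<partial>lborel)"
      using integrable_dominated_convergence[OF 1 dom 2 3] integral_dominated_convergence[OF 1 dom 2 3] by auto
  qed
  show "set_integrable lborel S (\<lambda>p. (cmod (completion_inner ip (completion_ext V ip (T p) X) Y))\<^sup>2)"
    using conv(1) by (simp add: set_integrable_def m_def)
  have "(\<lambda>n. (B * ip_norm ip (F n) * ip_norm ip (G n))\<^sup>2) \<longlonglongrightarrow> (B * completion_norm ip X * completion_norm ip Y)\<^sup>2"
    unfolding F(2) G(2) by (intro tendsto_intros completion_norm_limit F(1) G(1))
  then have le: "(LINT p:S|lborel. (cmod (m p))\<^sup>2) \<le> (B * completion_norm ip X * completion_norm ip Y)\<^sup>2"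
    unfolding set_lebesgue_integral_def
  proof (rule LIMSEQ_le[OF conv(2)])
    show "\<exists>N. \<forall>n\<ge>N. (\<integral>p. indicator S p *\<^sub>R (cmod (mn n p))\<^sup>2 \<partial>lborel) \<le> (B * ip_norm ip (F n) * ip_norm ip (G n))\<^sup>2"
      using bound[OF FV GV] by (auto simp: set_lebesgue_integral_def mn_def)
  qed
  have "0 \<le> completion_norm ip X" "0 \<le> completion_norm ip Y"
    using F G ip_norm_nonneg cauchy_seqs_memW
    by (auto intro!: LIMSEQ_le_const[OF completion_norm_limit])
  with le B show "sqrt (LINT p:S|lborel. (cmod (completion_inner ip (completion_ext V ip (T p) X) Y))\<^sup>2)
      \<le> B * completion_norm ip X * completion_norm ip Y"
    by (intro real_le_lsqrt) (auto simp: m_def)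
qed

end

end

section \<open>Fourier series on the circle\<close>

definition char_fun :: "int \<Rightarrow> real \<Rightarrow> complex" where
  "char_fun n x = cis (of_int n * x)"

text \<open>Functions on the circle are represented by periodic functions on the line, so that
  derivatives, substitutions and continuous lifts of the angle are those of one real
  variable.\<close>

definition cper :: "(real \<Rightarrow> complex) set" where
  "cper = {f. continuous_on UNIV f \<and> (\<forall>x. f (x + 2 * pi) = f x)}"

text \<open>The factor makes the characters orthonormal. On restrictions to the unit circle,
  \<open>pairing\<close> against a conjugate is \<pi> times this form.\<close>

definition l2_ip :: "(real \<Rightarrow> complex) \<Rightarrow> (real \<Rightarrow> complex) \<Rightarrow> complex" where
  "l2_ip f g = integral {-pi..pi} (\<lambda>x. f x * cnj (g x)) / (2 * pi)"

definition fcoeff :: "(real \<Rightarrow> complex) \<Rightarrow> int \<Rightarrow> complex" where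
  "fcoeff f n = l2_ip f (char_fun n)"

lemma cper_continuous: "f \<in> cper \<Longrightarrow> continuous_on S f"
  by (auto simp: cper_def intro: continuous_on_subset)

lemma cper_periodic: "f \<in> cper \<Longrightarrow> f (x + 2 * pi) = f x"
  by (auto simp: cper_def)

lemma cper_periodic_int:
  assumes "f \<in> cper"
  shows "f (x + 2 * pi * of_int k) = f x"
proof (induction k rule: int_induct[where k = 0])
  case (step1 i)
  then show ?case using cper_periodic[OF assms, of "x + 2 * pi * of_int i"] by (simp add: algebra_simps)
next
  case (step2 i)
  then show ?case using cper_periodic[OF assms, of "x + 2 * pi * of_int (i - 1)"] by (simp add: algebra_simps)
qed simp

lemma char_fun_cper: "char_fun n \<in> cper"
proof -
  have "cis (of_int n * (x + 2 * pi)) = cis (of_int n * x)" for x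
  proof -
    have "cis (of_int n * (x + 2 * pi)) = cis (of_int n * x) * cis (2 * pi * of_int n)"
      by (simp add: cis_mult algebra_simps)
    then show ?thesis by simp
  qed
  then show ?thesis
    by (auto simp: cper_def char_fun_def intro!: continuous_intros)
qed

lemma cnj_char_fun: "cnj (char_fun n x) = char_fun (- n) x"
  by (simp add: char_fun_def cis_cnj)

lemma norm_char_fun [simp]: "cmod (char_fun n x) = 1"
  by (simp add: char_fun_def)

lemma char_fun_add: "char_fun n (x + y) = char_fun n x * char_fun n y"
  by (simp add: char_fun_def cis_mult algebra_simps)

lemma char_fun_mult: "char_fun m x * char_fun n x = char_fun (m + n) x"
  by (simp add: char_fun_def cis_mult algebra_simps)

lemma char_fun_minus_arg: "char_fun n (- x) = char_fun (- n) x"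
  by (simp add: char_fun_def)

lemma cper_add: "f \<in> cper \<Longrightarrow> g \<in> cper \<Longrightarrow> (\<lambda>x. f x + g x) \<in> cper"
  and cper_diff: "f \<in> cper \<Longrightarrow> g \<in> cper \<Longrightarrow> (\<lambda>x. f x - g x) \<in> cper"
  and cper_mult: "f \<in> cper \<Longrightarrow> g \<in> cper \<Longrightarrow> (\<lambda>x. f x * g x) \<in> cper"
  and cper_const: "(\<lambda>x. c) \<in> cper"
  and cper_cnj: "f \<in> cper \<Longrightarrow> (\<lambda>x. cnj (f x)) \<in> cper"
  by (auto simp: cper_def intro!: continuous_intros)

lemma cper_scale: "f \<in> cper \<Longrightarrow> (\<lambda>x. c * f x) \<in> cper"
  by (simp add: cper_mult cper_const)

lemma cper_sum: "(\<And>i. i \<in> I \<Longrightarrow> f i \<in> cper) \<Longrightarrow> (\<lambda>x. \<Sum>i\<in>I. f i x) \<in> cper"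
  by (auto simp: cper_def intro!: continuous_intros)

lemma cper_shift: "f \<in> cper \<Longrightarrow> (\<lambda>x. f (x + a)) \<in> cper"
  by (auto simp: cper_def algebra_simps intro!: continuous_on_compose2[of UNIV f] continuous_intros)
    (metis add.assoc add.commute)

lemma integral_periodic_shift:
  assumes f: "f \<in> cper"
  shows "integral {-pi..pi} (\<lambda>x. f (x + a)) = integral {-pi..pi} f"
proof -
  \<comment> \<open>Reduction of \<open>a\<close> modulo the period to \<open>b\<close> in
    [0, 2 \<pi>]; then only the piece from \<pi> to \<pi> + b sticks out and is moved back by one
    period.\<close>
  define b where "b = a - 2 * pi * of_int \<lfloor>a / (2 * pi)\<rfloor>"
  have b: "0 \<le> b" "b \<le> 2 * pi"
  proof -
    have "of_int \<lfloor>a / (2 * pi)\<rfloor> * (2 * pi) \<le> a" "a < (of_int \<lfloor>a / (2 * pi)\<rfloor> + 1) * (2 * pi)"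
      by (intro floor_divide_lower floor_divide_upper; simp)+
    then show "0 \<le> b" "b \<le> 2 * pi" by (auto simp: b_def algebra_simps)
  qed
  have int: "f integrable_on {u..v}" for u v
    using f by (intro integrable_continuous_interval cper_continuous)
  have shift: "integral {u..v} (\<lambda>x. f (x + c)) = integral {u + c..v + c} f" for u v c
    using integral_shift[of u c v f] f by (simp add: o_def cper_continuous)
  have "f (x + a) = f (x + b)" for x
    using cper_periodic_int[OF f, of "x + b" "\<lfloor>a / (2 * pi)\<rfloor>"] by (simp add: b_def algebra_simps)
  then have "integral {-pi..pi} (\<lambda>x. f (x + a)) = integral {-pi + b..pi + b} f"
    using shift[of "-pi" pi b] by simp
  also have "\<dots> = integral {-pi + b..pi} f + integral {pi..pi + b} f"
    using b by (intro Henstock_Kurzweil_Integration.integral_combine[symmetric] int) auto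
  also have "integral {pi..pi + b} f = integral {-pi..-pi + b} (\<lambda>x. f (x + 2 * pi))"
    using shift[of "-pi" "-pi + b" "2 * pi"] by (simp add: algebra_simps)
  also have "\<dots> = integral {-pi..-pi + b} f"
    using cper_periodic[OF f] by simp
  also have "integral {-pi + b..pi} f + integral {-pi..-pi + b} f = integral {-pi..pi} f"
    using b Henstock_Kurzweil_Integration.integral_combine[of "-pi" "-pi + b" pi f] int by (simp add: add.commute)
  finally show ?thesis .
qed

text \<open>Translation by \<pi> / n leaves the integral unchanged and turns the character into its
  negative.\<close>

lemma integral_char_fun: "integral {-pi..pi} (char_fun n) = (if n = 0 then 2 * pi else 0)"
proof (cases "n = 0")
  case True
  have "integral {-pi..pi} (\<lambda>x. 1 :: complex) = 2 * pi"
    by (simp add: scaleR_conv_of_real)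
  then show ?thesis using True by (simp add: char_fun_def[abs_def] del: integral_const_real)
next
  case False
  have "integral {-pi..pi} (char_fun n) = integral {-pi..pi} (\<lambda>x. char_fun n (x + pi / of_int n))"
    by (simp add: integral_periodic_shift char_fun_cper)
  also have "\<dots> = integral {-pi..pi} (\<lambda>x. - char_fun n x)"
    using False by (simp add: char_fun_add) (simp add: char_fun_def)
  finally show ?thesis using False by simp
qed

lemma integral_mult_cnj_self:
  assumes "f \<in> cper"
  shows "integral {-pi..pi} (\<lambda>x. f x * cnj (f x)) = of_real (integral {-pi..pi} (\<lambda>x. (cmod (f x))\<^sup>2))"
proof -
  have "(\<lambda>x. (cmod (f x))\<^sup>2) integrable_on {-pi..pi}"
    by (intro integrable_continuous_interval continuous_intros cper_continuous assms)
  then have "((\<lambda>x. of_real ((cmod (f x))\<^sup>2)) has_integral complex_of_real (integral {-pi..pi} (\<lambda>x. (cmod (f x))\<^sup>2))) {-pi..pi}"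
    by (intro has_integral_of_real integrable_integral)
  then show ?thesis by (simp only: complex_norm_square integral_unique)
qed

interpretation L2: semi_ip cper l2_ip
proof
  fix f g h :: "real \<Rightarrow> complex" and c
  assume f: "f \<in> cper" and g: "g \<in> cper"
  have int: "(\<lambda>x. u x * cnj (v x)) integrable_on {-pi..pi}" if "u \<in> cper" "v \<in> cper" for u v
    using that by (intro integrable_continuous_interval cper_continuous cper_mult cper_cnj)
  show "(\<lambda>v. f v - g v) \<in> cper" using f g by (rule cper_diff)
  show "(\<lambda>v. c * f v) \<in> cper" using f by (rule cper_scale)
  show "l2_ip (\<lambda>v. f v - g v) h = l2_ip f h - l2_ip g h" if "h \<in> cper"
    using f g that by (simp add: l2_ip_def left_diff_distrib int integral_diff diff_divide_distrib)
  show "l2_ip (\<lambda>v. c * f v) h = c * l2_ip f h"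
    by (simp add: l2_ip_def mult.assoc)
  have "cnj (integral {-pi..pi} (\<lambda>x. f x * cnj (g x))) = integral {-pi..pi} (\<lambda>x. cnj (f x * cnj (g x)))"
    by (rule integral_cnj)
  then show "l2_ip g f = cnj (l2_ip f g)"
    by (simp add: l2_ip_def mult.commute)
  have "0 \<le> integral {-pi..pi} (\<lambda>x. (cmod (f x))\<^sup>2)"
    by (intro integral_nonneg integrable_continuous_interval continuous_intros cper_continuous f) auto
  then show "0 \<le> Re (l2_ip f f)"
    using integral_mult_cnj_self[OF f] by (simp add: l2_ip_def)
qed

lemma l2_self: "f \<in> cper \<Longrightarrow> l2_ip f f = of_real (integral {-pi..pi} (\<lambda>x. (cmod (f x))\<^sup>2) / (2 * pi))"
  by (simp add: l2_ip_def integral_mult_cnj_self)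

lemma l2_norm_sq: "f \<in> cper \<Longrightarrow> (ip_norm l2_ip f)\<^sup>2 = integral {-pi..pi} (\<lambda>x. (cmod (f x))\<^sup>2) / (2 * pi)"
  using L2.ip_self[of f] l2_self[of f] of_real_eq_iff by metis

lemma l2_norm_le:
  assumes f: "f \<in> cper" and b: "\<And>x. cmod (f x) \<le> b"
  shows "ip_norm l2_ip f \<le> b"
proof -
  have "0 \<le> b" using order_trans[OF norm_ge_zero b[of 0]] .
  have "integral {-pi..pi} (\<lambda>x. (cmod (f x))\<^sup>2) \<le> integral {-pi..pi} (\<lambda>x. b\<^sup>2)"
    by (intro integral_le integrable_continuous_interval continuous_intros cper_continuous f power_mono b) auto
  then have "(ip_norm l2_ip f)\<^sup>2 \<le> b\<^sup>2"
    by (simp add: l2_norm_sq[OF f] field_simps)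
  then show ?thesis using \<open>0 \<le> b\<close> by (rule power2_le_imp_le)
qed

lemma l2_char_fun: "l2_ip (char_fun m) (char_fun n) = (if m = n then 1 else 0)"
  by (simp add: l2_ip_def cnj_char_fun char_fun_mult integral_char_fun)

section \<open>Trigonometric sums, their density, and Parseval's identity\<close>

definition trig_sum :: "int set \<Rightarrow> (int \<Rightarrow> complex) \<Rightarrow> real \<Rightarrow> complex" where
  "trig_sum F c x = (\<Sum>n\<in>F. c n * char_fun n x)"

lemma trig_sum_cper: "trig_sum F c \<in> cper"
  unfolding trig_sum_def[abs_def] by (intro cper_sum cper_scale char_fun_cper)

lemma l2_sum_left:
  assumes "\<And>i. i \<in> I \<Longrightarrow> f i \<in> cper" "g \<in> cper"
  shows "l2_ip (\<lambda>x. \<Sum>i\<in>I. f i x) g = (\<Sum>i\<in>I. l2_ip (f i) g)"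
proof (cases "finite I")
  case True
  have "integral {-pi..pi} (\<lambda>x. \<Sum>i\<in>I. f i x * cnj (g x)) = (\<Sum>i\<in>I. integral {-pi..pi} (\<lambda>x. f i x * cnj (g x)))"
    using assms True by (intro integral_sum integrable_continuous_interval cper_continuous cper_mult cper_cnj)
  then show ?thesis by (simp add: l2_ip_def sum_distrib_right sum_divide_distrib)
qed (simp add: l2_ip_def)

lemma l2_trig_sum_left:
  assumes "g \<in> cper"
  shows "l2_ip (trig_sum F c) g = (\<Sum>n\<in>F. c n * cnj (fcoeff g n))"
proof -
  have "l2_ip (trig_sum F c) g = (\<Sum>n\<in>F. l2_ip (\<lambda>x. c n * char_fun n x) g)"
    unfolding trig_sum_def[abs_def] using assms by (intro l2_sum_left cper_scale char_fun_cper)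
  then show ?thesis
    using assms by (simp add: L2.ip_scale_left char_fun_cper fcoeff_def L2.ip_cnj[of g])
qed

lemma l2_trig_sum_right:
  assumes "g \<in> cper"
  shows "l2_ip g (trig_sum F c) = (\<Sum>n\<in>F. fcoeff g n * cnj (c n))"
  using assms by (simp add: L2.ip_cnj[of "trig_sum F c" g] trig_sum_cper l2_trig_sum_left mult.commute)

lemma fcoeff_char_fun: "fcoeff (char_fun m) n = (if m = n then 1 else 0)"
  by (simp add: fcoeff_def l2_char_fun)

lemma fcoeff_trig_sum:
  assumes "finite F"
  shows "fcoeff (trig_sum F c) n = (if n \<in> F then c n else 0)"
proof -
  have "fcoeff (trig_sum F c) n = (\<Sum>m\<in>F. c m * cnj (fcoeff (char_fun n) m))"
    unfolding fcoeff_def[of "trig_sum F c"] by (intro l2_trig_sum_left char_fun_cper)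
  also have "\<dots> = (\<Sum>m\<in>F. if m = n then c m else 0)"
    by (intro sum.cong) (auto simp: fcoeff_char_fun)
  finally show ?thesis using assms by simp
qed

lemma trig_sum_norm:
  assumes "finite F"
  shows "integral {-pi..pi} (\<lambda>x. (cmod (trig_sum F c x))\<^sup>2) = 2 * pi * (\<Sum>n\<in>F. (cmod (c n))\<^sup>2)"
proof -
  have "of_real (integral {-pi..pi} (\<lambda>x. (cmod (trig_sum F c x))\<^sup>2) / (2 * pi)) = (\<Sum>n\<in>F. c n * cnj (c n))"
    using assms unfolding l2_self[OF trig_sum_cper, symmetric]
    by (simp add: l2_trig_sum_left trig_sum_cper fcoeff_trig_sum)
  also have "\<dots> = of_real (\<Sum>n\<in>F. (cmod (c n))\<^sup>2)"
    by (simp add: complex_norm_square[symmetric])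
  finally have "integral {-pi..pi} (\<lambda>x. (cmod (trig_sum F c x))\<^sup>2) / (2 * pi) = (\<Sum>n\<in>F. (cmod (c n))\<^sup>2)"
    by (simp only: of_real_eq_iff)
  then show ?thesis by (simp add: field_simps)
qed

text \<open>A description without index sets, convenient for the products that Stone-Weierstrass
  brings in; \<open>trig_poly_trig_sum\<close> returns to sums over finite sets of
  frequencies.\<close>

inductive trig_poly :: "(real \<Rightarrow> complex) \<Rightarrow> bool" where
  base: "trig_poly (\<lambda>x. c * char_fun n x)"
| add: "trig_poly f \<Longrightarrow> trig_poly g \<Longrightarrow> trig_poly (\<lambda>x. f x + g x)"

lemma trig_poly_cper: "trig_poly f \<Longrightarrow> f \<in> cper"
  by (induction rule: trig_poly.induct) (auto intro: cper_scale char_fun_cper cper_add)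

lemma trig_poly_mult_base: "trig_poly f \<Longrightarrow> trig_poly (\<lambda>x. c * char_fun n x * f x)"
proof (induction rule: trig_poly.induct)
  case (base c' m)
  have "(\<lambda>x. c * char_fun n x * (c' * char_fun m x)) = (\<lambda>x. (c * c') * char_fun (n + m) x)"
    by (simp add: char_fun_mult[symmetric] mult_ac)
  then show ?case using trig_poly.base[of "c * c'" "n + m"] by metis
next
  case (add f g)
  then show ?case using trig_poly.add by (simp add: distrib_left)
qed

lemma trig_poly_mult: "trig_poly f \<Longrightarrow> trig_poly g \<Longrightarrow> trig_poly (\<lambda>x. f x * g x)"
proof (induction rule: trig_poly.induct)
  case (base c n)
  then show ?case using trig_poly_mult_base by simp
next
  case (add f1 f2)
  then show ?case using trig_poly.add by (simp add: distrib_right)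
qed

lemma trig_poly_const: "trig_poly (\<lambda>x. c)"
  using trig_poly.base[of c 0] by (simp add: char_fun_def)

text \<open>A real-linear form on the plane, evaluated at \<open>cis x\<close>, is a combination of
  cos and sin, hence of the characters 1 and -1.\<close>

lemma trig_poly_real_polynomial:
  fixes p :: "complex \<Rightarrow> real"
  assumes "real_polynomial_function p"
  shows "trig_poly (\<lambda>x. of_real (p (cis x)))"
  using assms
proof (induction rule: real_polynomial_function.induct)
  case (linear f)
  interpret bounded_linear f by fact
  have "of_real (f (cis x)) = of_real (f 1) / 2 * (char_fun 1 x + char_fun (-1) x)
     + of_real (f \<i>) / (2 * \<i>) * (char_fun 1 x - char_fun (-1) x)" for x
  proof -
    have "cis x = cos x *\<^sub>R 1 + sin x *\<^sub>R \<i>" by (simp add: complex_eq_iff)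
    then have "f (cis x) = cos x * f 1 + sin x * f \<i>" by (simp add: add scaleR)
    moreover have "char_fun 1 x + char_fun (-1) x = 2 * of_real (cos x)"
      "char_fun 1 x - char_fun (-1) x = 2 * \<i> * of_real (sin x)"
      by (simp_all add: char_fun_def complex_eq_iff)
    ultimately show ?thesis by (simp add: field_simps)
  qed
  then have "(\<lambda>x. complex_of_real (f (cis x))) = (\<lambda>x. (of_real (f 1) / 2 + of_real (f \<i>) / (2 * \<i>)) * char_fun 1 x
      + (of_real (f 1) / 2 - of_real (f \<i>) / (2 * \<i>)) * char_fun (-1) x)"
    by (intro ext) (simp add: algebra_simps add_divide_distrib diff_divide_distrib)
  then show ?case by (simp only: trig_poly.intros)
next
  case (const c)
  show ?case by (rule trig_poly_const)
next
  case (add f g)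
  then show ?case using trig_poly.add by simp
next
  case (mult f g)
  then show ?case using trig_poly_mult by simp
qed

text \<open>A periodic function does not see the choice of a branch of the argument.
  \<open>Arg\<close> is continuous off the nonpositive axis and \<open>Arg2pi\<close> off the
  nonnegative one, so near every point of the circle one of the two is usable.\<close>

lemma cper_Arg:
  assumes f: "f \<in> cper"
  shows "f (Arg (cis x)) = f x" "z \<noteq> 0 \<Longrightarrow> f (Arg2pi z) = f (Arg z)"
proof -
  have key: "f x = f y" if eq: "cis x = cis y" for x y
  proof -
    have "cos x = cos y \<and> sin x = sin y" using eq by (metis cis.sel)
    then obtain k :: int where "x = y + 2 * pi * of_int k" by (metis sin_cos_eq_iff)
    then show ?thesis using cper_periodic_int[OF f, of y k] by simp
  qed
  show "f (Arg (cis x)) = f x"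
    using cis_Arg[of "cis x"] by (intro key) (simp add: sgn_eq)
  show "f (Arg2pi z) = f (Arg z)" if "z \<noteq> 0"
  proof (rule key)
    have "z = of_real (cmod z) * exp (\<i> * of_real (Arg2pi z))" by (rule Arg2pi_eq)
    then have "cis (Arg2pi z) = sgn z"
      using that by (simp add: sgn_eq cis_conv_exp field_simps)
    then show "cis (Arg2pi z) = cis (Arg z)" using that by (simp add: cis_Arg)
  qed
qed

lemma trig_poly_dense:
  assumes f: "f \<in> cper" and e: "e > 0"
  obtains t where "trig_poly t" "\<And>x. cmod (f x - t x) < e"
proof -
  have "continuous_on (sphere 0 1) (\<lambda>z. f (Arg z))"
  proof (rule continuous_at_imp_continuous_on, intro ballI)
    fix z :: complex assume "z \<in> sphere 0 1"
    then have z0: "z \<noteq> 0" by auto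
    have fc: "isCont f x" for x using f by (simp add: cper_def continuous_on_eq_continuous_at)
    show "isCont (\<lambda>z. f (Arg z)) z"
    proof (cases "z \<in> \<real>\<^sub>\<le>\<^sub>0")
      case False
      then have "isCont (f \<circ> Arg) z"
        by (intro continuous_at_compose continuous_at_Arg fc)
      then show ?thesis by (simp add: o_def)
    next
      case True
      then have "z \<notin> \<real>\<^sub>\<ge>\<^sub>0" using z0 by (auto simp: complex_nonpos_Reals_iff complex_nonneg_Reals_iff complex_eq_iff)
      then have "isCont (f \<circ> Arg2pi) z"
        by (intro continuous_at_compose continuous_at_Arg2pi fc)
      moreover have "\<forall>\<^sub>F w in nhds z. w \<noteq> 0"
        using z0 by (rule t1_space_nhds)
      then have "\<forall>\<^sub>F w in nhds z. (f \<circ> Arg2pi) w = f (Arg w)"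
        by eventually_elim (simp add: cper_Arg(2)[OF f])
      ultimately show ?thesis
        using isCont_cong[of "f \<circ> Arg2pi" "\<lambda>w. f (Arg w)"] by simp
    qed
  qed
  from Stone_Weierstrass_polynomial_function[OF compact_sphere this e]
  obtain g where g: "polynomial_function g" "\<And>z. z \<in> sphere 0 1 \<Longrightarrow> cmod (f (Arg z) - g z) < e"
    by blast
  define t where "t x = g (cis x)" for x
  have "real_polynomial_function (Re \<circ> g)" "real_polynomial_function (Im \<circ> g)"
    using g(1) by (auto simp: polynomial_function_def bounded_linear_Re bounded_linear_Im)
  then have "trig_poly (\<lambda>x. of_real (Re (t x)) + \<i> * of_real (Im (t x)))"
    using trig_poly.add[OF _ trig_poly_mult[OF trig_poly_const]] trig_poly_real_polynomial
    by (fastforce simp: t_def o_def)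
  then have "trig_poly t" by (simp add: complex_eq[symmetric])
  moreover have "cmod (f x - t x) < e" for x
    using g(2)[of "cis x"] by (simp add: t_def cper_Arg(1)[OF f])
  ultimately show ?thesis using that by blast
qed

lemma trig_sum_residual_orthogonal:
  assumes f: "f \<in> cper" and F: "finite F"
  shows "l2_ip (\<lambda>x. f x - trig_sum F (fcoeff f) x) (trig_sum F c) = 0"
  using assms by (simp add: L2.ip_diff_left trig_sum_cper l2_trig_sum_right fcoeff_trig_sum sum_subtractf[symmetric])

text \<open>The frequencies may be padded to any larger finite set, which is what convergence along
  the net of finite sets asks for.\<close>

lemma trig_poly_trig_sum:
  assumes "trig_poly t"
  shows "\<exists>F. finite F \<and> (\<forall>F'. finite F' \<longrightarrow> F \<subseteq> F' \<longrightarrow> (\<exists>c. t = trig_sum F' c))"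
  using assms
proof (induction rule: trig_poly.induct)
  case (base c n)
  have "(\<lambda>x. c * char_fun n x) = trig_sum F' (\<lambda>m. if m = n then c else 0)" if "finite F'" "{n} \<subseteq> F'" for F'
    using that by (auto simp: trig_sum_def if_distrib[of "\<lambda>z. z * _"] cong: if_cong)
  then show ?case by (intro exI[of _ "{n}"]) blast
next
  case (add f g)
  then obtain F G where FG: "finite F" "finite G"
    "\<And>F'. finite F' \<Longrightarrow> F \<subseteq> F' \<Longrightarrow> \<exists>c. f = trig_sum F' c"
    "\<And>F'. finite F' \<Longrightarrow> G \<subseteq> F' \<Longrightarrow> \<exists>c. g = trig_sum F' c" by blast
  have "\<exists>c. (\<lambda>x. f x + g x) = trig_sum F' c" if F': "finite F'" "F \<union> G \<subseteq> F'" for F'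
  proof -
    obtain c c' where "f = trig_sum F' c" "g = trig_sum F' c'" using FG(3,4)[OF F'(1)] F'(2) by blast
    then have "(\<lambda>x. f x + g x) = trig_sum F' (\<lambda>n. c n + c' n)"
      by (auto simp: trig_sum_def sum.distrib distrib_right)
    then show ?thesis by blast
  qed
  then show ?case using FG(1,2) by (intro exI[of _ "F \<union> G"]) blast
qed

text \<open>The partial sum over \<open>F'\<close> is the orthogonal projection onto the span of its
  characters, so in norm it is at least as close to \<open>f\<close> as a uniformly close
  trigonometric polynomial with frequencies in \<open>F'\<close>.\<close>

lemma trig_sum_converges:
  assumes f: "f \<in> cper"
  shows "((\<lambda>F. ip_norm l2_ip (\<lambda>x. f x - trig_sum F (fcoeff f) x)) \<longlongrightarrow> 0) (finite_subsets_at_top UNIV)"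
proof (rule tendstoI)
  fix e :: real assume e: "e > 0"
  obtain t where t: "trig_poly t" "\<And>x. cmod (f x - t x) < e / 2"
    using trig_poly_dense[OF f, of "e / 2"] e by (metis half_gt_zero)
  obtain F where F: "finite F" "\<And>F'. finite F' \<Longrightarrow> F \<subseteq> F' \<Longrightarrow> \<exists>c. t = trig_sum F' c"
    using trig_poly_trig_sum[OF t(1)] by blast
  have "dist (ip_norm l2_ip (\<lambda>x. f x - trig_sum F' (fcoeff f) x)) 0 < e" if F': "finite F'" "F \<subseteq> F'" for F'
  proof -
    obtain c where c: "t = trig_sum F' c" using F(2)[OF F'] by blast
    define c' where "c' n = c n - fcoeff f n" for n
    have t': "trig_sum F' c' x = t x - trig_sum F' (fcoeff f) x" for x
      by (simp add: c c'_def trig_sum_def sum_subtractf left_diff_distrib)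
    have r: "(\<lambda>x. f x - trig_sum F' (fcoeff f) x) \<in> cper"
      by (intro cper_diff f trig_sum_cper)
    have eq: "(\<lambda>x. f x - t x) = (\<lambda>x. (f x - trig_sum F' (fcoeff f) x) - trig_sum F' c' x)"
      by (simp add: t')
    have "(ip_norm l2_ip (\<lambda>x. f x - trig_sum F' (fcoeff f) x))\<^sup>2 \<le> (ip_norm l2_ip (\<lambda>x. f x - t x))\<^sup>2"
      unfolding eq L2.ip_norm_diff_sq[OF r trig_sum_cper]
      using trig_sum_residual_orthogonal[OF f F'(1), of c'] by simp
    then have "ip_norm l2_ip (\<lambda>x. f x - trig_sum F' (fcoeff f) x) \<le> ip_norm l2_ip (\<lambda>x. f x - t x)"
      by (rule power2_le_imp_le) (intro L2.ip_norm_nonneg cper_diff f trig_poly_cper t)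
    also have "\<dots> \<le> e / 2"
      using t by (intro l2_norm_le cper_diff f trig_poly_cper) (auto intro: less_imp_le)
    finally show ?thesis using e L2.ip_norm_nonneg[OF r] by simp
  qed
  then show "\<forall>\<^sub>F F' in finite_subsets_at_top UNIV. dist (ip_norm l2_ip (\<lambda>x. f x - trig_sum F' (fcoeff f) x)) 0 < e"
    using F(1) by (auto simp: eventually_finite_subsets_at_top)
qed

theorem parseval:
  assumes f: "f \<in> cper" and g: "g \<in> cper"
  shows "((\<lambda>n. fcoeff f n * cnj (fcoeff g n)) has_sum l2_ip f g) UNIV"
  unfolding has_sum_def
proof (rule LIM_zero_cancel, rule Lim_null_comparison)
  show "((\<lambda>F. ip_norm l2_ip (\<lambda>x. f x - trig_sum F (fcoeff f) x) * ip_norm l2_ip g) \<longlongrightarrow> 0) (finite_subsets_at_top UNIV)"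
    by (intro tendsto_mult_left_zero trig_sum_converges f)
  have "cmod ((\<Sum>n\<in>F. fcoeff f n * cnj (fcoeff g n)) - l2_ip f g)
    \<le> ip_norm l2_ip (\<lambda>x. f x - trig_sum F (fcoeff f) x) * ip_norm l2_ip g" for F
  proof -
    have "l2_ip (\<lambda>x. f x - trig_sum F (fcoeff f) x) g = l2_ip f g - (\<Sum>n\<in>F. fcoeff f n * cnj (fcoeff g n))"
      using f g by (simp add: L2.ip_diff_left trig_sum_cper l2_trig_sum_left)
    then show ?thesis
      using L2.cauchy_schwarz[OF cper_diff[OF f trig_sum_cper] g] by (metis norm_minus_commute)
  qed
  then show "\<forall>\<^sub>F F in finite_subsets_at_top UNIV. cmod ((\<Sum>n\<in>F. fcoeff f n * cnj (fcoeff g n)) - l2_ip f g)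
    \<le> ip_norm l2_ip (\<lambda>x. f x - trig_sum F (fcoeff f) x) * ip_norm l2_ip g" by simp
qed

lemma parseval_norm:
  assumes f: "f \<in> cper"
  shows "((\<lambda>n. (cmod (fcoeff f n))\<^sup>2) has_sum integral {-pi..pi} (\<lambda>x. (cmod (f x))\<^sup>2) / (2 * pi)) UNIV"
proof -
  have "((\<lambda>n. of_real ((cmod (fcoeff f n))\<^sup>2)) has_sum complex_of_real (integral {-pi..pi} (\<lambda>x. (cmod (f x))\<^sup>2) / (2 * pi))) UNIV"
    using parseval[OF f f] by (simp only: l2_self[OF f] complex_norm_square)
  then show ?thesis by (simp only: has_sum_of_real_iff)
qed

section \<open>From double Fourier series to integrals over a square\<close>

lemma set_integral_square_iterated:
  fixes f :: "real \<times> real \<Rightarrow> 'a::euclidean_space"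
  assumes cont: "continuous_on UNIV f"
  shows "(LINT p:({a..b} \<times> {c..d})|lborel. f p) = integral {c..d} (\<lambda>y. integral {a..b} (\<lambda>x. f (x, y)))"
proof -
  have sq: "{a..b} \<times> {c..d} = cbox (a, c) (b, d)" by (simp add: cbox_Pair_eq)
  have cont': "continuous_on S f" for S using cont continuous_on_subset by blast
  have "set_integrable lborel (cbox (a, c) (b, d)) f"
    unfolding set_integrable_def by (rule borel_integrable_compact[OF compact_cbox cont'])
  then have "(LINT p:({a..b} \<times> {c..d})|lborel. f p) = integral (cbox (a, c) (b, d)) f"
    unfolding sq by (rule set_borel_integral_eq_integral)
  also have "\<dots> = integral (cbox a b) (\<lambda>x. integral (cbox c d) (\<lambda>y. f (x, y)))"
    by (rule integral_prod_continuous[OF cont'])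
  also have "\<dots> = integral (cbox c d) (\<lambda>y. integral (cbox a b) (\<lambda>x. f (x, y)))"
    using cont'[of "cbox (a, c) (b, d)"] by (intro integral_swap_continuous) simp
  finally show ?thesis by simp
qed

text \<open>The net behind \<open>has_sum\<close> becomes a sequence, so that measurability of
  limits and dominated convergence apply.\<close>

lemma has_sum_int_symmetric_limit:
  fixes f :: "int \<Rightarrow> 'a::{comm_monoid_add,topological_space}"
  assumes "(f has_sum S) UNIV"
  shows "(\<lambda>N. \<Sum>n\<in>{- int N..int N}. f n) \<longlonglongrightarrow> S"
proof -
  have "filterlim (\<lambda>N. {- int N..int N}) (finite_subsets_at_top UNIV) sequentially"
    unfolding filterlim_finite_subsets_at_top
  proof (intro allI impI)
    fix X :: "int set" assume X: "finite X \<and> X \<subseteq> UNIV"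
    define M where "M = Max (insert 0 ((\<lambda>n. nat \<bar>n\<bar>) ` X))"
    have M: "nat \<bar>n\<bar> \<le> M" if "n \<in> X" for n
      using X that by (auto simp: M_def intro!: Max_ge)
    have "X \<subseteq> {- int N..int N}" if "M \<le> N" for N
    proof
      fix n assume "n \<in> X"
      have "nat \<bar>n\<bar> \<le> N" by (rule le_trans[OF M[OF \<open>n \<in> X\<close>] \<open>M \<le> N\<close>])
      then have "\<bar>n\<bar> \<le> int N" by linarith
      then show "n \<in> {- int N..int N}" by (simp add: abs_le_iff)
    qed
    then have "finite {- int N..int N} \<and> X \<subseteq> {- int N..int N} \<and> {- int N..int N} \<subseteq> UNIV" if "M \<le> N" for N
      using that by simp
    then show "\<forall>\<^sub>F N in sequentially. finite {- int N..int N} \<and> X \<subseteq> {- int N..int N} \<and> {- int N..int N} \<subseteq> UNIV"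
      by (rule eventually_mono[OF eventually_ge_at_top[of M]])
  qed
  with assms show ?thesis
    unfolding has_sum_def by (rule filterlim_compose)
qed

text \<open>Parseval in \<open>x\<close> for fixed \<open>y\<close>, then in \<open>y\<close> for each coefficient.\<close>

lemma double_fourier_series_bound:
  fixes d :: "int \<Rightarrow> real" and \<alpha> :: "int \<Rightarrow> real \<Rightarrow> complex" and \<Phi> :: "int \<Rightarrow> int \<Rightarrow> complex"
  assumes d: "\<And>n. 0 < d n"
    and f: "((\<lambda>n. d n * (cmod (a n))\<^sup>2) has_sum qf) UNIV"
    and g: "((\<lambda>n. d n * (cmod (b n))\<^sup>2) has_sum qg) UNIV"
    and \<alpha>: "\<And>n. \<alpha> n \<in> cper" "\<And>n m. fcoeff (\<alpha> n) m = a m * \<Phi> n m"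
    and \<alpha>_sum: "\<And>y F. finite F \<Longrightarrow> (\<Sum>n\<in>F. d n * (cmod (\<alpha> n y))\<^sup>2) \<le> qf"
    and \<Phi>: "\<And>n m. b n \<noteq> 0 \<Longrightarrow> a m \<noteq> 0 \<Longrightarrow> d n * (cmod (\<Phi> n m))\<^sup>2 \<le> M\<^sup>2 * d m"
    and m: "\<And>x y. ((\<lambda>n. of_real (d n) * char_fun n x * \<alpha> n y * cnj (b n)) has_sum m (x, y)) UNIV"
  shows "m \<in> borel_measurable borel"
    and "(LINT p:({-pi..pi} \<times> {-pi..pi})|lborel. (cmod (m p))\<^sup>2) \<le> (2 * pi * M)\<^sup>2 * qf * qg"
proof -
  define Z where "Z N = {- int N..int N}" for N
  define c where "c y n = of_real (d n) * \<alpha> n y * cnj (b n)" for y n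
  \<comment> \<open>Partial sums in the first frequency. In the applications
    \<open>\<alpha> n y\<close> is the \<open>n\<close>-th coefficient of the vector moved by
    \<open>a\<^sub>r k\<^sub>y\<close>, \<open>\<Phi>\<close> consists of the matrix coefficients
    and \<open>d\<close> of the weights of the norm.\<close>
  define mN where "mN N p = trig_sum (Z N) (c (snd p)) (fst p)" for N p
  have Z: "finite (Z N)" for N by (simp add: Z_def)
  have d0: "0 \<le> d n" for n using d[of n] by simp
  have qf: "0 \<le> qf"
    by (rule has_sum_nonneg[OF f]) (simp add: d0)
  have lim: "(\<lambda>N. mN N p) \<longlonglongrightarrow> m p" for p
    using has_sum_int_symmetric_limit[OF m[of "fst p" "snd p"]]
    by (simp add: mN_def Z_def c_def trig_sum_def mult_ac)
  have mN_cont: "continuous_on UNIV (mN N)" for N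
    unfolding mN_def trig_sum_def c_def
    by (intro continuous_on_sum continuous_on_mult continuous_on_const
        continuous_on_compose2[OF cper_continuous[OF \<alpha>(1), of UNIV] continuous_on_snd[OF continuous_on_id]]
        continuous_on_compose2[OF cper_continuous[OF char_fun_cper, of UNIV] continuous_on_fst[OF continuous_on_id]]) auto
  then have mN_meas: "mN N \<in> borel_measurable borel" for N
    by (rule borel_measurable_continuous_onI)
  show m_meas: "m \<in> borel_measurable borel"
    by (rule borel_measurable_LIMSEQ_metric[OF mN_meas lim])
  have gF: "(\<Sum>n\<in>F. d n * (cmod (b n))\<^sup>2) \<le> qg" if "finite F" for F
    by (rule finite_sum_le_has_sum[OF g that]) (auto simp: d0)
  \<comment> \<open>Each weight is split into two square roots, one per factor, before
    Cauchy-Schwarz. The bound depends neither on \<open>N\<close> nor on \<open>p\<close> and serves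
    as dominating function.\<close>
  have bnd: "(cmod (mN N p))\<^sup>2 \<le> qf * qg" for N p
  proof -
    have "cmod (mN N p) \<le> (\<Sum>n\<in>Z N. (sqrt (d n) * cmod (\<alpha> n (snd p))) * (sqrt (d n) * cmod (b n)))"
    proof -
      have "cmod (c (snd p) n * char_fun n (fst p)) = (sqrt (d n) * cmod (\<alpha> n (snd p))) * (sqrt (d n) * cmod (b n))" for n
        using d[of n] by (simp add: c_def norm_mult)
      then show ?thesis
        using norm_sum[of "\<lambda>n. c (snd p) n * char_fun n (fst p)" "Z N"] by (simp add: mN_def trig_sum_def)
    qed
    then have "(cmod (mN N p))\<^sup>2 \<le> (\<Sum>n\<in>Z N. (sqrt (d n) * cmod (\<alpha> n (snd p))) * (sqrt (d n) * cmod (b n)))\<^sup>2"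
      by (intro power_mono) auto
    also have "\<dots> \<le> (\<Sum>n\<in>Z N. (sqrt (d n) * cmod (\<alpha> n (snd p)))\<^sup>2) * (\<Sum>n\<in>Z N. (sqrt (d n) * cmod (b n))\<^sup>2)"
      by (rule Cauchy_Schwarz_ineq_sum)
    also have "\<dots> = (\<Sum>n\<in>Z N. d n * (cmod (\<alpha> n (snd p)))\<^sup>2) * (\<Sum>n\<in>Z N. d n * (cmod (b n))\<^sup>2)"
      by (simp add: power_mult_distrib d0)
    also have "\<dots> \<le> qf * qg"
      by (rule mult_mono[OF \<alpha>_sum[OF Z] gF[OF Z] qf]) (simp add: sum_nonneg d0)
    finally show ?thesis .
  qed
  have bound: "(LINT p:({-pi..pi} \<times> {-pi..pi})|lborel. (cmod (mN N p))\<^sup>2) \<le> (2 * pi * M)\<^sup>2 * qf * qg" for N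
  proof -
    have \<alpha>int: "(\<lambda>y. (cmod (\<alpha> n y))\<^sup>2) integrable_on {-pi..pi}" for n
      by (intro integrable_continuous_interval continuous_intros cper_continuous \<alpha>)
    \<comment> \<open>Parseval in \<open>y\<close>, compared term by term with the series for
      \<open>qf\<close>. \<open>\<Phi>\<close> is controlled only where \<open>a k\<close> and
      \<open>b n\<close> are nonzero; where \<open>a k\<close> vanishes so does the term.\<close>
    have \<alpha>b: "d n * integral {-pi..pi} (\<lambda>y. (cmod (\<alpha> n y))\<^sup>2) \<le> 2 * pi * M\<^sup>2 * qf" if "b n \<noteq> 0" for n
    proof -
      have "((\<lambda>k. d n * (cmod (a k * \<Phi> n k))\<^sup>2) has_sum
        d n * (integral {-pi..pi} (\<lambda>y. (cmod (\<alpha> n y))\<^sup>2) / (2 * pi))) UNIV"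
        using parseval_norm[OF \<alpha>(1)[of n]] unfolding \<alpha>(2) by (rule has_sum_cmult_right)
      moreover have "((\<lambda>k. M\<^sup>2 * (d k * (cmod (a k))\<^sup>2)) has_sum M\<^sup>2 * qf) UNIV"
        using f by (rule has_sum_cmult_right)
      moreover have "d n * (cmod (a k * \<Phi> n k))\<^sup>2 \<le> M\<^sup>2 * (d k * (cmod (a k))\<^sup>2)" for k
      proof (cases "a k = 0")
        case False
        show ?thesis
          using mult_right_mono[OF \<Phi>[OF that False], of "(cmod (a k))\<^sup>2"]
          by (simp add: norm_mult power_mult_distrib mult_ac)
      qed simp
      ultimately have "d n * (integral {-pi..pi} (\<lambda>y. (cmod (\<alpha> n y))\<^sup>2) / (2 * pi)) \<le> M\<^sup>2 * qf"
        by (rule has_sum_mono)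
      then show ?thesis by (simp add: field_simps)
    qed
    have "(LINT p:({-pi..pi} \<times> {-pi..pi})|lborel. (cmod (mN N p))\<^sup>2)
      = integral {-pi..pi} (\<lambda>y. integral {-pi..pi} (\<lambda>x. (cmod (mN N (x, y)))\<^sup>2))"
      by (intro set_integral_square_iterated continuous_intros mN_cont)
    \<comment> \<open>Parseval in \<open>x\<close> for fixed \<open>y\<close>, applied to a finite
      sum; it contributes the first factor 2 \<pi>, and \<open>\<alpha>b\<close> the second.\<close>
    also have "\<dots> = integral {-pi..pi} (\<lambda>y. 2 * pi * (\<Sum>n\<in>Z N. (cmod (c y n))\<^sup>2))"
      by (simp add: mN_def trig_sum_norm Z)
    also have "\<dots> = integral {-pi..pi} (\<lambda>y. \<Sum>n\<in>Z N. (2 * pi * (d n)\<^sup>2 * (cmod (b n))\<^sup>2) * (cmod (\<alpha> n y))\<^sup>2)"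
      by (intro arg_cong[where f = "integral _"] ext)
        (simp add: c_def norm_mult power_mult_distrib sum_distrib_left mult_ac)
    also have "\<dots> = (\<Sum>n\<in>Z N. (2 * pi * (d n)\<^sup>2 * (cmod (b n))\<^sup>2) * integral {-pi..pi} (\<lambda>y. (cmod (\<alpha> n y))\<^sup>2))"
      using integrable_on_mult_right[OF \<alpha>int] by (subst integral_sum) (auto simp: Z)
    also have "\<dots> = (\<Sum>n\<in>Z N. (2 * pi * (d n * (cmod (b n))\<^sup>2)) * (d n * integral {-pi..pi} (\<lambda>y. (cmod (\<alpha> n y))\<^sup>2)))"
      by (simp add: power2_eq_square mult_ac)
    also have "\<dots> \<le> (\<Sum>n\<in>Z N. (2 * pi * (d n * (cmod (b n))\<^sup>2)) * (2 * pi * M\<^sup>2 * qf))"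
    proof (rule sum_mono)
      fix n
      show "(2 * pi * (d n * (cmod (b n))\<^sup>2)) * (d n * integral {-pi..pi} (\<lambda>y. (cmod (\<alpha> n y))\<^sup>2))
        \<le> (2 * pi * (d n * (cmod (b n))\<^sup>2)) * (2 * pi * M\<^sup>2 * qf)"
      proof (cases "b n = 0")
        case False
        then show ?thesis by (intro mult_left_mono \<alpha>b) (simp_all add: d0)
      qed simp
    qed
    also have "\<dots> = (2 * pi * M)\<^sup>2 * qf * (\<Sum>n\<in>Z N. d n * (cmod (b n))\<^sup>2)"
      by (simp add: sum_distrib_left sum_distrib_right power_mult_distrib power2_eq_square mult_ac)
    also have "\<dots> \<le> (2 * pi * M)\<^sup>2 * qf * qg"
      using qf by (intro mult_left_mono gF Z) simp
    finally show ?thesis .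
  qed
  have S: "{-pi..pi} \<times> {-pi..pi} \<in> sets borel" "emeasure lborel ({-pi..pi} \<times> {-pi..pi}) < \<infinity>"
  proof -
    have sq: "{-pi..pi} \<times> {-pi..pi} = cbox (-pi, -pi) (pi, pi)" by (simp add: cbox_Pair_eq)
    show "{-pi..pi} \<times> {-pi..pi} \<in> sets borel" unfolding sq by simp
    show "emeasure lborel ({-pi..pi} \<times> {-pi..pi}) < \<infinity>" unfolding sq by (rule emeasure_lborel_cbox_finite)
  qed
  have dom: "integrable lborel (\<lambda>p. indicator ({-pi..pi} \<times> {-pi..pi}) p *\<^sub>R (qf * qg))"
    using S by (auto simp: integrable_indicator_iff)
  have "(\<lambda>N. \<integral>p. indicator ({-pi..pi} \<times> {-pi..pi}) p *\<^sub>R (cmod (mN N p))\<^sup>2 \<partial>lborel)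
      \<longlonglongrightarrow> (\<integral>p. indicator ({-pi..pi} \<times> {-pi..pi}) p *\<^sub>R (cmod (m p))\<^sup>2 \<partial>lborel)"
  proof (rule integral_dominated_convergence[OF _ _ dom])
    show "(\<lambda>p. indicator ({-pi..pi} \<times> {-pi..pi}) p *\<^sub>R (cmod (m p))\<^sup>2) \<in> borel_measurable lborel"
      "\<And>N. (\<lambda>p. indicator ({-pi..pi} \<times> {-pi..pi}) p *\<^sub>R (cmod (mN N p))\<^sup>2) \<in> borel_measurable lborel"
      using m_meas mN_meas S by simp_all
    show "AE p in lborel. (\<lambda>N. indicator ({-pi..pi} \<times> {-pi..pi}) p *\<^sub>R (cmod (mN N p))\<^sup>2)
        \<longlonglongrightarrow> indicator ({-pi..pi} \<times> {-pi..pi}) p *\<^sub>R (cmod (m p))\<^sup>2"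
      using lim by (auto intro!: tendsto_intros)
    show "\<And>N. AE p in lborel. norm (indicator ({-pi..pi} \<times> {-pi..pi}) p *\<^sub>R (cmod (mN N p))\<^sup>2)
        \<le> indicator ({-pi..pi} \<times> {-pi..pi}) p *\<^sub>R (qf * qg)"
      using bnd by (auto simp: indicator_def)
  qed
  then show "(LINT p:({-pi..pi} \<times> {-pi..pi})|lborel. (cmod (m p))\<^sup>2) \<le> (2 * pi * M)\<^sup>2 * qf * qg"
    unfolding set_lebesgue_integral_def
    by (rule LIMSEQ_le_const2) (use bound in \<open>auto simp: set_lebesgue_integral_def\<close>)
qed

section \<open>Polar coordinates of the action of the diagonal subgroup\<close>

text \<open>
  \<open>(cos x, sin x) a\<^sub>r\<close> has polar coordinates \<open>radius r x\<close> and \<open>angle r x\<close>; measuring the angle from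
  \<open>x\<close> by an arctangent selects the continuous lift.
\<close>

definition radius :: "real \<Rightarrow> real \<Rightarrow> real" where
  "radius r x = sqrt (exp (- 2 * r) * (cos x)\<^sup>2 + exp (2 * r) * (sin x)\<^sup>2)"

definition angle :: "real \<Rightarrow> real \<Rightarrow> real" where
  "angle r x = x + arctan ((exp r - exp (- r)) * sin x * cos x / (exp (- r) * (cos x)\<^sup>2 + exp r * (sin x)\<^sup>2))"

text \<open>The action of \<open>a\<^sub>r k\<^sub>t\<close> on functions homogeneous of degree
  \<open>w\<close>, read off on the circle: homogeneity turns the radius of the moved point into the
  factor in front. For \<open>Vspace \<zeta> \<epsilon>\<close> the degree is
  \<open>2 * \<zeta> - 1\<close>.\<close>

definition twist :: "complex \<Rightarrow> real \<Rightarrow> real \<Rightarrow> (real \<Rightarrow> complex) \<Rightarrow> real \<Rightarrow> complex" where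
  "twist w r t f x = of_real (radius r x) powr w * f (angle r x + t)"

lemma pos_comb_cos_sin:
  fixes a b x :: real
  assumes "0 < a" "0 < b"
  shows "0 < a * (cos x)\<^sup>2 + b * (sin x)\<^sup>2"
proof (cases "cos x = 0")
  case True
  then have "(sin x)\<^sup>2 = 1" using sin_cos_squared_add[of x] by simp
  then show ?thesis using assms True by simp
next
  case False
  then show ?thesis using assms by (intro add_pos_nonneg) simp_all
qed

lemma radius_sq: "(radius r x)\<^sup>2 = exp (- 2 * r) * (cos x)\<^sup>2 + exp (2 * r) * (sin x)\<^sup>2"
  unfolding radius_def by (intro real_sqrt_pow2 add_nonneg_nonneg) auto

lemma radius_pos: "0 < radius r x"
  unfolding radius_def by (simp only: real_sqrt_gt_0_iff pos_comb_cos_sin exp_gt_zero)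

lemma radius_nonzero [simp]: "radius r x \<noteq> 0"
  using radius_pos[of r x] by simp

lemma radius_cos_sin_angle:
  shows "radius r x * cos (angle r x) = exp (- r) * cos x"
    and "radius r x * sin (angle r x) = exp r * sin x"
proof -
  \<comment> \<open>The components of (cos x, sin x) \<open>a\<^sub>r\<close> along and across the
    direction \<open>x\<close>. The first is positive, so the angle between the two vectors is the
    arctangent of the quotient.\<close>
  define D E where "D = exp (- r) * (cos x)\<^sup>2 + exp r * (sin x)\<^sup>2"
    and "E = (exp r - exp (- r)) * sin x * cos x"
  have D: "0 < D" unfolding D_def by (intro pos_comb_cos_sin) simp_all
  have ee: "exp r * exp (- r) = 1" "exp (- 2 * r) = (exp (- r))\<^sup>2" "exp (2 * r) = (exp r)\<^sup>2"
    by (simp_all add: power2_eq_square flip: exp_add)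
  have "D\<^sup>2 + E\<^sup>2 = (radius r x)\<^sup>2"
    unfolding radius_sq ee(2,3) D_def E_def using ee(1) sin_cos_squared_add[of x] by algebra
  then have sq: "sqrt (D\<^sup>2 + E\<^sup>2) = radius r x"
    using radius_pos[of r x] by simp
  have "sqrt (1 + (E / D)\<^sup>2) = radius r x / D"
  proof -
    have "1 + (E / D)\<^sup>2 = (D\<^sup>2 + E\<^sup>2) / D\<^sup>2" using D by (simp add: field_simps)
    then show ?thesis using D sq by (simp add: real_sqrt_divide)
  qed
  then have ca: "radius r x * cos (arctan (E / D)) = D" and sa: "radius r x * sin (arctan (E / D)) = E"
    using D by (simp_all add: cos_arctan sin_arctan)
  have A: "angle r x = x + arctan (E / D)" by (simp add: angle_def D_def E_def)
  show "radius r x * cos (angle r x) = exp (- r) * cos x"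
  proof -
    have "radius r x * cos (angle r x) = cos x * (radius r x * cos (arctan (E / D))) - sin x * (radius r x * sin (arctan (E / D)))"
      unfolding A cos_add by (simp add: algebra_simps)
    also have "\<dots> = cos x * D - sin x * E" by (simp only: ca sa)
    also have "\<dots> = exp (- r) * cos x"
      unfolding D_def E_def using sin_cos_squared_add[of x] by algebra
    finally show ?thesis .
  qed
  show "radius r x * sin (angle r x) = exp r * sin x"
  proof -
    have "radius r x * sin (angle r x) = sin x * (radius r x * cos (arctan (E / D))) + cos x * (radius r x * sin (arctan (E / D)))"
      unfolding A sin_add by (simp add: algebra_simps)
    also have "\<dots> = sin x * D + cos x * E" by (simp only: ca sa)
    also have "\<dots> = exp r * sin x"
      unfolding D_def E_def using sin_cos_squared_add[of x] by algebra
    finally show ?thesis .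
  qed
qed

text \<open>A matrix of determinant one preserves area, and a thin sector has area half of radius^2
  d(angle); hence the derivative of the angle times radius^2 is 1.\<close>

lemma angle_has_derivative: "(angle r has_real_derivative 1 / (radius r x)\<^sup>2) (at x within S)"
proof -
  define D E where "D x = exp (- r) * (cos x)\<^sup>2 + exp r * (sin x)\<^sup>2"
    and "E x = (exp r - exp (- r)) * sin x * cos x" for x
  define D' E' where "D' = 2 * (exp r - exp (- r)) * sin x * cos x"
    and "E' = (exp r - exp (- r)) * ((cos x)\<^sup>2 - (sin x)\<^sup>2)"
  have D: "0 < D x" unfolding D_def by (intro pos_comb_cos_sin) simp_all
  have ee: "exp r * exp (- r) = 1" "exp (- 2 * r) = (exp (- r))\<^sup>2" "exp (2 * r) = (exp r)\<^sup>2"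
    by (simp_all add: power2_eq_square flip: exp_add)
  have dD: "(D has_real_derivative D') (at x within S)" and dE: "(E has_real_derivative E') (at x within S)"
    unfolding D_def E_def D'_def E'_def
    by (auto intro!: derivative_eq_intros simp: power2_eq_square algebra_simps)
  have "((\<lambda>x. x + arctan (E x / D x)) has_real_derivative
     1 + inverse (1 + (E x / D x)\<^sup>2) * ((E' * D x - E x * D') / (D x * D x))) (at x within S)"
    using D by (intro DERIV_add DERIV_ident DERIV_chain2[OF DERIV_arctan] DERIV_divide dD dE) simp
  moreover have "1 + inverse (1 + (E x / D x)\<^sup>2) * ((E' * D x - E x * D') / (D x * D x)) = 1 / (radius r x)\<^sup>2"
  proof -
    have 1: "(D x)\<^sup>2 + (E x)\<^sup>2 = (radius r x)\<^sup>2"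
      unfolding radius_sq ee(2,3) D_def E_def using ee(1) sin_cos_squared_add[of x] by algebra
    have 2: "E' * D x - E x * D' = 1 - (radius r x)\<^sup>2"
      unfolding radius_sq ee(2,3) D_def E_def D'_def E'_def using ee(1) sin_cos_squared_add[of x] by algebra
    have "inverse (1 + (E x / D x)\<^sup>2) = (D x)\<^sup>2 / (radius r x)\<^sup>2"
      unfolding 1[symmetric] using D by (simp add: field_simps)
    then have "inverse (1 + (E x / D x)\<^sup>2) * ((E' * D x - E x * D') / (D x * D x)) = (1 - (radius r x)\<^sup>2) / (radius r x)\<^sup>2"
      unfolding 2 using D by (simp add: power2_eq_square)
    then show ?thesis by (simp add: diff_divide_distrib)
  qed
  ultimately show ?thesis by (simp add: angle_def[abs_def] D_def E_def)
qed

lemma angle_strict_mono: "x < y \<Longrightarrow> angle r x < angle r y"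
  by (rule DERIV_pos_imp_increasing[where f = "angle r"])
    (use angle_has_derivative radius_pos in \<open>auto intro!: exI[of _ "1 / (radius r _)\<^sup>2"]\<close>)

lemma angle_mono: "x \<le> y \<Longrightarrow> angle r x \<le> angle r y"
  using angle_strict_mono[of x y r] by (cases "x = y") auto

lemma angle_plus_pi: "angle r (x + pi) = angle r x + pi"
  and radius_plus_pi: "radius r (x + pi) = radius r x"
  by (simp_all add: angle_def radius_def)

lemma angle_plus_2pi: "angle r (x + 2 * pi) = angle r x + 2 * pi"
  and radius_plus_2pi: "radius r (x + 2 * pi) = radius r x"
  using angle_plus_pi[of r "x + pi"] angle_plus_pi[of r x] radius_plus_pi[of r "x + pi"] radius_plus_pi[of r x]
  by (simp_all add: add.assoc)

lemma angle_0 [simp]: "angle r 0 = 0" and angle_pi [simp]: "angle r pi = pi"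
  and angle_minus_pi [simp]: "angle r (- pi) = - pi"
  by (simp_all add: angle_def)

lemma char_fun_diff: "char_fun n (x - y) = char_fun n x * char_fun (- n) y"
  using char_fun_add[of n x "- y"] by (simp add: char_fun_minus_arg)

lemma continuous_on_angle [continuous_intros]:
  "continuous_on S f \<Longrightarrow> continuous_on S (\<lambda>x. angle r (f x))"
  by (rule continuous_on_compose2[of UNIV "angle r"])
    (auto intro!: DERIV_continuous_on angle_has_derivative)

lemma continuous_on_radius [continuous_intros]:
  "continuous_on S f \<Longrightarrow> continuous_on S (\<lambda>x. radius r (f x))"
  by (rule continuous_on_compose2[of UNIV "radius r"]) (auto simp: radius_def[abs_def] intro!: continuous_intros)

lemma cper_cong_cis:
  assumes f: "f \<in> cper" and "cis x = cis y"
  shows "f x = f y"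
  using cper_Arg(1)[OF f] assms(2) by metis

lemma radius_angle_minus: "radius (- r) (angle r x) = 1 / radius r x"
proof -
  have "(radius r x)\<^sup>2 * (radius (- r) (angle r x))\<^sup>2
    = exp (2 * r) * (radius r x * cos (angle r x))\<^sup>2 + exp (- 2 * r) * (radius r x * sin (angle r x))\<^sup>2"
    by (simp add: radius_sq[of "- r"] power_mult_distrib algebra_simps)
  also have "\<dots> = 1"
  proof -
    have "exp (2 * r) * (exp (- r))\<^sup>2 = 1" "exp (- 2 * r) * (exp r)\<^sup>2 = 1"
      by (simp_all add: power2_eq_square flip: exp_add)
    then show ?thesis
      unfolding radius_cos_sin_angle power_mult_distrib mult.assoc[symmetric] by simp
  qed
  finally have "(radius r x * radius (- r) (angle r x))\<^sup>2 = 1"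
    by (simp add: power_mult_distrib)
  then have "radius r x * radius (- r) (angle r x) = 1"
    using radius_pos[of r x] radius_pos[of "- r" "angle r x"]
    by (metis abs_of_pos mult_pos_pos power2_eq_1_iff abs_minus_cancel abs_one)
  then show ?thesis by (simp add: field_simps)
qed

text \<open>The actions for \<open>r\<close> and \<open>- r\<close> are inverse to each other;
  \<open>cis\<close> hides multiples of 2 \<pi>, which periodic functions do not see.\<close>

lemma cis_angle_minus: "cis (angle (- r) (angle r x)) = cis x"
proof -
  have ee: "exp r * exp (- r) = 1" by (simp flip: exp_add)
  have "cos (angle (- r) (angle r x)) = cos x"
  proof -
    have "cos (angle (- r) (angle r x)) = radius r x * (radius (- r) (angle r x) * cos (angle (- r) (angle r x)))"
      by (simp add: radius_angle_minus)
    also have "\<dots> = exp r * (radius r x * cos (angle r x))"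
      by (simp add: radius_cos_sin_angle(1)[of "- r"])
    also have "\<dots> = cos x" using ee by (simp add: radius_cos_sin_angle(1) mult.assoc[symmetric])
    finally show ?thesis .
  qed
  moreover have "sin (angle (- r) (angle r x)) = sin x"
  proof -
    have "sin (angle (- r) (angle r x)) = radius r x * (radius (- r) (angle r x) * sin (angle (- r) (angle r x)))"
      by (simp add: radius_angle_minus)
    also have "\<dots> = exp (- r) * (radius r x * sin (angle r x))"
      by (simp add: radius_cos_sin_angle(2)[of "- r"])
    also have "\<dots> = sin x" using ee by (simp add: radius_cos_sin_angle(2) mult.assoc[symmetric] mult.commute)
    finally show ?thesis .
  qed
  ultimately show ?thesis by (simp add: complex_eq_iff)
qed

lemma continuous_radius_powr [continuous_intros]:
  "continuous_on S f \<Longrightarrow> continuous_on S (\<lambda>x. complex_of_real (radius r (f x)) powr w)"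
  using radius_pos by (intro continuous_on_powr_complex continuous_intros) (auto simp: less_le)

section \<open>Twists as operators on circle functions: adjoints and matrix coefficients\<close>

lemma twist_cper:
  assumes f: "f \<in> cper"
  shows "twist w r t f \<in> cper"
proof -
  have "twist w r t f (x + 2 * pi) = twist w r t f x" for x
  proof -
    have "f (angle r x + 2 * pi + t) = f (angle r x + t)"
      using cper_periodic[OF f, of "angle r x + t"] by (simp only: add_ac)
    then show ?thesis by (simp only: twist_def angle_plus_2pi radius_plus_2pi)
  qed
  moreover have "continuous_on UNIV (twist w r t f)"
    unfolding twist_def[abs_def]
    by (intro continuous_intros continuous_on_compose2[OF cper_continuous[OF f, of UNIV]]) auto
  ultimately show ?thesis by (simp add: cper_def)
qed

lemma integral_angle_substitution:
  assumes f: "f \<in> cper"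
  shows "integral {-pi..pi} (\<lambda>x. of_real (1 / (radius r x)\<^sup>2) * f (angle r x)) = integral {-pi..pi} f"
proof -
  have "((\<lambda>x. (1 / (radius r x)\<^sup>2) *\<^sub>R f (angle r x)) has_integral integral {angle r (-pi)..angle r pi} f) {-pi..pi}"
  proof (rule has_integral_substitution)
    show "angle r ` {-pi..pi} \<subseteq> {-pi..pi}"
      using angle_mono[of "-pi" _ r] angle_mono[of _ pi r] by auto
  qed (use angle_has_derivative f in \<open>auto intro: cper_continuous\<close>)
  then show ?thesis by (simp add: integral_unique scaleR_conv_of_real)
qed

lemma powr_cnj_of_real: "x > 0 \<Longrightarrow> cnj (complex_of_real x powr w) = complex_of_real x powr cnj w"
  by (subst cnj_powr) simp_all

text \<open>Substitution by \<open>angle r\<close> has Jacobian \<open>radius^(-2)\<close>, which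
  the two powers produce because their exponents \<open>w\<close> and \<open>cnj w'\<close> add up
  to -2. For \<open>w = w' = i s - 1\<close> this is unitarity; for \<open>w = 2 l - 1\<close> and
  \<open>w' = - 2 l - 1\<close> it is the duality between \<open>l\<close> and
  \<open>- l\<close>.\<close>

lemma l2_twist_twist:
  assumes f: "f \<in> cper" and g: "g \<in> cper" and w: "w + cnj w' = - 2"
  shows "l2_ip (twist w r t f) (twist w' r t g) = l2_ip f g"
proof -
  have "twist w r t f x * cnj (twist w' r t g x) = of_real (1 / (radius r x)\<^sup>2) * (\<lambda>y. f (y + t) * cnj (g (y + t))) (angle r x)" for x
  proof -
    have "complex_of_real (radius r x) powr w * cnj (complex_of_real (radius r x) powr w') = of_real (1 / (radius r x)\<^sup>2)"
    proof -
      have "complex_of_real (radius r x) powr w * cnj (complex_of_real (radius r x) powr w') = complex_of_real (radius r x) powr (- 2)"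
        using radius_pos[of r x] w by (simp add: powr_cnj_of_real flip: powr_add)
      also have "\<dots> = of_real (radius r x powr (- 2))"
        using radius_pos[of r x] by (subst powr_of_real[symmetric]) auto
      also have "radius r x powr (- 2) = 1 / (radius r x)\<^sup>2"
        using radius_pos[of r x] by (simp add: powr_minus_divide)
      finally show ?thesis .
    qed
    then have "complex_of_real (radius r x) powr w * cnj (complex_of_real (radius r x) powr w') * (f (angle r x + t) * cnj (g (angle r x + t)))
      = of_real (1 / (radius r x)\<^sup>2) * (f (angle r x + t) * cnj (g (angle r x + t)))" by (rule arg_cong)
    then show ?thesis by (simp add: twist_def mult_ac)
  qed
  then have "integral {-pi..pi} (\<lambda>x. twist w r t f x * cnj (twist w' r t g x))
     = integral {-pi..pi} (\<lambda>y. f (y + t) * cnj (g (y + t)))"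
    using integral_angle_substitution[of "\<lambda>y. f (y + t) * cnj (g (y + t))" r]
    by (simp add: cper_mult cper_cnj cper_shift f g)
  also have "\<dots> = integral {-pi..pi} (\<lambda>y. f y * cnj (g y))"
    using integral_periodic_shift[of "\<lambda>y. f y * cnj (g y)" t] by (simp add: cper_mult cper_cnj f g)
  finally show ?thesis by (simp add: l2_ip_def)
qed

lemma twist_twist_minus:
  assumes "f \<in> cper"
  shows "twist w r 0 (twist w (- r) 0 f) = f"
proof
  fix x
  have "complex_of_real (radius r x) powr w * complex_of_real (radius (- r) (angle r x)) powr w = 1"
    using radius_pos[of r x] by (simp add: radius_angle_minus flip: powr_times_real)
  moreover have "f (angle (- r) (angle r x)) = f x"
    by (rule cper_cong_cis[OF assms cis_angle_minus])
  ultimately show "twist w r 0 (twist w (- r) 0 f) x = f x"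
    by (simp add: twist_def mult.assoc[symmetric])
qed

lemma l2_twist_adjoint:
  assumes f: "f \<in> cper" and g: "g \<in> cper" and w: "w + cnj w' = - 2"
  shows "l2_ip (twist w r 0 f) g = l2_ip f (twist w' (- r) 0 g)"
  using l2_twist_twist[OF f twist_cper[OF g, of w' "- r" 0] w, of r 0] by (simp add: twist_twist_minus g)

definition mcoeff :: "complex \<Rightarrow> real \<Rightarrow> int \<Rightarrow> int \<Rightarrow> complex" where
  "mcoeff w r n m = fcoeff (twist w r 0 (char_fun m)) n"

lemma fcoeff_twist_cper:
  assumes f: "f \<in> cper"
  shows "(\<lambda>t. fcoeff (twist w r t f) n) \<in> cper"
proof -
  have "continuous_on UNIV (\<lambda>t. integral (cbox (-pi) pi) (\<lambda>x. twist w r t f x * cnj (char_fun n x)))"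
    unfolding twist_def
    by (intro integral_continuous_on_param)
      (auto simp: case_prod_unfold intro!: continuous_intros
        continuous_on_compose2[OF cper_continuous[OF f, of UNIV]]
        continuous_on_compose2[OF cper_continuous[OF char_fun_cper, of UNIV]])
  then show ?thesis
    using cper_periodic[OF f] by (simp add: cper_def fcoeff_def l2_ip_def twist_def add.assoc[symmetric] continuous_on_divide)
qed

text \<open>After exchanging the integrals, the inner one is a Fourier coefficient of
  \<open>f\<close> translated by the angle, which produces the character \<open>m\<close> at
  \<open>angle r x\<close>; what remains is the integral of \<open>mcoeff\<close>.\<close>

lemma fcoeff_fcoeff_twist:
  assumes f: "f \<in> cper"
  shows "fcoeff (\<lambda>t. fcoeff (twist w r t f) n) m = fcoeff f m * mcoeff w r n m"
proof -
  define k where "k x = of_real (radius r x) powr w * cnj (char_fun n x)" for x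
  have k: "continuous_on UNIV k"
    unfolding k_def by (intro continuous_intros cper_continuous[OF char_fun_cper])
  have "integral {-pi..pi} (\<lambda>t. integral {-pi..pi} (\<lambda>x. k x * f (angle r x + t)) * cnj (char_fun m t))
    = integral {-pi..pi} (\<lambda>t. integral {-pi..pi} (\<lambda>x. k x * f (angle r x + t) * cnj (char_fun m t)))"
    by simp
  also have "\<dots> = integral {-pi..pi} (\<lambda>x. integral {-pi..pi} (\<lambda>t. k x * f (angle r x + t) * cnj (char_fun m t)))"
  proof -
    have "continuous_on (cbox (-pi, -pi) (pi, pi)) (\<lambda>(t, x). k x * f (angle r x + t) * cnj (char_fun m t))"
      unfolding case_prod_unfold
      by (intro continuous_intros continuous_on_compose2[OF k] continuous_on_compose2[OF cper_continuous[OF f, of UNIV]]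
        continuous_on_compose2[OF cper_continuous[OF char_fun_cper, of UNIV]] subset_UNIV)
    then show ?thesis
      using integral_swap_continuous[of "-pi" "-pi" pi pi "\<lambda>t x. k x * f (angle r x + t) * cnj (char_fun m t)"]
      unfolding cbox_interval by blast
  qed
  also have "\<dots> = integral {-pi..pi} (\<lambda>x. k x * char_fun m (angle r x) * (2 * pi * fcoeff f m))"
  proof (intro arg_cong[where f = "integral _"] ext)
    fix x
    have "integral {-pi..pi} (\<lambda>t. f (angle r x + t) * cnj (char_fun m t))
      = integral {-pi..pi} (\<lambda>t. (\<lambda>y. f y * cnj (char_fun m (y - angle r x))) (t + angle r x))"
      by (simp add: add.commute)
    also have "\<dots> = integral {-pi..pi} (\<lambda>y. f y * cnj (char_fun m (y - angle r x)))"
      using cper_shift[OF char_fun_cper, of m "- angle r x"] f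
      by (intro integral_periodic_shift cper_mult cper_cnj) simp_all
    also have "\<dots> = integral {-pi..pi} (\<lambda>y. char_fun m (angle r x) * (f y * cnj (char_fun m y)))"
      by (simp add: char_fun_diff cnj_char_fun mult_ac)
    also have "\<dots> = char_fun m (angle r x) * (2 * pi * fcoeff f m)"
      by (simp add: fcoeff_def l2_ip_def)
    finally show "integral {-pi..pi} (\<lambda>t. k x * f (angle r x + t) * cnj (char_fun m t)) = k x * char_fun m (angle r x) * (2 * pi * fcoeff f m)"
      by (simp add: mult.assoc)
  qed
  also have "\<dots> = (2 * pi * fcoeff f m) * (2 * pi * mcoeff w r n m)"
    by (simp add: mcoeff_def fcoeff_def[of "twist _ _ _ _"] l2_ip_def twist_def k_def mult_ac)
  finally have "integral {-pi..pi} (\<lambda>t. integral {-pi..pi} (\<lambda>x. k x * f (angle r x + t)) * cnj (char_fun m t))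
    = (2 * pi * fcoeff f m) * (2 * pi * mcoeff w r n m)" .
  then show ?thesis
    by (simp add: fcoeff_def[of "\<lambda>t. _ t"] l2_ip_def[of "\<lambda>t. _ t"] twist_def k_def mult_ac)
qed

section \<open>Matrix coefficients of the principal series\<close>

text \<open>
  The sign \<open>\<sigma>\<close> and the monotonicity of \<open>P\<close> keep the boundary terms and the integral of \<open>\<bar>Pd / P\<^sup>2\<bar>\<close>
  under control without a bound on \<open>Pd\<close>.
\<close>

lemma nonstationary_bound:
  fixes V Vd P Pd U Ud \<Psi> :: "real \<Rightarrow> real"
  assumes xy: "x \<le> y" and \<delta>: "0 < \<delta>" and \<sigma>: "\<sigma> = 1 \<or> \<sigma> = -1"
    and V: "\<And>t. t \<in> {x..y} \<Longrightarrow> (V has_real_derivative Vd t) (at t)"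
    and P: "\<And>t. t \<in> {x..y} \<Longrightarrow> (P has_real_derivative Pd t) (at t)"
    and U: "\<And>t. t \<in> {x..y} \<Longrightarrow> (U has_real_derivative Ud t) (at t)"
    and \<Psi>: "\<And>t. t \<in> {x..y} \<Longrightarrow> (\<Psi> has_real_derivative P t / (2 * (V t)\<^sup>2)) (at t)"
    and Vb: "\<And>t. t \<in> {x..y} \<Longrightarrow> 0 < V t \<and> V t \<le> B"
    and Vd: "\<And>t. t \<in> {x..y} \<Longrightarrow> \<bar>Vd t\<bar> \<le> Ud t"
    and Pb: "\<And>t. t \<in> {x..y} \<Longrightarrow> \<delta> \<le> \<bar>P t\<bar>"
    and Pd: "\<And>t. t \<in> {x..y} \<Longrightarrow> 0 \<le> \<sigma> * Pd t"
  shows "cmod (integral {x..y} (\<lambda>t. of_real (1 / (2 * V t)) * cis (\<Psi> t))) \<le> (4 * B + (U y - U x)) / \<delta>"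
proof -
  \<comment> \<open>Amplitude \<open>1 / (2 V)\<close> over phase derivative
    \<open>P / (2 V^2)\<close> is \<open>V / P\<close>. So \<open>H\<close> is a primitive of the
    integrand up to the error \<open>E\<close>, which carries the derivative of
    \<open>V / P\<close>.\<close>
  define H where "H t = of_real (V t / P t) * cis (\<Psi> t) / \<i>" for t
  define E where "E t = of_real ((Vd t * P t - V t * Pd t) / (P t)\<^sup>2) * cis (\<Psi> t) / \<i>" for t
  \<comment> \<open>A primitive of the majorant of |E|: \<open>Ud / \<delta>\<close> dominates the
    term with \<open>Vd\<close>, and the derivative of \<open>- \<sigma> * B / P\<close> the term
    with \<open>Pd\<close>.\<close>
  define R where "R t = U t / \<delta> - \<sigma> * B / P t" for t
  have P0: "P t \<noteq> 0" if "t \<in> {x..y}" for t using Pb[OF that] \<delta> by auto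
  have B: "0 \<le> B" using Vb[of x] xy by auto
  have dH: "(H has_vector_derivative (E t + of_real (1 / (2 * V t)) * cis (\<Psi> t))) (at t within {x..y})"
    if t: "t \<in> {x..y}" for t
  proof -
    have 1: "((\<lambda>t. V t / P t) has_real_derivative (Vd t * P t - V t * Pd t) / (P t * P t)) (at t)"
      by (rule DERIV_divide[OF V[OF t] P[OF t] P0[OF t]])
    have 2: "((\<lambda>t. cis (\<Psi> t)) has_vector_derivative (P t / (2 * (V t)\<^sup>2)) *\<^sub>R (\<i> * cis (\<Psi> t))) (at t)"
    proof -
      have "(cis has_vector_derivative \<i> * cis (\<Psi> t)) (at (\<Psi> t))"
        unfolding cis_conv_exp[abs_def] by (auto intro!: derivative_eq_intros has_vector_derivative_real_field)
      from vector_diff_chain_at[OF \<Psi>[OF t, unfolded has_real_derivative_iff_has_vector_derivative] this]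
      show ?thesis by (simp add: o_def)
    qed
    have "(H has_vector_derivative ((of_real (V t / P t) * ((P t / (2 * (V t)\<^sup>2)) *\<^sub>R (\<i> * cis (\<Psi> t)))
       + of_real ((Vd t * P t - V t * Pd t) / (P t * P t)) * cis (\<Psi> t)) / \<i>)) (at t)"
      unfolding H_def
      by (intro has_vector_derivative_divide has_vector_derivative_mult 2 has_vector_derivative_of_real)
        (use 1 in \<open>simp add: has_real_derivative_iff_has_vector_derivative\<close>)
    also have "(of_real (V t / P t) * ((P t / (2 * (V t)\<^sup>2)) *\<^sub>R (\<i> * cis (\<Psi> t)))
       + of_real ((Vd t * P t - V t * Pd t) / (P t * P t)) * cis (\<Psi> t)) / \<i> = E t + of_real (1 / (2 * V t)) * cis (\<Psi> t)"
      using P0[OF t] Vb[OF t] by (simp add: E_def scaleR_conv_of_real power2_eq_square add_divide_distrib diff_divide_distrib algebra_simps)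
    finally show ?thesis by (rule has_vector_derivative_at_within)
  qed
  have cont: "continuous_on {x..y} V" "continuous_on {x..y} \<Psi>"
    by (rule continuous_at_imp_continuous_on, blast intro: DERIV_isCont V,
        rule continuous_at_imp_continuous_on, blast intro: DERIV_isCont \<Psi>)
  have int: "(\<lambda>t. of_real (1 / (2 * V t)) * cis (\<Psi> t)) integrable_on {x..y}"
    using Vb by (intro integrable_continuous_interval continuous_intros cont) (auto, force)
  have "((\<lambda>t. E t + of_real (1 / (2 * V t)) * cis (\<Psi> t)) has_integral (H y - H x)) {x..y}"
    by (rule fundamental_theorem_of_calculus[OF xy dH])
  from has_integral_diff[OF this integrable_integral[OF int]]
  have intE: "(E has_integral (H y - H x - integral {x..y} (\<lambda>t. of_real (1 / (2 * V t)) * cis (\<Psi> t)))) {x..y}"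
    by simp
  have dR: "(R has_real_derivative (Ud t / \<delta> + \<sigma> * B * Pd t / (P t)\<^sup>2)) (at t)" if t: "t \<in> {x..y}" for t
    unfolding R_def using P0[OF t] \<delta>
    by (auto intro!: derivative_eq_intros U[OF t] P[OF t] simp: power2_eq_square field_simps)
  have intR: "((\<lambda>t. Ud t / \<delta> + \<sigma> * B * Pd t / (P t)\<^sup>2) has_integral (R y - R x)) {x..y}"
    using dR by (intro fundamental_theorem_of_calculus[OF xy])
      (auto simp: has_real_derivative_iff_has_vector_derivative intro: has_vector_derivative_at_within)
  have le: "cmod (E t) \<le> Ud t / \<delta> + \<sigma> * B * Pd t / (P t)\<^sup>2" if t: "t \<in> {x..y}" for t
  proof -
    have "cmod (E t) = \<bar>Vd t / P t - V t * Pd t / (P t)\<^sup>2\<bar>"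
      using P0[OF t] by (simp add: E_def norm_mult norm_divide power2_eq_square diff_divide_distrib flip: of_real_mult of_real_divide of_real_diff)
    also have "\<dots> \<le> \<bar>Vd t / P t\<bar> + \<bar>V t * Pd t / (P t)\<^sup>2\<bar>" by (rule abs_triangle_ineq4)
    also have "\<bar>Vd t / P t\<bar> \<le> Ud t / \<delta>"
      using Vd[OF t] Pb[OF t] \<delta> unfolding abs_divide by (intro frac_le) auto
    also have "\<bar>V t * Pd t / (P t)\<^sup>2\<bar> = V t * (\<sigma> * Pd t) / (P t)\<^sup>2"
      using \<sigma> Pd[OF t] Vb[OF t] by (auto simp: abs_mult)
    also have "\<dots> \<le> B * (\<sigma> * Pd t) / (P t)\<^sup>2"
      using Vb[OF t] Pd[OF t] by (intro divide_right_mono mult_right_mono) auto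
    finally show ?thesis by (simp add: mult_ac)
  qed
  have "cmod (H y - H x - integral {x..y} (\<lambda>t. of_real (1 / (2 * V t)) * cis (\<Psi> t))) \<le> R y - R x"
    using integral_norm_bound_integral[of E "{x..y}" "\<lambda>t. Ud t / \<delta> + \<sigma> * B * Pd t / (P t)\<^sup>2"] le intE intR
    by (simp add: integral_unique has_integral_integrable)
  moreover have HB: "cmod (H t) \<le> B / \<delta>" if "t \<in> {x..y}" for t
  proof -
    have "cmod (H t) = V t / \<bar>P t\<bar>" using Vb[OF that] by (simp add: H_def norm_mult norm_divide)
    also have "\<dots> \<le> B / \<delta>" using Vb[OF that] Pb[OF that] \<delta> by (intro frac_le) auto
    finally show ?thesis .
  qed
  have calc: "\<bar>\<sigma> * B / P t\<bar> \<le> B / \<delta>" if "t \<in> {x..y}" for t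
  proof -
    have "\<bar>\<sigma> * B / P t\<bar> = B / \<bar>P t\<bar>" using \<sigma> B by auto
    also have "\<dots> \<le> B / \<delta>" using Pb[OF that] \<delta> B by (intro frac_le) auto
    finally show ?thesis .
  qed
  have "R y - R x \<le> (U y - U x) / \<delta> + 2 * (B / \<delta>)"
  proof -
    have "- (\<sigma> * B / P y) \<le> B / \<delta>" "\<sigma> * B / P x \<le> B / \<delta>"
      using calc[of x] calc[of y] xy by (simp_all only: abs_le_iff) auto
    then show ?thesis unfolding R_def diff_divide_distrib by argo
  qed
  moreover have "cmod (integral {x..y} (\<lambda>t. of_real (1 / (2 * V t)) * cis (\<Psi> t)))
    \<le> cmod (H y) + cmod (H x) + cmod (H y - H x - integral {x..y} (\<lambda>t. of_real (1 / (2 * V t)) * cis (\<Psi> t)))"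
    by norm
  \<comment> \<open>The \<open>4 * B\<close> consists of two boundary values of \<open>H\<close> and
    two of \<open>\<sigma> * B / P\<close>.\<close>
  ultimately have "cmod (integral {x..y} (\<lambda>t. of_real (1 / (2 * V t)) * cis (\<Psi> t)))
    \<le> B / \<delta> + B / \<delta> + ((U y - U x) / \<delta> + 2 * (B / \<delta>))"
    using HB[of x] HB[of y] xy by simp
  then show ?thesis by (simp add: add_divide_distrib)
qed

text \<open>A function with second derivative at least \<open>\<kappa>\<close> lies below its chord
  by at least \<open>\<kappa> (y - x)^2 / 8\<close> at the midpoint, while values between
  \<open>- \<kappa>\<close> and \<open>\<kappa>\<close> allow a gap of at most
  \<open>2 \<kappa>\<close>.\<close>

lemma second_derivative_sublevel:
  fixes P Pd Pdd :: "real \<Rightarrow> real"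
  assumes xy: "x \<le> y" and \<kappa>: "0 < \<kappa>"
    and P: "\<And>t. t \<in> {x..y} \<Longrightarrow> (P has_real_derivative Pd t) (at t)"
    and Pd: "\<And>t. t \<in> {x..y} \<Longrightarrow> (Pd has_real_derivative Pdd t) (at t)"
    and Pdd: "\<And>t. t \<in> {x..y} \<Longrightarrow> \<kappa> \<le> Pdd t"
    and Pb: "\<And>t. t \<in> {x..y} \<Longrightarrow> \<bar>P t\<bar> \<le> \<kappa>"
  shows "y - x \<le> 4"
proof -
  define m where "m = (x + y) / 2"
  have "convex_on {x..y} (\<lambda>t. P t - \<kappa> * t\<^sup>2 / 2)"
    by (rule f''_ge0_imp_convex[where f' = "\<lambda>t. Pd t - \<kappa> * t" and f'' = "\<lambda>t. Pdd t - \<kappa>"])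
      (use Pdd in \<open>auto intro!: derivative_eq_intros P Pd\<close>)
  from convex_onD[OF this, of "1/2" x y] xy
  have "P m - \<kappa> * m\<^sup>2 / 2 \<le> (P x - \<kappa> * x\<^sup>2 / 2) / 2 + (P y - \<kappa> * y\<^sup>2 / 2) / 2"
    by (simp add: m_def add_divide_distrib)
  moreover have "P x \<le> \<kappa>" "P y \<le> \<kappa>" "- P m \<le> \<kappa>"
    using xy Pb[of x] Pb[of y] Pb[of m] by (auto simp: m_def abs_le_iff)
  ultimately have "\<kappa> * x\<^sup>2 / 4 + \<kappa> * y\<^sup>2 / 4 - \<kappa> * m\<^sup>2 / 2 \<le> \<kappa> * 2" by argo
  also have "\<kappa> * x\<^sup>2 / 4 + \<kappa> * y\<^sup>2 / 4 - \<kappa> * m\<^sup>2 / 2 = \<kappa> * ((y - x)\<^sup>2 / 8)"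
    by (simp add: m_def power2_eq_square field_simps)
  finally have "\<kappa> * ((y - x)\<^sup>2 / 8) \<le> \<kappa> * 2" .
  then have "(y - x)\<^sup>2 \<le> 4\<^sup>2" using \<kappa> by simp
  then show ?thesis by (rule power2_le_imp_le) simp
qed

text \<open>Each side of \<open>c\<close> is degenerate or carries a definite sign, so integrals
  over the two sides can be estimated separately. The cases \<open>c = x\<close> and
  \<open>c = y\<close> cover a function without sign change.\<close>

lemma monotone_sign_split:
  fixes Q :: "real \<Rightarrow> real"
  assumes xy: "x \<le> y" and cont: "continuous_on {x..y} Q"
    and mono: "\<And>s t. x \<le> s \<Longrightarrow> s \<le> t \<Longrightarrow> t \<le> y \<Longrightarrow> Q s \<le> Q t"
  obtains c where "x \<le> c" "c \<le> y" "c = x \<or> (\<forall>t\<in>{x..c}. Q t \<le> 0)" "c = y \<or> (\<forall>t\<in>{c..y}. 0 \<le> Q t)"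
proof -
  consider "0 \<le> Q x" | "Q y \<le> 0" | "Q x \<le> 0" "0 \<le> Q y" by linarith
  then show thesis
  proof cases
    case 1
    have "0 \<le> Q t" if "t \<in> {x..y}" for t using 1 mono[of x t] that by auto
    then show thesis using that[of x] xy by auto
  next
    case 2
    have "Q t \<le> 0" if "t \<in> {x..y}" for t using 2 mono[of t y] that by auto
    then show thesis using that[of y] xy by auto
  next
    case 3
    from IVT'[of Q x 0 y] 3 xy cont obtain c where c: "x \<le> c" "c \<le> y" "Q c = 0" by auto
    have "Q t \<le> 0" if "t \<in> {x..c}" for t using c mono[of t c] that by auto
    moreover have "0 \<le> Q t" if "t \<in> {c..y}" for t using c mono[of c t] that by auto
    ultimately show thesis using that[of c] c by auto
  qed
qed

section \<open>The oscillatory integral in the variable \<open>t\<close>\<close>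

lemma cosh_mult_shift: "cosh (r + t) * cosh (r - t) = (cosh r)\<^sup>2 + (sinh t)\<^sup>2" for r t :: real
proof -
  have "(cosh r)\<^sup>2 = (sinh r)\<^sup>2 + 1" "(cosh t)\<^sup>2 = (sinh t)\<^sup>2 + 1" by (rule cosh_square_eq)+
  then show ?thesis unfolding cosh_add cosh_diff by algebra
qed

lemma sinh_shift_sum: "sinh (r + t) * cosh (r - t) + cosh (r + t) * sinh (r - t) = sinh (2 * r)" for r t :: real
  using sinh_add[of "r + t" "r - t"] by simp

context
  fixes a m n r :: real and \<Psi> V P Pd :: "real \<Rightarrow> real"
  assumes r: "0 < r" and a: "a \<noteq> 0"
    and V_eq: "\<And>t. V t = sqrt ((cosh r)\<^sup>2 + (sinh t)\<^sup>2)"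
    and P_eq: "\<And>t. P t = a + m * cosh (r - t) - n * cosh (r + t)"
    and Pd_eq: "\<And>t. Pd t = - m * sinh (r - t) - n * sinh (r + t)"
    and \<Psi>: "\<And>t. (\<Psi> has_real_derivative P t / (2 * (V t)\<^sup>2)) (at t)"
begin

text \<open>The first bound keeps the amplitude \<open>1 / (2 V)\<close> below e^(-r), the second
  keeps the derivative of \<open>V\<close> below \<open>cosh t\<close>.\<close>

lemma V_ge: "exp r / 2 \<le> V t" "cosh t \<le> V t" "0 < V t"
proof -
  have "cosh r \<le> V t" unfolding V_eq by (rule real_le_rsqrt) simp
  moreover have "exp r / 2 \<le> cosh r" by (simp add: cosh_field_def)
  ultimately show 1: "exp r / 2 \<le> V t" by linarith
  show "cosh t \<le> V t"
    unfolding V_eq cosh_square_eq[of r] by (rule real_le_rsqrt) (simp add: cosh_square_eq)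
  show "0 < V t" using 1 exp_gt_zero[of r] by linarith
qed

lemma V_le: "t \<in> {-r..r} \<Longrightarrow> V t \<le> exp r"
proof -
  assume t: "t \<in> {-r..r}"
  have "sinh t \<le> sinh r" "sinh (- t) \<le> sinh r" using t by (auto simp del: sinh_minus)
  then have "\<bar>sinh t\<bar> \<le> sinh r" by (simp add: abs_le_iff)
  then have "(sinh t)\<^sup>2 \<le> (sinh r)\<^sup>2" using power_mono[of "\<bar>sinh t\<bar>" "sinh r" 2] by simp
  then have "(cosh r)\<^sup>2 + (sinh t)\<^sup>2 \<le> (cosh r + sinh r)\<^sup>2"
    using r by (simp add: power2_sum add_increasing2)
  then show "V t \<le> exp r"
    unfolding V_eq cosh_plus_sinh by (rule real_le_lsqrt[rotated]) simp_all
qed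

lemma V_deriv: "(V has_real_derivative sinh t * cosh t / V t) (at t)"
proof -
  have "0 < (cosh r)\<^sup>2 + (sinh t)\<^sup>2" by (intro add_pos_nonneg) simp_all
  then show ?thesis unfolding V_eq[abs_def]
    by (auto intro!: derivative_eq_intros simp: divide_simps)
qed

lemma P_deriv: "(P has_real_derivative Pd t) (at t)"
  unfolding P_eq[abs_def] Pd_eq by (auto intro!: derivative_eq_intros)

lemma Pd_deriv: "(Pd has_real_derivative P t - a) (at t)"
  unfolding P_eq Pd_eq[abs_def] by (auto intro!: derivative_eq_intros)

abbreviation (input) "amp t \<equiv> of_real (1 / (2 * V t)) * cis (\<Psi> t)"

lemma amp_integrable: "(\<lambda>t. amp t) integrable_on {x..y}"
proof -
  have "continuous_on {x..y} V" "continuous_on {x..y} \<Psi>"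
    using V_deriv \<Psi> by (meson DERIV_isCont continuous_at_imp_continuous_on)+
  then show ?thesis
    using V_ge(3) by (intro integrable_continuous_interval continuous_intros) (auto simp: less_imp_neq[symmetric])
qed

text \<open>\<open>U = sinh\<close> dominates the variation of \<open>V\<close>; over
  \<open>[-r, r]\<close> it grows by at most e^r, and \<open>V\<close> is at most e^r there. With
  \<delta> = |a|/2 the constant is 2 (4 + 1) = 10.\<close>

lemma amp_large:
  assumes "x \<le> y" "{x..y} \<subseteq> {-r..r}" "\<sigma> = 1 \<or> \<sigma> = -1"
    "\<And>t. t \<in> {x..y} \<Longrightarrow> 0 \<le> \<sigma> * Pd t" "\<And>t. t \<in> {x..y} \<Longrightarrow> \<bar>a\<bar> / 2 \<le> \<bar>P t\<bar>"
  shows "cmod (integral {x..y} (\<lambda>t. amp t)) \<le> 10 * exp r / \<bar>a\<bar>"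
proof -
  have "cmod (integral {x..y} (\<lambda>t. amp t)) \<le> (4 * exp r + (sinh y - sinh x)) / (\<bar>a\<bar> / 2)"
  proof (rule nonstationary_bound[where V = V and P = P and U = sinh and \<sigma> = \<sigma> and Pd = Pd, OF assms(1) _ assms(3) V_deriv P_deriv _ \<Psi>])
    show "0 < \<bar>a\<bar> / 2" using a by simp
    show "(sinh has_real_derivative cosh t) (at t)" for t :: real by (auto intro!: derivative_eq_intros)
    show "\<bar>sinh t * cosh t / V t\<bar> \<le> cosh t" for t
    proof -
      have "\<bar>sinh t\<bar> \<le> cosh t" using sinh_le_cosh_real[of t] sinh_le_cosh_real[of "-t"] by (simp add: abs_le_iff)
      then have "\<bar>sinh t\<bar> * cosh t \<le> cosh t * V t"
        using V_ge(2)[of t] by (subst mult.commute) (intro mult_left_mono, auto)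
      then show ?thesis using V_ge(3)[of t] by (simp add: abs_mult field_simps)
    qed
  qed (use assms V_ge V_le in auto)
  also have "\<dots> \<le> (4 * exp r + exp r) / (\<bar>a\<bar> / 2)"
  proof -
    have "sinh y \<le> sinh r" "sinh (- r) \<le> sinh x" using assms(1,2) by (auto simp del: sinh_minus)
    moreover have "2 * sinh r \<le> exp r" by (simp add: sinh_field_def)
    ultimately have "sinh y - sinh x \<le> exp r" unfolding sinh_minus by linarith
    then show ?thesis by (intro divide_right_mono) auto
  qed
  finally show ?thesis by simp
qed

text \<open>Where |P| \<le> |a|/2, the second derivative \<open>P - a\<close> has the sign opposite
  to \<open>a\<close> and size at least |a|/2, so such an interval has length at most 4, whatever
  \<open>m\<close> and \<open>n\<close> are.\<close>

lemma amp_small: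
  assumes "x \<le> y" "{x..y} \<subseteq> {-r..r}" "\<And>t. t \<in> {x..y} \<Longrightarrow> \<bar>P t\<bar> \<le> \<bar>a\<bar> / 2"
  shows "cmod (integral {x..y} (\<lambda>t. amp t)) \<le> 4 * exp (- r)"
proof -
  have "y - x \<le> 4"
  proof (cases "a > 0")
    case True
    show ?thesis
      by (rule second_derivative_sublevel[where P = "\<lambda>t. - P t" and \<kappa> = "\<bar>a\<bar> / 2", OF assms(1) _ DERIV_minus[OF P_deriv] DERIV_minus[OF Pd_deriv]])
        (use True assms(3) in \<open>force simp: abs_le_iff\<close>)+
  next
    case False
    show ?thesis
      by (rule second_derivative_sublevel[where P = P and \<kappa> = "\<bar>a\<bar> / 2", OF assms(1) _ P_deriv Pd_deriv])
        (use False a assms(3) in \<open>force simp: abs_le_iff\<close>)+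
  qed
  have "cmod (amp t) \<le> exp (- r)" for t
  proof -
    have "cmod (amp t) = 1 / (2 * V t)" using V_ge(3)[of t] by (simp add: norm_mult norm_divide)
    also have "\<dots> \<le> 1 / exp r" using V_ge(1)[of t] by (intro divide_left_mono) (auto intro!: mult_pos_pos V_ge)
    finally show ?thesis by (simp add: exp_minus inverse_eq_divide)
  qed
  then have "cmod (integral {x..y} (\<lambda>t. amp t)) \<le> integral {x..y} (\<lambda>t. exp (- r))"
    by (intro integral_norm_bound_integral amp_integrable) auto
  also have "\<dots> = (y - x) * exp (- r)" using assms(1) by simp
  also have "\<dots> \<le> 4 * exp (- r)" using \<open>y - x \<le> 4\<close> by (intro mult_right_mono) auto
  finally show ?thesis .
qed

text \<open>The monotone function \<open>\<sigma> * P\<close> is cut at the levels -|a|/2 and |a|/2: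
  |P| is large on the two outer pieces, which cost 10 each, and small on the middle one, which costs
  4.\<close>

lemma amp_monotone_piece:
  assumes xy: "x \<le> y" and sub: "{x..y} \<subseteq> {-r..r}" and \<sigma>: "\<sigma> = 1 \<or> \<sigma> = -1"
    and Pd: "\<And>t. t \<in> {x..y} \<Longrightarrow> 0 \<le> \<sigma> * Pd t"
  shows "cmod (integral {x..y} (\<lambda>t. amp t)) \<le> 20 * exp r / \<bar>a\<bar> + 4 * exp (- r)"
proof -
  have mono: "\<sigma> * P s \<le> \<sigma> * P t" if "x \<le> s" "s \<le> t" "t \<le> y" for s t
  proof (rule DERIV_nonneg_imp_nondecreasing[OF that(2)])
    fix u assume "s \<le> u" "u \<le> t"
    then have "0 \<le> \<sigma> * Pd u" using that by (intro Pd) auto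
    then show "\<exists>y. ((\<lambda>t. \<sigma> * P t) has_real_derivative y) (at u) \<and> 0 \<le> y"
      using DERIV_cmult[OF P_deriv] by blast
  qed
  have cont: "continuous_on A (\<lambda>t. \<sigma> * P t)" for A
    by (intro continuous_intros) (meson P_deriv DERIV_isCont continuous_at_imp_continuous_on)
  obtain u where u: "x \<le> u" "u \<le> y" "u = x \<or> (\<forall>t\<in>{x..u}. \<sigma> * P t + \<bar>a\<bar> / 2 \<le> 0)"
      "u = y \<or> (\<forall>t\<in>{u..y}. 0 \<le> \<sigma> * P t + \<bar>a\<bar> / 2)"
    by (rule monotone_sign_split[OF xy, of "\<lambda>t. \<sigma> * P t + \<bar>a\<bar> / 2"])
      (auto intro!: continuous_intros cont mono)
  obtain v where v: "u \<le> v" "v \<le> y" "v = u \<or> (\<forall>t\<in>{u..v}. \<sigma> * P t - \<bar>a\<bar> / 2 \<le> 0)"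
      "v = y \<or> (\<forall>t\<in>{v..y}. 0 \<le> \<sigma> * P t - \<bar>a\<bar> / 2)"
    by (rule monotone_sign_split[OF u(2), of "\<lambda>t. \<sigma> * P t - \<bar>a\<bar> / 2"])
      (use u(1) in \<open>auto intro!: continuous_intros cont mono\<close>)
  have pos: "0 \<le> 10 * exp r / \<bar>a\<bar>" "0 \<le> 4 * exp (- r)" by auto
  have absP: "\<bar>P t\<bar> = \<bar>\<sigma> * P t\<bar>" for t using \<sigma> by auto
  have 1: "cmod (integral {x..u} (\<lambda>t. amp t)) \<le> 10 * exp r / \<bar>a\<bar>"
  proof (cases "u = x")
    case False
    then have "\<bar>a\<bar> / 2 \<le> \<bar>P t\<bar>" if "t \<in> {x..u}" for t
    proof -
      have "\<sigma> * P t + \<bar>a\<bar> / 2 \<le> 0" using False u(3) that by auto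
      then show ?thesis unfolding absP by linarith
    qed
    then show ?thesis using u sub Pd by (intro amp_large[where \<sigma> = \<sigma>] \<sigma>) auto
  qed (use pos in simp)
  have 2: "cmod (integral {u..v} (\<lambda>t. amp t)) \<le> 4 * exp (- r)"
  proof (cases "u = v")
    case False
    then have "\<bar>P t\<bar> \<le> \<bar>a\<bar> / 2" if "t \<in> {u..v}" for t
    proof -
      have "\<sigma> * P t - \<bar>a\<bar> / 2 \<le> 0" "0 \<le> \<sigma> * P t + \<bar>a\<bar> / 2" using False u(4) v that by auto
      then show ?thesis unfolding absP by (simp add: abs_le_iff)
    qed
    then show ?thesis using u v sub by (intro amp_small) auto
  qed (use pos in simp)
  have 3: "cmod (integral {v..y} (\<lambda>t. amp t)) \<le> 10 * exp r / \<bar>a\<bar>"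
  proof (cases "v = y")
    case False
    then have "\<bar>a\<bar> / 2 \<le> \<bar>P t\<bar>" if "t \<in> {v..y}" for t
    proof -
      have "0 \<le> \<sigma> * P t - \<bar>a\<bar> / 2" using False v(4) that by auto
      then show ?thesis unfolding absP by linarith
    qed
    then show ?thesis using u v sub Pd by (intro amp_large[where \<sigma> = \<sigma>] \<sigma>) auto
  qed (use pos in simp)
  have "integral {x..y} (\<lambda>t. amp t) = integral {x..u} (\<lambda>t. amp t) + (integral {u..v} (\<lambda>t. amp t) + integral {v..y} (\<lambda>t. amp t))"
    using u v amp_integrable by (simp add: Henstock_Kurzweil_Integration.integral_combine)
  then have "cmod (integral {x..y} (\<lambda>t. amp t)) \<le> cmod (integral {x..u} (\<lambda>t. amp t)) + (cmod (integral {u..v} (\<lambda>t. amp t)) + cmod (integral {v..y} (\<lambda>t. amp t)))"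
    using norm_triangle_ineq[of "integral {x..u} (\<lambda>t. amp t)" "integral {u..v} (\<lambda>t. amp t) + integral {v..y} (\<lambda>t. amp t)"]
      norm_triangle_ineq[of "integral {u..v} (\<lambda>t. amp t)" "integral {v..y} (\<lambda>t. amp t)"] by simp
  then show ?thesis using 1 2 3 by simp
qed

text \<open>At most one cut makes the sign of \<open>Pd\<close> constant on both sides. For
  \<open>m\<close>, \<open>n\<close> of equal sign, \<open>Pd\<close> has constant sign because
  \<open>sinh (r - t)\<close> and \<open>sinh (r + t)\<close> are nonnegative; for opposite signs it
  is monotone because its derivative \<open>P - a\<close> has constant sign. So two monotone pieces
  suffice uniformly in \<open>m\<close> and \<open>n\<close>.\<close>

lemma amp_total: "cmod (integral {-r..r} (\<lambda>t. amp t)) \<le> 40 * exp r / \<bar>a\<bar> + 8 * exp (- r)"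
proof -
  have key: "cmod (integral {-r..r} (\<lambda>t. amp t)) \<le> 40 * exp r / \<bar>a\<bar> + 8 * exp (- r)"
    if c: "-r \<le> c" "c \<le> r" "c = -r \<or> (\<forall>t\<in>{-r..c}. \<tau> * Pd t \<le> 0)" "c = r \<or> (\<forall>t\<in>{c..r}. 0 \<le> \<tau> * Pd t)"
      "\<tau> = 1 \<or> \<tau> = -1" for c \<tau>
  proof -
    have "cmod (integral {-r..c} (\<lambda>t. amp t)) \<le> 20 * exp r / \<bar>a\<bar> + 4 * exp (- r)"
    proof (cases "c = -r")
      case False
      then show ?thesis using c by (intro amp_monotone_piece[where \<sigma> = "- \<tau>"]) auto
    qed simp
    moreover have "cmod (integral {c..r} (\<lambda>t. amp t)) \<le> 20 * exp r / \<bar>a\<bar> + 4 * exp (- r)"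
    proof (cases "c = r")
      case False
      then show ?thesis using c by (intro amp_monotone_piece[where \<sigma> = \<tau>]) auto
    qed simp
    moreover have "integral {-r..r} (\<lambda>t. amp t) = integral {-r..c} (\<lambda>t. amp t) + integral {c..r} (\<lambda>t. amp t)"
      using c amp_integrable by (simp add: Henstock_Kurzweil_Integration.integral_combine)
    ultimately show ?thesis
      using norm_triangle_ineq[of "integral {-r..c} (\<lambda>t. amp t)" "integral {c..r} (\<lambda>t. amp t)"] by simp
  qed
  have s: "0 \<le> sinh (r - t)" "0 \<le> sinh (r + t)" if "t \<in> {-r..r}" for t using that by auto
  have contPd: "continuous_on A Pd" for A
    by (meson Pd_deriv DERIV_isCont continuous_at_imp_continuous_on)
  consider "0 \<le> m" "0 \<le> n" | "m \<le> 0" "n \<le> 0" | "0 \<le> m" "n \<le> 0" | "m \<le> 0" "0 \<le> n" by linarith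
  then show ?thesis
  proof cases
    case 1
    then have "Pd t \<le> 0" if "t \<in> {-r..r}" for t
      using mult_nonneg_nonneg[OF 1(1) s(1)[OF that]] mult_nonneg_nonneg[OF 1(2) s(2)[OF that]]
      unfolding Pd_eq by linarith
    then show ?thesis using r by (intro key[of r 1]) auto
  next
    case 2
    then have "0 \<le> Pd t" if "t \<in> {-r..r}" for t
      using mult_nonpos_nonneg[OF 2(1) s(1)[OF that]] mult_nonpos_nonneg[OF 2(2) s(2)[OF that]]
      unfolding Pd_eq by linarith
    then show ?thesis using r by (intro key[of "-r" 1]) auto
  next
    case 3
    have mono: "Pd u \<le> Pd v" if "u \<le> v" for u v
    proof (rule DERIV_nonneg_imp_nondecreasing[OF that])
      fix t
      have "0 \<le> P t - a" using mult_nonneg_nonneg[OF 3(1) cosh_real_nonneg[of "r - t"]]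
          mult_nonpos_nonneg[OF 3(2) cosh_real_nonneg[of "r + t"]] unfolding P_eq by linarith
      then show "\<exists>y. (Pd has_real_derivative y) (at t) \<and> 0 \<le> y" using Pd_deriv by blast
    qed
    obtain c where "-r \<le> c" "c \<le> r" "c = -r \<or> (\<forall>t\<in>{-r..c}. Pd t \<le> 0)" "c = r \<or> (\<forall>t\<in>{c..r}. 0 \<le> Pd t)"
      by (rule monotone_sign_split[of "-r" r Pd]) (use r contPd mono in auto)
    then show ?thesis by (intro key[of c 1]) auto
  next
    case 4
    have mono: "- Pd u \<le> - Pd v" if "u \<le> v" for u v
    proof (rule DERIV_nonneg_imp_nondecreasing[OF that])
      fix t
      have "0 \<le> - (P t - a)" using mult_nonneg_nonneg[OF 4(2) cosh_real_nonneg[of "r + t"]]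
          mult_nonpos_nonneg[OF 4(1) cosh_real_nonneg[of "r - t"]] unfolding P_eq by linarith
      then show "\<exists>y. ((\<lambda>t. - Pd t) has_real_derivative y) (at t) \<and> 0 \<le> y" using DERIV_minus[OF Pd_deriv] by blast
    qed
    obtain c where "-r \<le> c" "c \<le> r" "c = -r \<or> (\<forall>t\<in>{-r..c}. - Pd t \<le> 0)" "c = r \<or> (\<forall>t\<in>{c..r}. 0 \<le> - Pd t)"
      by (rule monotone_sign_split[of "-r" r "\<lambda>t. - Pd t"]) (use r mono in \<open>auto intro!: continuous_intros contPd\<close>)
    then show ?thesis by (intro key[of c "-1"]) auto
  qed
qed

end

section \<open>Oscillatory integrals over the circle\<close>

lemma radius_ge_cos: "exp (- r) * \<bar>cos x\<bar> \<le> radius r x"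
  and radius_ge_sin: "exp r * \<bar>sin x\<bar> \<le> radius r x"
proof -
  have "(exp (- r) * \<bar>cos x\<bar>)\<^sup>2 = exp (- 2 * r) * (cos x)\<^sup>2" "(exp r * \<bar>sin x\<bar>)\<^sup>2 = exp (2 * r) * (sin x)\<^sup>2"
    by (simp_all add: power2_eq_square mult_ac flip: exp_add)
  then show "exp (- r) * \<bar>cos x\<bar> \<le> radius r x" "exp r * \<bar>sin x\<bar> \<le> radius r x"
    unfolding radius_def by (intro real_le_rsqrt; simp)+
qed

lemma radius_ge:
  assumes "0 \<le> r"
  shows "exp (- r) \<le> radius r x"
proof -
  have "exp (- 2 * r) * (sin x)\<^sup>2 \<le> exp (2 * r) * (sin x)\<^sup>2" using assms by (intro mult_right_mono) auto
  moreover have "exp (- 2 * r) * (cos x)\<^sup>2 + exp (- 2 * r) * (sin x)\<^sup>2 = exp (- 2 * r)"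
    by (simp flip: distrib_left)
  moreover have "(exp (- r))\<^sup>2 = exp (- 2 * r)" by (simp add: power2_eq_square flip: exp_add)
  ultimately show ?thesis unfolding radius_def by (intro real_le_rsqrt) linarith
qed

lemma norm_radius_powr: "cmod (of_real (radius r x) powr w) = radius r x powr Re w"
  using radius_pos[of r x] by (simp add: norm_powr_real_powr)

text \<open>The integrand of 2 \<pi> \<open>mcoeff (\<i> * of_real s - 1) r n m\<close>. Its modulus
  is \<open>1 / radius r x\<close>; everything else is phase.\<close>

definition osc :: "real \<Rightarrow> real \<Rightarrow> int \<Rightarrow> int \<Rightarrow> real \<Rightarrow> complex" where
  "osc s r n m x = of_real (radius r x) powr (\<i> * of_real s - 1) * char_fun m (angle r x) * cnj (char_fun n x)"

lemma norm_osc: "cmod (osc s r n m x) = 1 / radius r x"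
  using radius_pos[of r x] by (simp add: osc_def norm_mult norm_radius_powr powr_minus_divide)

lemma osc_continuous: "continuous_on S (osc s r n m)"
  unfolding osc_def[abs_def]
  by (intro continuous_intros continuous_on_compose2[OF cper_continuous[OF char_fun_cper, of UNIV]]
      cper_continuous[OF char_fun_cper] subset_UNIV)

lemma osc_integrable: "osc s r n m integrable_on {a..b}"
  by (intro integrable_continuous_interval osc_continuous)

lemma osc_integral_bound:
  assumes "a \<le> b" "\<And>x. x \<in> {a..b} \<Longrightarrow> B \<le> radius r x" "0 < B"
  shows "cmod (integral {a..b} (osc s r n m)) \<le> (b - a) / B"
proof -
  have "cmod (integral {a..b} (osc s r n m)) \<le> integral {a..b} (\<lambda>x. 1 / B)"
    using assms by (intro integral_norm_bound_integral osc_integrable) (auto simp: norm_osc intro!: frac_le)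
  then show ?thesis using assms by simp
qed

lemma osc_middle:
  assumes r: "1 \<le> r" and s: "s \<noteq> 0"
  shows "cmod (integral {arctan (exp (- 2 * r))..pi / 4} (osc s r n m)) \<le> (160 / \<bar>s\<bar> + 8) * exp (- r)"
proof -
  \<comment> \<open>The limits of integration are \<open>\<theta> (-r)\<close> and
    \<open>\<theta> r\<close>. In this variable \<open>radius^2\<close> is
    \<open>cosh (r + t) / cosh (r - t)\<close>, and \<open>angle r (\<theta> t)\<close> and
    \<open>\<theta> t\<close> have derivatives \<open>1 / (2 * cosh (r + t))\<close> and
    \<open>1 / (2 * cosh (r - t))\<close>.\<close>
  define \<theta> where "\<theta> t = arctan (exp (t - r))" for t
  define V where "V t = sqrt ((cosh r)\<^sup>2 + (sinh t)\<^sup>2)" for t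
  define a where "a = s * sinh (2 * r)"
  \<comment> \<open>The first term is \<open>s\<close> times the logarithm of the radius, the phase
    of the complex power; the others come from the two characters.\<close>
  define \<Psi> where "\<Psi> t = s * ((ln (cosh (r + t)) - ln (cosh (r - t))) / 2) + of_int m * angle r (\<theta> t) - of_int n * \<theta> t" for t
  have cp: "0 < cosh u" for u :: real by (rule cosh_real_pos)
  have Vsq: "(V t)\<^sup>2 = cosh (r + t) * cosh (r - t)" for t
    unfolding V_def cosh_mult_shift by (rule real_sqrt_pow2) simp
  have Veq: "V t = sqrt (cosh (r + t) * cosh (r - t))" for t unfolding V_def cosh_mult_shift ..
  have d\<theta>: "(\<theta> has_real_derivative 1 / (2 * cosh (r - t))) (at t within S)" for t S
  proof -
    have "1 = exp (t - r) * exp (r - t)" "(exp (t - r))\<^sup>2 = exp (t - r) * exp (- (r - t))"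
      by (simp_all add: power2_eq_square flip: exp_add)
    then have "1 + (exp (t - r))\<^sup>2 = exp (t - r) * (2 * cosh (r - t))"
      by (simp add: cosh_field_def algebra_simps)
    then have "exp (t - r) / (1 + (exp (t - r))\<^sup>2) = 1 / (2 * cosh (r - t))"
      by simp
    then show ?thesis unfolding \<theta>_def[abs_def]
      by (auto intro!: derivative_eq_intros simp: field_simps)
  qed
  have rad: "(radius r (\<theta> t))\<^sup>2 = cosh (r + t) / cosh (r - t)" for t
  proof -
    define y where "y = exp (t - r)"
    have y: "0 < 1 + y\<^sup>2" by (intro add_pos_nonneg) auto
    have "(cos (\<theta> t))\<^sup>2 = 1 / (1 + y\<^sup>2)" "(sin (\<theta> t))\<^sup>2 = y\<^sup>2 / (1 + y\<^sup>2)"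
      using y by (simp_all add: \<theta>_def y_def[symmetric] cos_arctan sin_arctan power_divide)
    then have "(radius r (\<theta> t))\<^sup>2 = (exp (- 2 * r) + exp (2 * r) * y\<^sup>2) / (1 + y\<^sup>2)"
      by (simp add: radius_sq add_divide_distrib)
    also have "exp (- 2 * r) + exp (2 * r) * y\<^sup>2 = y * (2 * cosh (r + t))"
    proof -
      have "exp (2 * r) * y\<^sup>2 = y * exp (r + t)" "exp (- 2 * r) = y * exp (- (r + t))"
        by (simp_all add: y_def power2_eq_square flip: exp_add)
      then show ?thesis by (simp add: cosh_field_def algebra_simps)
    qed
    also have "1 + y\<^sup>2 = y * (2 * cosh (r - t))"
    proof -
      have "1 = y * exp (r - t)" "y\<^sup>2 = y * exp (- (r - t))"
        by (simp_all add: y_def power2_eq_square flip: exp_add)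
      then show ?thesis by (simp add: cosh_field_def algebra_simps)
    qed
    also have "y * (2 * cosh (r + t)) / (y * (2 * cosh (r - t))) = cosh (r + t) / cosh (r - t)"
      by (simp add: y_def)
    finally show ?thesis .
  qed
  have dA: "((\<lambda>t. angle r (\<theta> t)) has_real_derivative 1 / (2 * cosh (r + t))) (at t)" for t
  proof -
    have "((\<lambda>t. angle r (\<theta> t)) has_real_derivative 1 / (radius r (\<theta> t))\<^sup>2 * (1 / (2 * cosh (r - t)))) (at t)"
      by (rule DERIV_chain2[OF angle_has_derivative d\<theta>])
    then show ?thesis using cp[of "r - t"] by (simp add: rad mult.commute)
  qed
  have d\<Psi>: "(\<Psi> has_real_derivative (a + of_int m * cosh (r - t) - of_int n * cosh (r + t)) / (2 * (V t)\<^sup>2)) (at t)" for t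
  proof -
    have "((\<lambda>t. ln (cosh (r + t)) - ln (cosh (r - t))) has_real_derivative sinh (r + t) / cosh (r + t) + sinh (r - t) / cosh (r - t)) (at t)"
      using cp by (auto intro!: derivative_eq_intros simp: divide_simps)
    also have "sinh (r + t) / cosh (r + t) + sinh (r - t) / cosh (r - t) = sinh (2 * r) / (V t)\<^sup>2"
      using cp[of "r + t"] cp[of "r - t"] unfolding Vsq sinh_shift_sum[of r t, symmetric]
      by (simp add: add_frac_eq add.commute mult.commute)
    finally have L: "((\<lambda>t. ln (cosh (r + t)) - ln (cosh (r - t))) has_real_derivative sinh (2 * r) / (V t)\<^sup>2) (at t)" .
    have "(\<Psi> has_real_derivative s * (sinh (2 * r) / (V t)\<^sup>2 / 2) + of_int m * (1 / (2 * cosh (r + t))) - of_int n * (1 / (2 * cosh (r - t)))) (at t)"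
      unfolding \<Psi>_def[abs_def] by (intro DERIV_diff DERIV_add DERIV_cmult DERIV_cdivide L dA d\<theta>)
    also have "s * (sinh (2 * r) / (V t)\<^sup>2 / 2) + of_int m * (1 / (2 * cosh (r + t))) - of_int n * (1 / (2 * cosh (r - t)))
      = (a + of_int m * cosh (r - t) - of_int n * cosh (r + t)) / (2 * (V t)\<^sup>2)"
      using cp[of "r + t"] cp[of "r - t"] unfolding Vsq a_def
      by (simp add: divide_simps)
    finally show ?thesis .
  qed
  have sub: "((\<lambda>t. (1 / (2 * cosh (r - t))) *\<^sub>R osc s r n m (\<theta> t)) has_integral integral {\<theta> (-r)..\<theta> r} (osc s r n m)) {-r..r}"
  proof -
    have "\<theta> u \<le> \<theta> v" if "u \<le> v" for u v using that by (simp only: \<theta>_def arctan_le_iff exp_le_cancel_iff diff_right_mono)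
    then show ?thesis
      using r by (intro has_integral_substitution[where c = "\<theta> (-r)" and d = "\<theta> r"] osc_continuous d\<theta>) auto
  qed
  have eq: "(1 / (2 * cosh (r - t))) *\<^sub>R osc s r n m (\<theta> t) = of_real (1 / (2 * V t)) * cis (\<Psi> t)" for t
  proof -
    define R where "R = radius r (\<theta> t)"
    have R: "0 < R" by (simp add: R_def radius_pos)
    have Rs: "R = sqrt (cosh (r + t)) / sqrt (cosh (r - t))"
      using rad[of t] R real_sqrt_unique[of R] by (simp add: R_def flip: real_sqrt_divide)
    have lnR: "ln R = (ln (cosh (r + t)) - ln (cosh (r - t))) / 2"
      unfolding Rs using cp[of "r + t"] cp[of "r - t"] by (simp add: ln_div ln_sqrt diff_divide_distrib)
    have "of_real R powr (\<i> * of_real s - 1) = of_real (1 / R) * cis (s * ln R)"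
    proof -
      have "of_real R powr (\<i> * of_real s - 1) = exp (\<i> * of_real (s * ln R)) / exp (of_real (ln R))"
        using R by (simp add: powr_def Ln_of_real algebra_simps flip: exp_diff)
      also have "exp (of_real (ln R)) = complex_of_real R" using R by (simp add: exp_of_real)
      finally show ?thesis by (simp add: cis_conv_exp)
    qed
    then have o: "osc s r n m (\<theta> t) = of_real (1 / R) * cis (\<Psi> t)"
      by (simp add: osc_def R_def[symmetric] char_fun_def cis_cnj cis_mult \<Psi>_def lnR mult.assoc algebra_simps)
    have "1 / (2 * cosh (r - t)) * (1 / R) = 1 / (2 * V t)"
    proof -
      have "cosh (r - t) = sqrt (cosh (r - t)) * sqrt (cosh (r - t))" using cp[of "r - t"] by simp
      then have "cosh (r - t) * R = V t"
        unfolding Rs Veq real_sqrt_mult using cp[of "r - t"] by (simp add: field_simps)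
      then show ?thesis by (simp add: mult.assoc)
    qed
    then show ?thesis unfolding o by (metis mult.assoc of_real_mult scaleR_conv_of_real)
  qed
  have \<theta>1: "\<theta> (-r) = arctan (exp (- 2 * r))" and \<theta>2: "\<theta> r = pi / 4" by (simp_all add: \<theta>_def)
  have a0: "a \<noteq> 0" using s r by (simp add: a_def)
  have "cmod (integral {-r..r} (\<lambda>t. of_real (1 / (2 * V t)) * cis (\<Psi> t))) \<le> 40 * exp r / \<bar>a\<bar> + 8 * exp (- r)"
    by (rule amp_total[where P = "\<lambda>t. a + of_int m * cosh (r - t) - of_int n * cosh (r + t)"
          and Pd = "\<lambda>t. - of_int m * sinh (r - t) - of_int n * sinh (r + t)", OF _ a0 V_def refl refl d\<Psi>])
      (use r in simp)
  also have "integral {-r..r} (\<lambda>t. of_real (1 / (2 * V t)) * cis (\<Psi> t)) = integral {arctan (exp (- 2 * r))..pi / 4} (osc s r n m)"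
    using sub unfolding eq \<theta>1 \<theta>2 by (rule integral_unique)
  also have "40 * exp r / \<bar>a\<bar> \<le> 160 / \<bar>s\<bar> * exp (- r)"
  proof -
    \<comment> \<open>The hypothesis \<open>1 \<le> r\<close> makes |a| at least |s| e^(2 r) / 4,
      and 40 * 4 = 160.\<close>
    have "exp (2 * r) / 4 \<le> sinh (2 * r)"
    proof -
      have "1 \<le> exp (2 * r)" using r by simp
      have "exp (- (2 * r)) \<le> 1" using r by simp
      moreover have "2 \<le> exp (2 * r)" using exp_ge_add_one_self[of "2 * r"] r by linarith
      ultimately show ?thesis unfolding sinh_field_def by argo
    qed
    then have "\<bar>s\<bar> * (exp (2 * r) / 4) \<le> \<bar>s\<bar> * sinh (2 * r)" by (intro mult_left_mono) auto
    moreover have "\<bar>a\<bar> = \<bar>s\<bar> * sinh (2 * r)" using r by (simp add: a_def abs_mult)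
    ultimately have "\<bar>s\<bar> * (exp (2 * r) / 4) \<le> \<bar>a\<bar>" by simp
    then have "40 * exp r / \<bar>a\<bar> \<le> 40 * exp r / (\<bar>s\<bar> * (exp (2 * r) / 4))"
      using s by (intro divide_left_mono) (auto intro!: mult_pos_pos simp: a0)
    also have "\<dots> = 160 / \<bar>s\<bar> * exp (- r)"
    proof -
      have "exp (2 * r) = exp r * exp r" by (simp flip: exp_add)
      then show ?thesis using s by (simp add: field_simps exp_minus)
    qed
    finally show ?thesis .
  qed
  finally show ?thesis by (simp add: algebra_simps)
qed

text \<open>Off the middle range absolute values are enough: \<open>[0, x0]\<close> has length at
  most e^(-2 r) and radius at least e^(-r) / 2, and on \<open>[\<pi>/4, \<pi>/2]\<close> the radius
  is at least e^r / 2. Each end costs 2 e^(-r), whence 8 + 2 + 2 = 12.\<close>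

lemma osc_quarter:
  assumes r: "1 \<le> r" and s: "s \<noteq> 0"
  shows "cmod (integral {0..pi / 2} (osc s r n m)) \<le> (160 / \<bar>s\<bar> + 12) * exp (- r)"
proof -
  define x0 where "x0 = arctan (exp (- 2 * r))"
  have x0: "0 \<le> x0" "x0 \<le> pi / 4" "x0 \<le> exp (- 2 * r)"
    using r arctan_le_iff[of "exp (- 2 * r)" 1] arctan_le_self[of "exp (- 2 * r)"] by (auto simp: x0_def arctan_one)
  have half: "1 / 2 \<le> cos x" if "x \<in> {0..x0}" for x
    using that x0 pi_gt_zero cos_monotone_0_pi_le[of x "pi / 3"] by (simp add: cos_60)
  have half': "1 / 2 \<le> sin x" if "x \<in> {pi / 4..pi / 2}" for x
    using that pi_gt_zero sin_monotone_2pi_le[of "pi / 6" x] by (simp add: sin_30)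
  have 1: "cmod (integral {0..x0} (osc s r n m)) \<le> 2 * exp (- r)"
  proof -
    have "cmod (integral {0..x0} (osc s r n m)) \<le> (x0 - 0) / (exp (- r) / 2)"
    proof (rule osc_integral_bound)
      fix x assume "x \<in> {0..x0}"
      then have "exp (- r) * (1 / 2) \<le> exp (- r) * \<bar>cos x\<bar>"
        by (intro mult_left_mono order_trans[OF half abs_ge_self]) auto
      then show "exp (- r) / 2 \<le> radius r x" using radius_ge_cos[of r x] by linarith
    qed (use x0 in auto)
    also have "\<dots> \<le> exp (- 2 * r) / (exp (- r) / 2)"
      using x0 by (intro divide_right_mono) auto
    also have "\<dots> = 2 * exp (- r)" by (simp add: field_simps flip: exp_add)
    finally show ?thesis .
  qed
  have 2: "cmod (integral {pi / 4..pi / 2} (osc s r n m)) \<le> 2 * exp (- r)"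
  proof -
    have "cmod (integral {pi / 4..pi / 2} (osc s r n m)) \<le> (pi / 2 - pi / 4) / (exp r / 2)"
    proof (rule osc_integral_bound)
      fix x assume "x \<in> {pi / 4..pi / 2}"
      then have "exp r * (1 / 2) \<le> exp r * \<bar>sin x\<bar>"
        by (intro mult_left_mono order_trans[OF half' abs_ge_self]) auto
      then show "exp r / 2 \<le> radius r x" using radius_ge_sin[of r x] by linarith
    qed auto
    also have "\<dots> \<le> 1 / (exp r / 2)" using pi_less_4 by (intro divide_right_mono) auto
    also have "\<dots> = 2 * exp (- r)" by (simp add: exp_minus field_simps)
    finally show ?thesis .
  qed
  have "integral {0..pi / 2} (osc s r n m) = integral {0..x0} (osc s r n m) + (integral {x0..pi / 4} (osc s r n m) + integral {pi / 4..pi / 2} (osc s r n m))"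
    using x0 pi_gt_zero by (simp add: Henstock_Kurzweil_Integration.integral_combine osc_integrable)
  then have "cmod (integral {0..pi / 2} (osc s r n m)) \<le> cmod (integral {0..x0} (osc s r n m))
    + (cmod (integral {x0..pi / 4} (osc s r n m)) + cmod (integral {pi / 4..pi / 2} (osc s r n m)))"
    by (simp only:) (intro norm_triangle_le add_left_mono norm_triangle_ineq)
  then show ?thesis
    using 1 2 osc_middle[OF r s, of n m] by (simp add: x0_def algebra_simps)
qed

lemma angle_minus: "angle r (- x) = - angle r x" and radius_minus: "radius r (- x) = radius r x"
  by (simp_all add: angle_def radius_def arctan_minus[symmetric] del: arctan_minus)

lemma osc_minus: "osc s r n m (- x) = osc s r (- n) (- m) x"
  by (simp add: osc_def angle_minus radius_minus char_fun_minus_arg)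

text \<open>Translation by \<pi> multiplies the integrand by the sign (-1)^(m - n).\<close>

lemma norm_osc_integral_shift:
  "cmod (integral {a..b} (\<lambda>x. osc s r n m (x + pi))) = cmod (integral {a..b} (osc s r n m))"
proof -
  have "osc s r n m (x + pi) = char_fun (m - n) pi * osc s r n m x" for x
    by (simp add: osc_def angle_plus_pi radius_plus_pi char_fun_add cnj_char_fun char_fun_mult[of m _ "- n", symmetric]
        flip: diff_conv_add_uminus) (simp add: char_fun_mult[symmetric] diff_conv_add_uminus mult_ac del: add_uminus_conv_diff)
  then show ?thesis by (simp add: norm_mult)
qed

text \<open>The other quarters reduce to the first by translation and reflection. Reflection changes
  the signs of \<open>n\<close> and \<open>m\<close>, so the bound is assumed for all frequencies at
  once.\<close>

lemma osc_full:
  assumes q: "\<And>n m. cmod (integral {0..pi / 2} (osc s r n m)) \<le> B"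
  shows "cmod (integral {-pi..pi} (osc s r n m)) \<le> 4 * B"
proof -
  have shift: "integral {u..v} (\<lambda>x. osc s r n m (x + pi)) = integral {u + pi..v + pi} (osc s r n m)" for u v
    using integral_shift[of u pi v "osc s r n m"] by (simp add: o_def osc_continuous)
  have refl: "integral {-v..-u} (osc s r n m) = integral {u..v} (osc s r (- n) (- m))" for u v n m
    using Henstock_Kurzweil_Integration.integral_reflect_real[of v u "osc s r (- n) (- m)"] by (simp add: osc_minus)
  have 1: "cmod (integral {-pi..-(pi / 2)} (osc s r n m)) \<le> B"
  proof -
    have "cmod (integral {-pi..-(pi / 2)} (osc s r n m)) = cmod (integral {0..pi / 2} (osc s r n m))"
      unfolding norm_osc_integral_shift[symmetric, of "-pi"] shift by simp
    then show ?thesis using q by simp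
  qed
  have 2: "cmod (integral {-(pi / 2)..0} (osc s r n m)) \<le> B"
    using refl[of "pi / 2" 0 n m] q by simp
  have 3: "cmod (integral {pi / 2..pi} (osc s r n m)) \<le> B"
  proof -
    have "cmod (integral {pi / 2..pi} (osc s r n m)) = cmod (integral {-(pi / 2)..0} (osc s r n m))"
      unfolding norm_osc_integral_shift[symmetric, of "-(pi / 2)"] shift by simp
    then show ?thesis using 2 by simp
  qed
  have "integral {-pi..pi} (osc s r n m) = integral {-pi..-(pi / 2)} (osc s r n m) + (integral {-(pi / 2)..0} (osc s r n m)
    + (integral {0..pi / 2} (osc s r n m) + integral {pi / 2..pi} (osc s r n m)))"
  proof -
    have "-pi \<le> -(pi / 2)" "-(pi / 2) \<le> pi" "-(pi / 2) \<le> 0" "0 \<le> pi / 2" "pi / 2 \<le> pi" "0 \<le> pi"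
      using pi_gt_zero by linarith+
    then show ?thesis
      by (simp only: Henstock_Kurzweil_Integration.integral_combine osc_integrable)
  qed
  also have "cmod \<dots> \<le> B + (B + (B + B))"
    by (intro norm_triangle_le add_mono 1 2 3 q)
  finally show ?thesis by simp
qed

theorem mcoeff_principal_bound:
  assumes r: "0 < r" and s: "s \<noteq> 0"
  shows "cmod (mcoeff (\<i> * of_real s - 1) r n m) \<le> 160 * ((\<bar>s\<bar> + 1) / \<bar>s\<bar>) * exp (- r)"
proof -
  have m: "mcoeff (\<i> * of_real s - 1) r n m = integral {-pi..pi} (osc s r n m) / (2 * pi)"
    by (simp add: mcoeff_def fcoeff_def l2_ip_def twist_def osc_def[abs_def])
  have "cmod (integral {-pi..pi} (osc s r n m)) \<le> 4 * ((160 / \<bar>s\<bar> + 12) * exp (- r))"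
  proof (cases "1 \<le> r")
    case True
    then show ?thesis by (intro osc_full osc_quarter s)
  next
    case False
    \<comment> \<open>For \<open>r < 1\<close> oscillation is irrelevant: absolute values lose only
      the bounded factor e^(2 r), and 2 \<pi> e^2 < 48 = 4 * 12.\<close>
    have "cmod (integral {-pi..pi} (osc s r n m)) \<le> (pi - (-pi)) / exp (- r)"
      using r by (intro osc_integral_bound radius_ge) auto
    also have "\<dots> = 2 * pi * exp (2 * r) * exp (- r)"
      by (simp add: field_simps flip: exp_add)
    also have "\<dots> \<le> 48 * exp (- r)"
    proof -
      have "exp (2 * r) \<le> exp 2" using False by simp
      also have "exp 2 = exp 1 * exp (1 :: real)" by (simp flip: exp_add)
      also have "\<dots> \<le> 2.72 * 2.72" using e_less_272 by (intro mult_mono) auto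
      finally have "2 * pi * exp (2 * r) \<le> 2 * 3.15 * (2.72 * 2.72)"
        using pi_approx by (intro mult_mono) auto
      then show ?thesis by (intro mult_right_mono) auto
    qed
    also have "\<dots> \<le> 4 * ((160 / \<bar>s\<bar> + 12) * exp (- r))" by (simp add: algebra_simps)
    finally show ?thesis .
  qed
  then have "cmod (mcoeff (\<i> * of_real s - 1) r n m) \<le> 4 * ((160 / \<bar>s\<bar> + 12) * exp (- r)) / (2 * pi)"
    unfolding m norm_divide by (simp only: norm_mult norm_numeral norm_of_real) (rule frac_le; simp)
  also have "\<dots> \<le> 4 * ((160 / \<bar>s\<bar> + 12) * exp (- r)) / 4"
    using pi_ge_two by (intro divide_left_mono) auto
  also have "\<dots> \<le> 160 * ((\<bar>s\<bar> + 1) / \<bar>s\<bar>) * exp (- r)"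
    using s by (simp add: field_simps)
  finally show ?thesis .
qed

section \<open>Analytic continuation of the intertwining operator\<close>

text \<open>Two derivatives are what two integrations by parts consume; they are arguments because
  the resulting formula names \<open>f''\<close>.\<close>

definition C2 :: "(real \<Rightarrow> complex) \<Rightarrow> (real \<Rightarrow> complex) \<Rightarrow> (real \<Rightarrow> complex) \<Rightarrow> bool" where
  "C2 f f' f'' \<longleftrightarrow> (\<forall>x. (f has_vector_derivative f' x) (at x)) \<and>
     (\<forall>x. (f' has_vector_derivative f'' x) (at x)) \<and> continuous_on UNIV f''"

lemma C2_continuous:
  assumes "C2 f f' f''"
  shows "continuous_on S f" "continuous_on S f'" "continuous_on S f''"
  using assms unfolding C2_def
  by (auto intro: continuous_on_subset continuous_at_imp_continuous_on has_vector_derivative_continuous)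

lemma C2_shift: "C2 f f' f'' \<Longrightarrow> C2 (\<lambda>x. f (x + c)) (\<lambda>x. f' (x + c)) (\<lambda>x. f'' (x + c))"
proof -
  assume C: "C2 f f' f''"
  have sh: "((\<lambda>x. g (x + c)) has_vector_derivative g' (x + c)) (at x)"
    if "\<And>x. (g has_vector_derivative g' x) (at x)" for g g' :: "real \<Rightarrow> complex" and x
  proof -
    have "((\<lambda>x. x + c) has_vector_derivative 1) (at x)" by (auto intro!: derivative_eq_intros)
    from vector_diff_chain_at[OF this that] show ?thesis by (simp add: o_def)
  qed
  have "continuous_on UNIV (\<lambda>x. f'' (x + c))"
    by (rule continuous_on_compose2[OF C2_continuous(3)[OF C, of UNIV]]) (auto intro!: continuous_intros)
  then show ?thesis using C sh unfolding C2_def by blast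
qed

lemma C2_periodic:
  assumes C: "C2 f f' f''" and per: "\<And>x. f (x + c) = f x"
  shows "f' (x + c) = f' x" "f'' (x + c) = f'' x"
proof -
  have sh: "C2 f (\<lambda>x. f' (x + c)) (\<lambda>x. f'' (x + c))"
    using C2_shift[OF C, of c] by (simp add: per)
  have 1: "f' (x + c) = f' x" for x
    using sh C unfolding C2_def by (blast intro: vector_derivative_unique_at)
  then have "C2 f f' (\<lambda>x. f'' (x + c))" using sh by simp
  then show "f'' (x + c) = f'' x"
    using C unfolding C2_def by (blast intro: vector_derivative_unique_at)
  show "f' (x + c) = f' x" by (rule 1)
qed

lemma continuous_on_sin_powr:
  assumes "0 < Re p" "S \<subseteq> {0..pi}"
  shows "continuous_on S (\<lambda>u. complex_of_real (sin u) powr p)"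
  using assms by (intro continuous_on_powr_complex continuous_intros) (auto intro!: sin_ge_zero)

lemma sin_powr_has_vector_derivative:
  assumes "u \<in> {0<..<pi}"
  shows "((\<lambda>u. complex_of_real (sin u) powr p) has_vector_derivative p * complex_of_real (sin u) powr (p - 1) * of_real (cos u)) (at u)"
proof -
  have s: "0 < sin u" using assms by (auto intro: sin_gt_zero)
  have 1: "((\<lambda>u. complex_of_real (sin u)) has_vector_derivative of_real (cos u)) (at u)"
    by (intro has_vector_derivative_of_real) (auto intro!: derivative_eq_intros)
  have 2: "((\<lambda>z. z powr p) has_field_derivative p * of_real (sin u) powr (p - 1)) (at (complex_of_real (sin u)))"
    using s by (intro has_field_derivative_powr) auto
  show ?thesis
    using field_vector_diff_chain_at[OF 1 2] by (simp add: o_def mult_ac)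
qed

text \<open>
  Two integrations by parts raise the exponent by 2, which gives the continuation of the integral
  from \<open>Re p > -1\<close> to \<open>Re p > -3\<close>.
\<close>

lemma sin_powr_parts:
  assumes C: "C2 f f' f''" and p: "-1 < Re p"
  shows "((\<lambda>u. f u * of_real (sin u) powr p) has_integral
    integral {0..pi} (\<lambda>u. ((p + 2)\<^sup>2 * f u + f'' u) * of_real (sin u) powr (p + 2)) / ((p + 2) * (p + 1))) {0..pi}"
proof -
  define sp where "sp q u = complex_of_real (sin u) powr q" for q u
  \<comment> \<open>Boundary term of the two integrations by parts. With cos^2 = 1 - sin^2 its
    derivative is the difference of the two integrands below; it vanishes at 0 and \<pi> because
    \<open>Re p + 1 > 0\<close>.\<close>
  define G where "G u = (p + 2) * f u * sp (p + 1) u * of_real (cos u) - f' u * sp (p + 2) u" for u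
  define I where "I = integral {0..pi} (\<lambda>u. ((p + 2)\<^sup>2 * f u + f'' u) * sp (p + 2) u)"
  have p0: "p + 1 \<noteq> 0" "p + 2 \<noteq> 0" using p by (auto simp: complex_eq_iff)
  have cont: "continuous_on {0..pi} (sp q)" if "0 < Re q" for q
    unfolding sp_def using that by (rule continuous_on_sin_powr) simp
  have "((\<lambda>u. (p + 2) * (p + 1) * (f u * sp p u) - ((p + 2)\<^sup>2 * f u + f'' u) * sp (p + 2) u)
      has_integral (G pi - G 0)) {0..pi}"
  \<comment> \<open>The power of the sine may be unbounded at the ends. With \<open>G\<close>
    continuous up to the ends, derivatives in the interior suffice and give integrability along with
    the value.\<close>
  proof (rule fundamental_theorem_of_calculus_interior)
    show "continuous_on {0..pi} G"
      unfolding G_def using p by (intro continuous_intros cont C2_continuous[OF C]) auto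
    fix u assume u: "u \<in> {0<..<pi}"
    then have s: "0 < sin u" by (auto intro: sin_gt_zero)
    have dsp: "(sp q has_vector_derivative q * sp (q - 1) u * of_real (cos u)) (at u)" for q
      unfolding sp_def using u by (rule sin_powr_has_vector_derivative)
    have df: "(f has_vector_derivative f' u) (at u)" and df': "(f' has_vector_derivative f'' u) (at u)"
      using C by (auto simp: C2_def)
    have dcos: "((\<lambda>u. complex_of_real (cos u)) has_vector_derivative - of_real (sin u)) (at u)"
      using has_vector_derivative_of_real[of cos "- sin u" "at u"] by (auto intro!: derivative_eq_intros)
    have e1: "sp (p + 1) u = of_real (sin u) * sp p u" and e2: "sp (p + 2) u = (of_real (sin u))\<^sup>2 * sp p u"
      using s by (simp_all add: sp_def powr_add power2_eq_square)
    have sc: "(of_real (cos u))\<^sup>2 = 1 - (complex_of_real (sin u))\<^sup>2"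
      by (simp add: cos_squared_eq flip: of_real_power)
    have "(G has_vector_derivative
       (((p + 2) * f u * sp (p + 1) u) * (- of_real (sin u)) + (((p + 2) * f u) * ((p + 1) * sp (p + 1 - 1) u * of_real (cos u)) + ((p + 2) * f' u) * sp (p + 1) u) * of_real (cos u))
       - (f' u * ((p + 2) * sp (p + 2 - 1) u * of_real (cos u)) + f'' u * sp (p + 2) u)) (at u)"
      unfolding G_def
      by (intro has_vector_derivative_diff has_vector_derivative_mult dsp df df' dcos has_vector_derivative_mult_right)
    moreover have "p + 1 - 1 = p" "p + 2 - 1 = p + 1" by simp_all
    moreover have "((p + 2) * f u * sp (p + 1) u) * (- of_real (sin u)) + (((p + 2) * f u) * ((p + 1) * sp p u * of_real (cos u)) + ((p + 2) * f' u) * sp (p + 1) u) * of_real (cos u)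
       - (f' u * ((p + 2) * sp (p + 1) u * of_real (cos u)) + f'' u * sp (p + 2) u)
       = (p + 2) * (p + 1) * (f u * sp p u) - ((p + 2)\<^sup>2 * f u + f'' u) * sp (p + 2) u"
      unfolding e1 e2 using sc by algebra
    ultimately show "(G has_vector_derivative (p + 2) * (p + 1) * (f u * sp p u) - ((p + 2)\<^sup>2 * f u + f'' u) * sp (p + 2) u) (at u)"
      by simp
  qed simp
  moreover have "G pi = 0" "G 0 = 0" by (simp_all add: G_def sp_def)
  ultimately have A: "((\<lambda>u. (p + 2) * (p + 1) * (f u * sp p u) - ((p + 2)\<^sup>2 * f u + f'' u) * sp (p + 2) u)
      has_integral 0) {0..pi}" by simp
  have "continuous_on {0..pi} (\<lambda>u. ((p + 2)\<^sup>2 * f u + f'' u) * sp (p + 2) u)"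
    using p by (intro continuous_intros cont C2_continuous[OF C]) auto
  then have B: "((\<lambda>u. ((p + 2)\<^sup>2 * f u + f'' u) * sp (p + 2) u) has_integral I) {0..pi}"
    unfolding I_def by (intro integrable_integral integrable_continuous_interval)
  have "((\<lambda>u. (p + 2) * (p + 1) * (f u * sp p u)) has_integral I) {0..pi}"
    using has_integral_add[OF A B] by simp
  from has_integral_mult_right[OF this, of "1 / ((p + 2) * (p + 1))"]
  have "((\<lambda>u. 1 / ((p + 2) * (p + 1)) * ((p + 2) * (p + 1) * (f u * sp p u))) has_integral (1 / ((p + 2) * (p + 1)) * I)) {0..pi}" .
  then show ?thesis using p0 by (simp add: I_def sp_def)
qed

section \<open>The kernel on the circle and the regularised integral\<close>

lemma has_integral_translate:
  fixes f :: "real \<Rightarrow> 'a::real_normed_vector"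
  assumes "(f has_integral i) {a..b}"
  shows "((\<lambda>x. f (x + c)) has_integral i) {a - c..b - c}"
  using has_integral_affinity'[of f i a b 1 c] assms by simp

lemma has_integral_periodic:
  fixes f :: "real \<Rightarrow> 'a::banach"
  assumes T: "0 < T" and per: "\<And>x. f (x + T) = f x" and f: "(f has_integral i) {a..a + T}"
  shows "(f has_integral i) {b..b + T}"
proof -
  have perk: "f (x + of_int k * T) = f x" for x and k :: int
  proof (induction k rule: int_induct[where k = 0])
    case (step1 i)
    then show ?case using per[of "x + of_int i * T"] by (simp add: algebra_simps)
  next
    case (step2 i)
    then show ?case using per[of "x + of_int (i - 1) * T"] by (simp add: algebra_simps)
  qed simp
  have tr: "(f has_integral j) {u + of_int k * T..v + of_int k * T}" if "(f has_integral j) {u..v}" for j u v and k :: int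
    using has_integral_translate[OF that, of "of_int (- k) * T"] perk[of _ "- k"] by simp
  define k where "k = \<lfloor>(b - a) / T\<rfloor>"
  define c where "c = b - of_int k * T"
  have c: "a \<le> c" "c \<le> a + T"
  proof -
    have "of_int k * T \<le> b - a" "b - a < (of_int k + 1) * T"
      unfolding k_def using T by (intro floor_divide_lower floor_divide_upper; simp)+
    then show "a \<le> c" "c \<le> a + T" by (auto simp: c_def algebra_simps)
  qed
  have int: "f integrable_on {a..a + T}" using f by blast
  have "f integrable_on {a..c}" "f integrable_on {c..a + T}"
    using c by (auto intro: integrable_subinterval_real[OF int])
  then obtain i1 i2 where i: "(f has_integral i1) {a..c}" "(f has_integral i2) {c..a + T}" by blast
  have "i1 + i2 = i"
    using has_integral_combine[OF c i] f by (rule has_integral_unique)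
  moreover have "(f has_integral i1) {a + T..c + T}" using tr[OF i(1), of 1] by simp
  then have "(f has_integral (i2 + i1)) {c..c + T}"
    using c i(2) by (intro has_integral_combine[of c "a + T"]) auto
  ultimately show ?thesis
    using tr[of "i2 + i1" c "c + T" k] by (simp add: c_def add.commute)
qed

text \<open>Both \<open>f\<close> and |sin| have period \<pi>, so the circle amounts to twice the
  period that starts at the singularity \<phi>, where the sine is nonnegative and the absolute value
  drops out.\<close>

lemma circle_kernel_has_integral:
  fixes f :: "real \<Rightarrow> complex"
  assumes per: "\<And>x. f (x + pi) = f x"
    and I: "((\<lambda>u. f (u + \<phi>) * of_real (sin u) powr p) has_integral I) {0..pi}"
  shows "((\<lambda>\<theta>. f \<theta> * of_real \<bar>sin (\<theta> - \<phi>)\<bar> powr p) has_integral (2 * I)) {-pi..pi}"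
proof -
  define F where "F \<theta> = f \<theta> * of_real \<bar>sin (\<theta> - \<phi>)\<bar> powr p" for \<theta>
  have "sin (x + pi - \<phi>) = - sin (x - \<phi>)" for x
    by (simp add: sin_diff sin_add cos_add)
  then have F: "F (x + pi) = F x" for x by (simp add: F_def per)
  have "((\<lambda>u. F (u + \<phi>)) has_integral I) {0..pi}"
    by (rule has_integral_eq[OF _ I]) (simp add: F_def sin_ge_zero)
  from has_integral_translate[OF this, of "- \<phi>"] have "(F has_integral I) {\<phi>..\<phi> + pi}" by (simp add: add.commute)
  then have J: "(F has_integral I) {b..b + pi}" for b
    by (rule has_integral_periodic[where a = \<phi> and T = pi and f = F, OF pi_gt_zero F])
  have 1: "(F has_integral I) {-pi..0}" using J[of "-pi"] unfolding add.left_inverse .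
  have 2: "(F has_integral I) {0..pi}" using J[of 0] unfolding add_0_left .
  have "(F has_integral (I + I)) {-pi..pi}"
    by (rule has_integral_combine[OF _ _ 1 2]) simp_all
  then show ?thesis unfolding F_def mult_2 .
qed

text \<open>Integration by parts yields a gauge integral, while \<open>J_integral\<close> is a
  Lebesgue integral. The same formula for the constant function and the real exponent
  \<open>Re p\<close> supplies an integrable majorant.\<close>

lemma circle_kernel_set_integrable:
  assumes f: "continuous_on UNIV f" and per: "\<And>x. f (x + pi) = f x" and C: "C2 f f' f''" and p: "-1 < Re p"
  shows "set_integrable lborel {-pi..pi} (\<lambda>\<theta>. f \<theta> * complex_of_real \<bar>sin (\<theta> - \<phi>)\<bar> powr p)"
proof -
  have one: "C2 (\<lambda>x. 1) (\<lambda>x. 0) (\<lambda>x. 0)" by (simp add: C2_def)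
  have "(\<lambda>\<theta>. f \<theta> * complex_of_real \<bar>sin (\<theta> - \<phi>)\<bar> powr p) integrable_on {-pi..pi}"
    using circle_kernel_has_integral[OF per sin_powr_parts[OF C2_shift[OF C] p]] by blast
  moreover have "(\<lambda>\<theta>. \<bar>sin (\<theta> - \<phi>)\<bar> powr Re p) integrable_on {-pi..pi}"
  proof -
    have "-1 < Re (complex_of_real (Re p))" using p by simp
    from circle_kernel_has_integral[OF _ sin_powr_parts[OF C2_shift[OF one] this], of \<phi>]
    have "(\<lambda>\<theta>. complex_of_real \<bar>sin (\<theta> - \<phi>)\<bar> powr of_real (Re p)) integrable_on {-pi..pi}" by auto
    from integrable_linear[OF this bounded_linear_Re] show ?thesis
      by (simp add: o_def powr_of_real)
  qed
  moreover obtain B where B: "\<And>x. x \<in> {-pi..pi} \<Longrightarrow> cmod (f x) \<le> B"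
  proof -
    have "bounded (f ` {-pi..pi})"
      using f by (intro compact_imp_bounded compact_continuous_image) (auto intro: continuous_on_subset)
    then show ?thesis using that unfolding bounded_iff by blast
  qed
  moreover have "cmod (complex_of_real \<bar>sin (\<theta> - \<phi>)\<bar> powr p) \<le> \<bar>sin (\<theta> - \<phi>)\<bar> powr Re p" for \<theta>
    by (cases "sin (\<theta> - \<phi>) = 0") (auto simp: norm_powr_real_powr)
  ultimately have "(\<lambda>\<theta>. f \<theta> * complex_of_real \<bar>sin (\<theta> - \<phi>)\<bar> powr p) absolutely_integrable_on {-pi..pi}"
    by (intro absolutely_integrable_integrable_bound[where g = "\<lambda>\<theta>. B * \<bar>sin (\<theta> - \<phi>)\<bar> powr Re p"] integrable_on_mult_right)
      (auto simp: norm_mult intro!: mult_mono order_trans[OF norm_ge_zero B])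
  moreover have "(\<lambda>\<theta>. indicator {-pi..pi} \<theta> *\<^sub>R (f \<theta> * complex_of_real \<bar>sin (\<theta> - \<phi>)\<bar> powr p)) \<in> borel_measurable lborel"
  proof -
    have [measurable]: "f \<in> borel_measurable borel" using f by (rule borel_measurable_continuous_onI)
    show ?thesis unfolding powr_def by measurable
  qed
  ultimately show ?thesis
    unfolding set_integrable_def using integrable_completion by blast
qed

text \<open>
  The poles of \<open>1 / ((p + 2) (p + 1))\<close> at \<open>p = -1 - 2 z\<close> and of \<open>\<Gamma>(-z)\<close> cancel at \<open>z = 0\<close>:
  \<open>\<Gamma>(1 - z) = -z \<Gamma>(-z)\<close>.
\<close>

definition J_const :: "complex \<Rightarrow> complex" where
  "J_const z = Gamma (1 / 2 + z) * 2 powr (2 * z) * rGamma (1 - z) / (2 * of_real (sqrt pi) * (1 - 2 * z))"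

text \<open>What the integrations by parts leave for \<open>p = - 1 - 2 z\<close>. The exponent
  \<open>1 - 2 z\<close> has positive real part in the whole strip |Re z| < 1/2.\<close>

definition J_reg :: "complex \<Rightarrow> (real \<Rightarrow> complex) \<Rightarrow> (real \<Rightarrow> complex) \<Rightarrow> real \<Rightarrow> complex" where
  "J_reg z f f'' \<phi> = integral {0..pi} (\<lambda>u. ((1 - 2 * z)\<^sup>2 * f (u + \<phi>) + f'' (u + \<phi>)) * of_real (sin u) powr (1 - 2 * z))"

lemma J_integral_eq_reg:
  assumes C: "C2 F F' F''" and per: "\<And>x. F (x + pi) = F x" and f: "\<And>\<theta>. f (circ \<theta>) = F \<theta>"
    and z: "-1/2 < Re z" "Re z < 0"
  shows "J_integral z f \<phi> = J_const z * J_reg z F F'' \<phi>"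
proof -
  define p where "p = - 1 - 2 * z"
  have p: "-1 < Re p" using z by (simp add: p_def)
  have p12: "p + 2 = 1 - 2 * z" "p + 1 = - 2 * z" by (simp_all add: p_def)
  have "J_integral z f \<phi> = 1 / (2 * c_fun z) * (LINT \<theta>:{-pi..pi}|lborel. F \<theta> * of_real \<bar>sin (\<theta> - \<phi>)\<bar> powr p)"
    by (simp add: J_integral_def f p_def)
  also have "(LINT \<theta>:{-pi..pi}|lborel. F \<theta> * of_real \<bar>sin (\<theta> - \<phi>)\<bar> powr p)
      = integral {-pi..pi} (\<lambda>\<theta>. F \<theta> * of_real \<bar>sin (\<theta> - \<phi>)\<bar> powr p)"
    by (intro set_borel_integral_eq_integral circle_kernel_set_integrable[OF C2_continuous(1)[OF C] per C p])
  also have "\<dots> = 2 * (J_reg z F F'' \<phi> / ((1 - 2 * z) * (- 2 * z)))"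
    using circle_kernel_has_integral[OF per sin_powr_parts[OF C2_shift[OF C] p]]
    unfolding p12 J_reg_def by (rule integral_unique)
  also have "1 / (2 * c_fun z) * (2 * (J_reg z F F'' \<phi> / ((1 - 2 * z) * (- 2 * z)))) = J_const z * J_reg z F F'' \<phi>"
  proof -
    have ni: "- z \<notin> \<int>\<^sub>\<le>\<^sub>0" "1 - z \<notin> \<int>\<^sub>\<le>\<^sub>0" "1 / 2 + z \<notin> \<int>\<^sub>\<le>\<^sub>0"
      using z by (auto elim!: nonpos_Ints_cases simp: complex_eq_iff)
    have z0: "z \<noteq> 0" "1 - 2 * z \<noteq> 0" using z by (auto simp: complex_eq_iff)
    have G: "Gamma (1 - z) = - z * Gamma (- z)"
      using Gamma_plus1[OF ni(1)] by (simp add: algebra_simps)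
    have rG: "rGamma (1 - z) = 1 / (- z * Gamma (- z))"
      unfolding rGamma_inverse_Gamma G by (simp add: inverse_eq_divide)
    have nz: "Gamma (- z) \<noteq> 0" "Gamma (1 / 2 + z) \<noteq> 0" using ni by (simp_all add: Gamma_eq_zero_iff)
    have "(2::complex) powr (- 2 * z) = 1 / 2 powr (2 * z)" by (simp add: powr_minus_divide)
    then have "c_fun z = of_real (sqrt pi) * Gamma (- z) / (2 powr (2 * z) * Gamma (1 / 2 + z))"
      by (simp add: c_fun_def)
    moreover have "1 / (2 * (a * G / (E * H))) * (2 * (J / (w * (- 2 * z)))) = H * E * (1 / (- z * G)) / (2 * a * w) * J"
      if "a \<noteq> 0" "G \<noteq> 0" "E \<noteq> 0" "H \<noteq> 0" "w \<noteq> 0" for a G E H J w :: complex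
      using that z0(1) by (simp add: field_simps)
    ultimately show ?thesis
      using z0 nz by (simp only: J_const_def rG) simp
  qed
  finally show ?thesis .
qed

section \<open>Holomorphy in the strip |Re z| < 1/2\<close>

lemma strip_convex: "convex {z. \<bar>Re z\<bar> < 1 / 2}" and strip_open: "open {z. \<bar>Re z\<bar> < 1 / 2}"
proof -
  have "{z. \<bar>Re z\<bar> < 1 / 2} = {z. Re z < 1 / 2} \<inter> {z. Re z > - 1 / 2}" by auto
  then show "convex {z. \<bar>Re z\<bar> < 1 / 2}"
    by (simp only: convex_Int convex_halfspace_Re_lt convex_halfspace_Re_gt)
  show "open {z. \<bar>Re z\<bar> < 1 / 2}" by (intro open_Collect_less continuous_intros)
qed

lemma norm_sin_powr_le:
  assumes "u \<in> {0..pi}" "0 < Re w"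
  shows "cmod (of_real (sin u) powr w) \<le> 1"
proof (cases "sin u = 0")
  case False
  then have "0 < sin u" using assms sin_ge_zero[of u] by simp
  then show ?thesis using assms by (simp add: norm_powr_real_powr powr_le1)
qed simp

text \<open>Near 0 and \<pi> the logarithm of the sine is unbounded, so differentiation under the
  integral is done on \<open>[e n, \<pi> - e n]\<close>. In the strip the integrand is bounded by
  \<open>B\<close>, so the discarded ends contribute at most \<open>2 * B * e n\<close> and the
  limit is uniform.\<close>

lemma sin_powr_integral_holomorphic:
  assumes g: "continuous_on {0..pi} g"
  shows "(\<lambda>z. integral {0..pi} (\<lambda>u. g u * of_real (sin u) powr (1 - 2 * z))) holomorphic_on {z. \<bar>Re z\<bar> < 1 / 2}"
    (is "?A holomorphic_on ?S")
proof -
  define h where "h z u = g u * complex_of_real (sin u) powr (1 - 2 * z)" for z u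
  define e where "e n = 1 / (real n + 1)" for n
  have e: "0 < e n" "e n \<le> 1" for n by (simp_all add: e_def)
  have pi2: "2 < pi" using pi_gt3 by simp
  note S = strip_convex and op = strip_open
  obtain B where B: "\<And>u. u \<in> {0..pi} \<Longrightarrow> cmod (g u) \<le> B"
    using compact_imp_bounded[OF compact_continuous_image[OF g compact_Icc]] unfolding bounded_iff by blast
  have B0: "0 \<le> B" using order_trans[OF norm_ge_zero B[of 0]] by simp
  have hol: "(\<lambda>z. integral (cbox (e n) (pi - e n)) (h z)) holomorphic_on ?S" for n
  proof (rule leibniz_rule_holomorphic[where fx = "\<lambda>z u. g u * (- 2 * of_real (ln (sin u)) * exp ((1 - 2 * z) * of_real (ln (sin u))))"])
    have sp: "0 < sin u" if "u \<in> cbox (e n) (pi - e n)" for u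
      using that e(1)[of n] by (intro sin_gt_zero) auto
    have heq: "h z u = g u * exp ((1 - 2 * z) * of_real (ln (sin u)))" if "u \<in> cbox (e n) (pi - e n)" for z u
      using sp[OF that] by (simp add: h_def powr_def Ln_of_real)
    have gc: "continuous_on (cbox (e n) (pi - e n)) g"
      by (rule continuous_on_subset[OF g]) (use e(1)[of n] in auto)
    have lnc: "continuous_on (cbox (e n) (pi - e n)) (\<lambda>u. ln (sin u))"
      by (intro continuous_on_ln continuous_intros ballI less_imp_neq[OF sp, symmetric])
    show "((\<lambda>z. h z u) has_field_derivative g u * (- 2 * of_real (ln (sin u)) * exp ((1 - 2 * z) * of_real (ln (sin u))))) (at z within ?S)"
      if "u \<in> cbox (e n) (pi - e n)" for z u
      unfolding heq[OF that] by (auto intro!: derivative_eq_intros)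
    show "h z integrable_on cbox (e n) (pi - e n)" for z
    proof -
      have "(\<lambda>u. g u * exp ((1 - 2 * z) * of_real (ln (sin u)))) integrable_on cbox (e n) (pi - e n)"
        by (intro integrable_continuous continuous_on_mult gc continuous_on_exp continuous_on_const continuous_on_of_real lnc)
      then show ?thesis by (rule integrable_eq) (rule heq[symmetric])
    qed
    show "continuous_on (?S \<times> cbox (e n) (pi - e n)) (\<lambda>(z, u). g u * (- 2 * of_real (ln (sin u)) * exp ((1 - 2 * z) * of_real (ln (sin u)))))"
      unfolding case_prod_unfold
      by (intro continuous_on_mult continuous_on_exp continuous_on_const continuous_on_of_real continuous_on_diff
          continuous_on_fst continuous_on_id continuous_on_compose2[OF gc continuous_on_snd[OF continuous_on_id]]
          continuous_on_compose2[OF lnc continuous_on_snd[OF continuous_on_id]]) auto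
  qed (fact S)
  have close: "cmod (integral (cbox (e n) (pi - e n)) (h z) - ?A z) \<le> 2 * B * e n" if z: "z \<in> ?S" for n z
  proof -
    have w: "0 < Re (1 - 2 * z)" using z by auto
    have hi: "h z integrable_on {a..b}" if "{a..b} \<subseteq> {0..pi}" for a b
    proof -
      have "continuous_on {a..b} (h z)"
        unfolding h_def[abs_def] by (intro continuous_intros continuous_on_subset[OF g that] continuous_on_sin_powr w that)
      then show ?thesis by (rule integrable_continuous_interval)
    qed
    have bnd: "cmod (integral {a..b} (h z)) \<le> B * (b - a)" if "a \<le> b" "{a..b} \<subseteq> {0..pi}" for a b
    proof -
      have "cmod (integral {a..b} (h z)) \<le> integral {a..b} (\<lambda>u. B)"
      proof (rule integral_norm_bound_integral[OF hi[OF that(2)]])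
        fix u assume "u \<in> {a..b}"
        then have u: "u \<in> {0..pi}" using that by auto
        have "cmod (h z u) \<le> B * 1"
          unfolding h_def norm_mult by (intro mult_mono B norm_sin_powr_le u w B0 norm_ge_zero)
        then show "cmod (h z u) \<le> B" by simp
      qed (rule integrable_const_ivl)
      then show ?thesis using that(1) by (simp add: mult.commute)
    qed
    have en: "0 \<le> e n" "e n \<le> pi - e n" "pi - e n \<le> pi" using e[of n] pi2 by auto
    have "?A z = integral {0..pi} (h z)" by (simp add: h_def[abs_def])
    also have "\<dots> = integral {0..e n} (h z) + (integral {e n..pi - e n} (h z) + integral {pi - e n..pi} (h z))"
    proof -
      have "integral {e n..pi - e n} (h z) + integral {pi - e n..pi} (h z) = integral {e n..pi} (h z)"
        using en by (intro Henstock_Kurzweil_Integration.integral_combine hi) auto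
      moreover have "integral {0..e n} (h z) + integral {e n..pi} (h z) = integral {0..pi} (h z)"
        using en by (intro Henstock_Kurzweil_Integration.integral_combine hi) auto
      ultimately show ?thesis by simp
    qed
    finally have "integral (cbox (e n) (pi - e n)) (h z) - ?A z = - (integral {0..e n} (h z) + integral {pi - e n..pi} (h z))"
      by simp
    then have "cmod (integral (cbox (e n) (pi - e n)) (h z) - ?A z) \<le> cmod (integral {0..e n} (h z)) + cmod (integral {pi - e n..pi} (h z))"
      by (simp only: norm_minus_cancel norm_triangle_ineq)
    also have "\<dots> \<le> B * (e n - 0) + B * (pi - (pi - e n))"
      using en by (intro add_mono bnd) auto
    finally show ?thesis by simp
  qed
  have e0: "(\<lambda>n. 2 * B * e n) \<longlonglongrightarrow> 0"
  proof -
    have "(\<lambda>n. e n) \<longlonglongrightarrow> 0" unfolding e_def using LIMSEQ_inverse_real_of_nat by (simp add: inverse_eq_divide add.commute)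
    then show ?thesis by (rule tendsto_mult_right_zero)
  qed
  have ul: "uniform_limit ?S (\<lambda>n z. integral (cbox (e n) (pi - e n)) (h z)) ?A sequentially"
  proof (rule uniform_limitI)
    fix d :: real assume "0 < d"
    then have "\<forall>\<^sub>F n in sequentially. 2 * B * e n < d" by (rule order_tendstoD(2)[OF e0])
    then show "\<forall>\<^sub>F n in sequentially. \<forall>z\<in>?S. dist (integral (cbox (e n) (pi - e n)) (h z)) (?A z) < d"
    proof eventually_elim
      case (elim n)
      show ?case
      proof
        fix z assume "z \<in> ?S"
        from le_less_trans[OF close[OF this] elim]
        show "dist (integral (cbox (e n) (pi - e n)) (h z)) (?A z) < d" by (simp only: dist_norm)
      qed
    qed
  qed
  show ?thesis
  proof (rule holomorphic_uniform_sequence[OF op hol])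
    fix z assume "z \<in> ?S"
    then obtain d where d: "0 < d" "cball z d \<subseteq> ?S" using op[unfolded open_contains_cball] by blast
    then show "\<exists>d>0. cball z d \<subseteq> ?S \<and> uniform_limit (cball z d) (\<lambda>n z. integral (cbox (e n) (pi - e n)) (h z)) ?A sequentially"
      using uniform_limit_on_subset[OF ul] by blast
  qed
qed

lemma J_reg_holomorphic:
  assumes C: "C2 F F' F''"
  shows "(\<lambda>z. J_reg z F F'' \<phi>) holomorphic_on {z. \<bar>Re z\<bar> < 1 / 2}"
proof -
  have C': "C2 (\<lambda>u. F (u + \<phi>)) (\<lambda>u. F' (u + \<phi>)) (\<lambda>u. F'' (u + \<phi>))" by (rule C2_shift[OF C])
  have eq: "J_reg z F F'' \<phi> = (1 - 2 * z)\<^sup>2 * integral {0..pi} (\<lambda>u. F (u + \<phi>) * of_real (sin u) powr (1 - 2 * z))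
     + integral {0..pi} (\<lambda>u. F'' (u + \<phi>) * of_real (sin u) powr (1 - 2 * z))" if "\<bar>Re z\<bar> < 1 / 2" for z
  proof -
    have w: "0 < Re (1 - 2 * z)" using that by auto
    have "(\<lambda>u. g u * of_real (sin u) powr (1 - 2 * z)) integrable_on {0..pi}" if "continuous_on {0..pi} g" for g :: "real \<Rightarrow> complex"
      by (intro integrable_continuous_interval continuous_intros that continuous_on_sin_powr w order_refl)
    then have i: "(\<lambda>u. F (u + \<phi>) * of_real (sin u) powr (1 - 2 * z)) integrable_on {0..pi}"
      "(\<lambda>u. F'' (u + \<phi>) * of_real (sin u) powr (1 - 2 * z)) integrable_on {0..pi}"
      using C2_continuous[OF C'] by auto
    have "J_reg z F F'' \<phi> = integral {0..pi} (\<lambda>u. (1 - 2 * z)\<^sup>2 * (F (u + \<phi>) * of_real (sin u) powr (1 - 2 * z)) + F'' (u + \<phi>) * of_real (sin u) powr (1 - 2 * z))"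
      by (simp add: J_reg_def algebra_simps)
    also have "\<dots> = integral {0..pi} (\<lambda>u. (1 - 2 * z)\<^sup>2 * (F (u + \<phi>) * of_real (sin u) powr (1 - 2 * z))) + integral {0..pi} (\<lambda>u. F'' (u + \<phi>) * of_real (sin u) powr (1 - 2 * z))"
      by (rule integral_add[OF integrable_on_mult_right[OF i(1)] i(2)])
    finally show ?thesis by simp
  qed
  have hol: "(\<lambda>z. (1 - 2 * z)\<^sup>2 * integral {0..pi} (\<lambda>u. F (u + \<phi>) * of_real (sin u) powr (1 - 2 * z))
     + integral {0..pi} (\<lambda>u. F'' (u + \<phi>) * of_real (sin u) powr (1 - 2 * z))) holomorphic_on {z. \<bar>Re z\<bar> < 1 / 2}"
    by (intro holomorphic_intros sin_powr_integral_holomorphic C2_continuous[OF C'])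
  show ?thesis by (rule holomorphic_transform[OF hol]) (simp add: eq)
qed

lemma J_const_holomorphic: "J_const holomorphic_on {z. \<bar>Re z\<bar> < 1 / 2}"
  unfolding J_const_def[abs_def]
  by (intro holomorphic_intros) (auto elim!: nonpos_Ints_cases simp: complex_eq_iff)

text \<open>For \<open>l > 0\<close> the definite description is resolved by the identity theorem:
  the regularised formula is one continuation, and any other agrees with it on the connected strip
  because both equal \<open>J_integral\<close> on the open left half.\<close>

lemma J_circle_eq_reg:
  assumes C: "C2 F F' F''" and per: "\<And>x. F (x + pi) = F x" and f: "\<And>\<theta>. f (circ \<theta>) = F \<theta>"
    and l: "-1/2 < l" "l < 1/2" "l \<noteq> 0"
  shows "J_circle l f \<phi> = J_const (of_real l) * J_reg (of_real l) F F'' \<phi>"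
proof (cases "l < 0")
  case True
  then show ?thesis using J_integral_eq_reg[OF C per f, of "of_real l" \<phi>] l by (simp add: J_circle_def)
next
  case False
  let ?S = "{z. \<bar>Re z\<bar> < 1 / 2}" and ?h = "\<lambda>z. J_const z * J_reg z F F'' \<phi>"
  have hol: "?h holomorphic_on ?S" by (intro holomorphic_intros J_const_holomorphic J_reg_holomorphic[OF C])
  have eq: "?h z = J_integral z f \<phi>" if "-1/2 < Re z" "Re z < 0" for z
    using J_integral_eq_reg[OF C per f that] by simp
  have S: "open ?S" "connected ?S" by (rule strip_open, rule convex_connected[OF strip_convex])
  have "(THE w. \<exists>h. h holomorphic_on ?S \<and> (\<forall>z. - 1 / 2 < Re z \<and> Re z < 0 \<longrightarrow> h z = J_integral z f \<phi>) \<and> w = h (of_real l)) = ?h (of_real l)"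
  proof (rule the_equality)
    show "\<exists>h. h holomorphic_on ?S \<and> (\<forall>z. - 1 / 2 < Re z \<and> Re z < 0 \<longrightarrow> h z = J_integral z f \<phi>) \<and> ?h (of_real l) = h (of_real l)"
      using hol eq by (intro exI[of _ ?h]) auto
    fix w assume "\<exists>h. h holomorphic_on ?S \<and> (\<forall>z. - 1 / 2 < Re z \<and> Re z < 0 \<longrightarrow> h z = J_integral z f \<phi>) \<and> w = h (of_real l)"
    then obtain h where h: "h holomorphic_on ?S" "\<And>z. - 1 / 2 < Re z \<Longrightarrow> Re z < 0 \<Longrightarrow> h z = J_integral z f \<phi>" "w = h (of_real l)"
      by blast
    have "h (of_real l) = ?h (of_real l)"
    proof (rule analytic_continuation_open[where s = "{z. - 1 / 2 < Re z} \<inter> {z. Re z < 0}" and s' = ?S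
          and f = h and g = ?h and z = "of_real l"])
      show "open ({z. - 1 / 2 < Re z} \<inter> {z. Re z < 0})"
        by (intro open_Int open_Collect_less continuous_intros)
      have "of_real (-1/4) \<in> {z. - 1 / 2 < Re z} \<inter> {z. Re z < 0}" by simp
      then show "{z. - 1 / 2 < Re z} \<inter> {z. Re z < 0} \<noteq> {}" by blast
      show "of_real l \<in> ?S" using l by auto
    qed (use S hol h eq in auto)
    then show "w = ?h (of_real l)" using h by simp
  qed
  then show ?thesis using False by (simp add: J_circle_def)
qed

section \<open>Spectrum of the intertwining operator\<close>

text \<open>Circle model of the even functions, \<epsilon> = 0, with two derivatives: enough for the
  regularised formula, and preserved by twists and shifts.\<close>

definition C2pi :: "(real \<Rightarrow> complex) set" where
  "C2pi = {f. (\<exists>f' f''. C2 f f' f'') \<and> (\<forall>x. f (x + pi) = f x)}"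

definition second_deriv :: "(real \<Rightarrow> complex) \<Rightarrow> real \<Rightarrow> complex" where
  "second_deriv f x = vector_derivative (\<lambda>y. vector_derivative f (at y)) (at x)"

text \<open>The intertwining operator on circle functions, by one formula for both signs of
  \<open>l\<close>; \<open>second_deriv\<close> makes it depend on \<open>f\<close> alone.\<close>

definition J_real :: "real \<Rightarrow> (real \<Rightarrow> complex) \<Rightarrow> real \<Rightarrow> complex" where
  "J_real l f \<phi> = J_const (of_real l) * J_reg (of_real l) f (second_deriv f) \<phi>"

lemma second_deriv_eq: "C2 f f' f'' \<Longrightarrow> second_deriv f = f''"
proof -
  assume C: "C2 f f' f''"
  then have "vector_derivative f (at y) = f' y" for y by (auto simp: C2_def intro: vector_derivative_at)
  then show ?thesis using C by (intro ext) (auto simp: second_deriv_def C2_def intro!: vector_derivative_at)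
qed

lemma C2pi_periodic: "f \<in> C2pi \<Longrightarrow> f (x + pi) = f x"
  by (simp add: C2pi_def)

lemma C2pi_E:
  assumes "f \<in> C2pi"
  obtains f' where "C2 f f' (second_deriv f)" "\<And>x. second_deriv f (x + pi) = second_deriv f x"
proof -
  obtain f' f'' where C: "C2 f f' f''" using assms by (auto simp: C2pi_def)
  with second_deriv_eq[OF C] C2_periodic(2)[OF C C2pi_periodic[OF assms]] that show thesis by metis
qed

lemma pi_periodic_cper:
  assumes "continuous_on UNIV f" "\<And>x. f (x + pi) = f x"
  shows "f \<in> cper"
proof -
  have "f (x + 2 * pi) = f x" for x
    using assms(2)[of "x + pi"] assms(2)[of x] by (simp add: add.assoc)
  then show ?thesis using assms(1) by (simp add: cper_def)
qed

lemma C2pi_cper: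
  assumes "f \<in> C2pi"
  shows "f \<in> cper"
proof -
  obtain f' where "C2 f f' (second_deriv f)" using C2pi_E[OF assms] by blast
  then show ?thesis by (rule pi_periodic_cper[where f = f, OF C2_continuous(1) C2pi_periodic[OF assms]])
qed

lemma second_deriv_cper: "f \<in> C2pi \<Longrightarrow> second_deriv f \<in> cper"
  by (erule C2pi_E) (rule pi_periodic_cper[where f = "second_deriv f", OF C2_continuous(3)])

lemma char_fun_pi: "char_fun n pi = (if even n then 1 else -1)"
  by (simp add: char_fun_def cis_conv_exp complex_eq_iff Re_exp Im_exp cos_int_times_real sin_int_times_real mult.commute)

text \<open>Translation by \<pi> preserves \<open>f\<close> and changes the sign of an odd
  character.\<close>

lemma fcoeff_odd:
  assumes f: "f \<in> cper" and per: "\<And>x. f (x + pi) = f x" and n: "odd n"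
  shows "fcoeff f n = 0"
proof -
  have "integral {-pi..pi} (\<lambda>x. f x * cnj (char_fun n x)) = integral {-pi..pi} (\<lambda>x. f (x + pi) * cnj (char_fun n (x + pi)))"
    using integral_periodic_shift[of "\<lambda>x. f x * cnj (char_fun n x)" pi]
    by (simp add: cper_mult cper_cnj char_fun_cper f)
  also have "\<dots> = integral {-pi..pi} (\<lambda>x. - (f x * cnj (char_fun n x)))"
    using n by (simp add: per char_fun_add char_fun_pi)
  also have "\<dots> = - integral {-pi..pi} (\<lambda>x. f x * cnj (char_fun n x))" by simp
  finally show ?thesis by (simp add: fcoeff_def l2_ip_def)
qed

lemma char_fun_has_vector_derivative:
  "(char_fun n has_vector_derivative \<i> * of_int n * char_fun n x) (at x)"
proof -
  have 1: "((\<lambda>x. real_of_int n * x) has_vector_derivative of_int n) (at x)"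
    unfolding has_real_derivative_iff_has_vector_derivative[symmetric] by (auto intro!: derivative_eq_intros)
  have 2: "(cis has_vector_derivative \<i> * cis (of_int n * x)) (at (of_int n * x))"
    unfolding cis_conv_exp[abs_def] by (auto intro!: derivative_eq_intros has_vector_derivative_real_field)
  have "((\<lambda>x. cis (of_int n * x)) has_vector_derivative real_of_int n *\<^sub>R (\<i> * cis (of_int n * x))) (at x)"
    using vector_diff_chain_at[OF 1 2] unfolding o_def .
  also have "real_of_int n *\<^sub>R (\<i> * cis (of_int n * x)) = \<i> * of_int n * char_fun n x"
    by (simp add: scaleR_conv_of_real char_fun_def)
  finally have 3: "((\<lambda>x. cis (of_int n * x)) has_vector_derivative \<i> * of_int n * char_fun n x) (at x)" .
  have "char_fun n = (\<lambda>x. cis (of_int n * x))" by (rule ext) (simp add: char_fun_def)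
  then show ?thesis using 3 by simp
qed

lemma fcoeff_deriv:
  assumes d: "\<And>x. (f has_vector_derivative f' x) (at x)" and f: "f \<in> cper" "f' \<in> cper"
  shows "fcoeff f' n = \<i> * of_int n * fcoeff f n"
proof -
  have "((\<lambda>x. f x * (\<i> * of_int (- n) * char_fun (- n) x) + f' x * char_fun (- n) x) has_integral
      (f pi * char_fun (- n) pi - f (- pi) * char_fun (- n) (- pi))) {-pi..pi}"
    by (rule fundamental_theorem_of_calculus, simp, rule has_vector_derivative_at_within,
        rule has_vector_derivative_mult[OF d char_fun_has_vector_derivative])
  moreover have "f pi * char_fun (- n) pi = f (- pi) * char_fun (- n) (- pi)"
    using cper_periodic[OF f(1), of "- pi"] cper_periodic[OF char_fun_cper, of "- n" "- pi"] by simp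
  ultimately have "integral {-pi..pi} (\<lambda>x. (- \<i> * of_int n) * (f x * char_fun (- n) x) + f' x * char_fun (- n) x) = 0"
    by (intro integral_unique) (simp add: algebra_simps)
  moreover have i: "(\<lambda>x. g x * char_fun (- n) x) integrable_on {-pi..pi}" if "g \<in> cper" for g
    by (intro integrable_continuous_interval cper_continuous cper_mult that char_fun_cper)
  have "integral {-pi..pi} (\<lambda>x. (- \<i> * of_int n) * (f x * char_fun (- n) x) + f' x * char_fun (- n) x)
     = (- \<i> * of_int n) * integral {-pi..pi} (\<lambda>x. f x * char_fun (- n) x) + integral {-pi..pi} (\<lambda>x. f' x * char_fun (- n) x)"
    by (subst integral_add[OF integrable_on_mult_right[OF i[OF f(1)]] i[OF f(2)]]) simp
  ultimately show ?thesis by (simp add: fcoeff_def l2_ip_def cnj_char_fun field_simps)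
qed

lemma fcoeff_second_deriv:
  assumes "f \<in> C2pi"
  shows "fcoeff (second_deriv f) n = - (of_int n)\<^sup>2 * fcoeff f n"
proof -
  obtain f' where C: "C2 f f' (second_deriv f)" using C2pi_E[OF assms] by blast
  have f': "f' \<in> cper"
    by (intro pi_periodic_cper C2_continuous[OF C] C2_periodic[OF C] C2pi_periodic[OF assms])
  have "fcoeff (second_deriv f) n = \<i> * of_int n * fcoeff f' n"
    using C f' second_deriv_cper[OF assms] by (intro fcoeff_deriv) (auto simp: C2_def)
  also have "fcoeff f' n = \<i> * of_int n * fcoeff f n"
    using C f' C2pi_cper[OF assms] by (intro fcoeff_deriv) (auto simp: C2_def)
  finally show ?thesis by (simp add: power2_eq_square mult.assoc mult.left_commute[of "of_int n" "\<i>"])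
qed

section \<open>Moments of sine powers and the eigenvalues\<close>

definition sin_moment :: "real \<Rightarrow> int \<Rightarrow> complex" where
  "sin_moment p n = integral {0..pi} (\<lambda>u. char_fun n u * of_real (sin u) powr of_real p)"

text \<open>The function sin^(p+1)(u) e^(i (n+1) u) vanishes at 0 and \<pi>. With cos and sin
  written through the characters 1 and -1, its derivative combines the integrands for
  \<open>n + 2\<close> and \<open>n\<close>.\<close>

lemma sin_moment_recursion:
  assumes p: "0 < p"
  shows "(p + 2 + of_int n) * sin_moment p (n + 2) = (of_int n - p) * sin_moment p n"
proof -
  define sp where "sp q u = complex_of_real (sin u) powr (of_real q)" for q u
  define G where "G u = sp (p + 1) u * char_fun (n + 1) u" for u
  have cont: "continuous_on {0..pi} (sp q)" if "0 < q" for q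
    unfolding sp_def using that by (intro continuous_on_sin_powr) simp_all
  have H: "((\<lambda>u. ((p + 2 + of_int n) * (char_fun (n + 2) u * sp p u) - (of_int n - p) * (char_fun n u * sp p u)) / 2)
      has_integral (G pi - G 0)) {0..pi}"
  proof (rule fundamental_theorem_of_calculus_interior)
    show "continuous_on {0..pi} G"
      unfolding G_def using p by (intro continuous_on_mult cont cper_continuous char_fun_cper) simp
    fix u assume u: "u \<in> {0<..<pi}"
    have s: "0 < sin u" using u by (intro sin_gt_zero) auto
    have "(G has_vector_derivative (sp (p + 1) u * (\<i> * of_int (n + 1) * char_fun (n + 1) u)
       + of_real (p + 1) * complex_of_real (sin u) powr (of_real (p + 1) - 1) * of_real (cos u) * char_fun (n + 1) u)) (at u)"
      unfolding G_def sp_def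
      by (intro has_vector_derivative_mult sin_powr_has_vector_derivative char_fun_has_vector_derivative u)
    also have "complex_of_real (sin u) powr (of_real (p + 1) - 1) = sp p u" by (simp add: sp_def)
    also have "sp (p + 1) u = of_real (sin u) * sp p u" using s by (simp add: sp_def powr_add)
    also have "of_real (sin u) * sp p u * (\<i> * of_int (n + 1) * char_fun (n + 1) u) + of_real (p + 1) * sp p u * of_real (cos u) * char_fun (n + 1) u
      = ((p + 2 + of_int n) * (char_fun (n + 2) u * sp p u) - (of_int n - p) * (char_fun n u * sp p u)) / 2"
    proof -
      have e: "char_fun (n + 2) u = char_fun (n + 1) u * char_fun 1 u" "char_fun n u = char_fun (n + 1) u * char_fun (- 1) u"
        by (simp_all add: char_fun_mult add.commute)
      have e1: "char_fun 1 u = of_real (cos u) + \<i> * of_real (sin u)" "char_fun (- 1) u = of_real (cos u) - \<i> * of_real (sin u)"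
        by (simp_all add: char_fun_def complex_eq_iff)
      show ?thesis unfolding e e1 by (simp add: algebra_simps)
    qed
    finally show "(G has_vector_derivative ((p + 2 + of_int n) * (char_fun (n + 2) u * sp p u) - (of_int n - p) * (char_fun n u * sp p u)) / 2) (at u)" .
  qed simp
  have G: "G pi = 0" "G 0 = 0" using p by (simp_all add: G_def sp_def)
  have i: "(\<lambda>u. c * (char_fun k u * sp p u)) integrable_on {0..pi}" for c k
    using p by (intro integrable_continuous_interval continuous_on_mult cont cper_continuous char_fun_cper continuous_on_const)
  have eq: "integral {0..pi} (\<lambda>u. ((p + 2 + of_int n) * (char_fun (n + 2) u * sp p u) - (of_int n - p) * (char_fun n u * sp p u)) / 2)
    = ((p + 2 + of_int n) * sin_moment p (n + 2) - (of_int n - p) * sin_moment p n) / 2"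
    using integral_diff[OF i[of "p + 2 + of_int n" "n + 2"] i[of "of_int n - p" n]]
    by (simp add: sin_moment_def sp_def)
  show ?thesis using integral_unique[OF H, unfolded eq G] by simp
qed

lemma sin_moment_0_pos:
  assumes p: "0 < p"
  obtains c where "0 < c" "sin_moment p 0 = of_real c"
proof -
  define c where "c = integral {0..pi} (\<lambda>u. sin u powr p)"
  have cont: "continuous_on {0..pi} (\<lambda>u. sin u powr p)"
    using p by (intro continuous_on_powr' continuous_intros) (auto intro: sin_ge_zero)
  have "sin_moment p 0 = integral {0..pi} (\<lambda>u. of_real (sin u powr p))"
    unfolding sin_moment_def
    by (rule Henstock_Kurzweil_Integration.integral_cong) (simp add: char_fun_def powr_of_real sin_ge_zero)
  also have "\<dots> = of_real c"
    unfolding c_def by (intro integral_unique has_integral_of_real integrable_integral integrable_continuous_interval cont)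
  finally have "sin_moment p 0 = of_real c" .
  moreover have "0 < c"
  proof -
    have "0 \<le> c" unfolding c_def by (intro integral_nonneg integrable_continuous_interval cont) simp
    moreover have "c \<noteq> 0"
    proof
      assume "c = 0"
      then have "\<forall>u\<in>{0..pi}. sin u powr p = 0"
        unfolding c_def by (subst (asm) integral_eq_0_iff[OF cont]) auto
      from bspec[OF this, of "pi / 2"] show False by simp
    qed
    ultimately show ?thesis by simp
  qed
  ultimately show thesis using that by blast
qed

text \<open>By the functional equation of \<open>\<Gamma>\<close>, \<open>spec l k = d(l, 2k) / d(l, 0)\<close> in the paper's notation.\<close>

definition spec :: "real \<Rightarrow> nat \<Rightarrow> real" where
  "spec l k = (\<Prod>j<k. (real j + 1 / 2 + l) / (real j + 1 / 2 - l))"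

text \<open>For even \<open>n\<close>, the eigenvalue at \<open>n\<close> divided by the one at 0.
  Odd \<open>n\<close> share the value of the even number next below in absolute value, which keeps
  all weights positive; functions in \<open>C2pi\<close> have no odd coefficients.\<close>

definition weight :: "real \<Rightarrow> int \<Rightarrow> real" where
  "weight l n = spec l (nat (\<bar>n\<bar> div 2))"

lemma spec_pos: "\<bar>l\<bar> < 1 / 2 \<Longrightarrow> 0 < spec l k"
  unfolding spec_def by (intro prod_pos divide_pos_pos) auto

lemma spec_minus: "\<bar>l\<bar> < 1 / 2 \<Longrightarrow> spec (- l) k * spec l k = 1"
proof -
  assume l: "\<bar>l\<bar> < 1 / 2"
  have "(real j + 1 / 2 + - l) / (real j + 1 / 2 - - l) * ((real j + 1 / 2 + l) / (real j + 1 / 2 - l)) = 1" for j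
  proof -
    have "real j + 1 / 2 + l \<noteq> 0" "real j + 1 / 2 - l \<noteq> 0" using l by linarith+
    then show ?thesis by simp
  qed
  then show ?thesis unfolding spec_def prod.distrib[symmetric] by simp
qed

lemma weight_pos: "\<bar>l\<bar> < 1 / 2 \<Longrightarrow> 0 < weight l n"
  by (simp add: weight_def spec_pos)

lemma weight_minus: "\<bar>l\<bar> < 1 / 2 \<Longrightarrow> weight (- l) n * weight l n = 1"
  by (simp add: weight_def spec_minus)

lemma J_const_pos:
  assumes l: "\<bar>l\<bar> < 1 / 2"
  obtains c where "0 < c" "J_const (of_real l) = of_real c"
proof -
  define c where "c = Gamma (1 / 2 + l) * 2 powr (2 * l) * rGamma (1 - l) / (2 * sqrt pi * (1 - 2 * l))"
  have "0 < Gamma (1 / 2 + l)" "0 < rGamma (1 - l)"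
    using l Gamma_real_pos[of "1 / 2 + l"] Gamma_real_pos[of "1 - l"] by (auto simp: rGamma_inverse_Gamma)
  then have "0 < c" unfolding c_def using l by (intro divide_pos_pos mult_pos_pos) auto
  moreover have "J_const (of_real l) = of_real c"
  proof -
    have "Gamma (1 / 2 + complex_of_real l) = of_real (Gamma (1 / 2 + l))"
      "rGamma (1 - complex_of_real l) = of_real (rGamma (1 - l))"
      using Gamma_complex_of_real[of "1 / 2 + l"] rGamma_complex_of_real[of "1 - l"] by simp_all
    moreover have "2 powr (2 * complex_of_real l) = of_real (2 powr (2 * l))"
      using powr_of_real[of 2 "2 * l"] by simp
    ultimately show ?thesis by (simp add: J_const_def c_def)
  qed
  ultimately show thesis using that by blast
qed

definition J_scale :: "real \<Rightarrow> real" where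
  "J_scale l = Re (J_const (of_real l) * (1 - 2 * l)\<^sup>2 * sin_moment (1 - 2 * l) 0)"

text \<open>With \<open>p = 1 - 2 l\<close>, the factor \<open>p^2 - n^2\<close> turns the recursion
  of the moments into \<open>(n + p) D(n + 2) = (n + 2 - p) D(n)\<close>, whose ratio at
  \<open>n = 2 k\<close> is the factor of index \<open>k\<close> in \<open>spec\<close>. Positivity
  of \<open>J_scale\<close> is that of the moment at 0.\<close>

lemma J_spectrum:
  fixes l :: real and n :: int
  assumes l: "\<bar>l\<bar> < 1 / 2" and n: "even n"
  shows "J_const (of_real l) * (((1 - 2 * l)\<^sup>2 - (of_int n)\<^sup>2) * sin_moment (1 - 2 * l) n) = of_real (J_scale l * weight l n)"
    and "0 < J_scale l"
proof -
  define p where "p = 1 - 2 * l"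
  have p: "0 < p" "p < 2" using l by (auto simp: p_def)
  define D where "D n = J_const (of_real l) * ((p\<^sup>2 - (of_int n)\<^sup>2) * sin_moment p n)" for n
  obtain c where c: "0 < c" "J_const (of_real l) = of_real c" using J_const_pos[OF l] .
  obtain c' where c': "0 < c'" "sin_moment p 0 = of_real c'" using sin_moment_0_pos[OF p(1)] .
  have "J_const (of_real l) * (1 - 2 * l)\<^sup>2 * sin_moment (1 - 2 * l) 0 = of_real (c * p\<^sup>2 * c')"
    using c c' by (simp add: p_def)
  then have sc: "J_scale l = c * p\<^sup>2 * c'" unfolding J_scale_def by (simp only: Re_complex_of_real)
  then show "0 < J_scale l" using c c' p by simp
  have D0: "D 0 = of_real (J_scale l)" using c c' by (simp add: D_def sc)
  have rec: "of_real (of_int n + p) * D (n + 2) = of_real (of_int n + 2 - p) * D n" for n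
  proof -
    define S where "S = sin_moment p n"
    have S: "(p + 2 + of_int n) * sin_moment p (n + 2) = (of_int n - p) * S"
      unfolding S_def using sin_moment_recursion[OF p(1), of n] by simp
    have "of_real (of_int n + p) * D (n + 2) = J_const (of_real l) * (of_int n + p) * (p - of_int n - 2) * ((p + 2 + of_int n) * sin_moment p (n + 2))"
      by (simp add: D_def power2_eq_square algebra_simps)
    also have "\<dots> = J_const (of_real l) * (of_int n + p) * (p - of_int n - 2) * ((of_int n - p) * S)"
      by (simp only: S)
    also have "\<dots> = of_real (of_int n + 2 - p) * D n"
      by (simp add: D_def S_def[symmetric] power2_eq_square algebra_simps)
    finally show ?thesis .
  qed
  have up: "D (2 * int k) = of_real (J_scale l * spec l k)" for k
  proof (induction k)
    case (Suc k)
    have nz: "2 * real k + p \<noteq> 0" using p by linarith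
    have "(2 * real k + p) * spec l (Suc k) = (2 * real k + 2 - p) * spec l k"
    proof -
      have 1: "spec l (Suc k) = spec l k * ((real k + 1 / 2 + l) / (real k + 1 / 2 - l))" by (simp add: spec_def)
      have 2: "2 * real k + p = 2 * (real k + 1 / 2 - l)" "2 * real k + 2 - p = 2 * (real k + 1 / 2 + l)"
        by (simp_all add: p_def)
      have "real k + 1 / 2 - l \<noteq> 0" using l by linarith
      moreover have "2 * A * (x * (B / A)) = 2 * B * x" if "A \<noteq> 0" for A B x :: real using that by simp
      ultimately show ?thesis unfolding 1 2 by blast
    qed
    then have "(2 * real k + 2 - p) * (J_scale l * spec l k) = (2 * real k + p) * (J_scale l * spec l (Suc k))"
      by (simp only: mult.left_commute[of _ "J_scale l"])
    moreover have "of_real (2 * real k + p) * D (2 * int k + 2) = of_real ((2 * real k + 2 - p) * (J_scale l * spec l k))"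
      using rec[of "2 * int k"] by (simp only: Suc of_real_mult) simp
    ultimately have "of_real (2 * real k + p) * D (2 * int k + 2) = of_real (2 * real k + p) * of_real (J_scale l * spec l (Suc k))"
      by (simp only: of_real_mult)
    then have "D (2 * int k + 2) = of_real (J_scale l * spec l (Suc k))"
      using nz by (metis mult_cancel_left of_real_eq_0_iff)
    then show ?case by (simp add: algebra_simps)
  qed (simp add: D0 spec_def)
  \<comment> \<open>At \<open>- 2 k - 2\<close> the recursion reads, up to sign, as it does at
    \<open>2 k\<close>, so \<open>D\<close> is even.\<close>
  have down: "D (- 2 * int k) = D (2 * int k)" for k
  proof (induction k)
    case (Suc k)
    have "2 * real k + p \<noteq> 0" using p by (simp add: add_nonneg_pos less_imp_neq[symmetric])
    moreover have "of_real (2 * real k + p) * D (- 2 * int k - 2) = of_real (2 * real k + 2 - p) * D (- 2 * int k)"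
      using rec[of "- 2 * int k - 2"] by (simp add: algebra_simps)
    moreover have "of_real (2 * real k + p) * D (2 * int k + 2) = of_real (2 * real k + 2 - p) * D (2 * int k)"
      using rec[of "2 * int k"] by simp
    ultimately have "D (- 2 * int k - 2) = D (2 * int k + 2)"
      using Suc by (metis mult_cancel_left of_real_eq_0_iff)
    moreover have "- 2 * int (Suc k) = - 2 * int k - 2" "2 * int (Suc k) = 2 * int k + 2" by simp_all
    ultimately show ?case by metis
  qed simp
  obtain k where k: "n = 2 * k" using n by blast
  have "D n = of_real (J_scale l * weight l n)"
  proof (cases "0 \<le> k")
    case True
    then show ?thesis using up[of "nat k"] k by (simp add: weight_def)
  next
    case False
    then have "\<bar>n\<bar> = 2 * (- k)" using k by simp
    then have "\<bar>n\<bar> div 2 = - k" by simp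
    then show ?thesis using False up[of "nat (- k)"] down[of "nat (- k)"] k by (simp add: weight_def)
  qed
  then show "J_const (of_real l) * (((1 - 2 * l)\<^sup>2 - (of_int n)\<^sup>2) * sin_moment (1 - 2 * l) n) = of_real (J_scale l * weight l n)"
    by (simp add: D_def p_def)
qed

lemma fcoeff_shift:
  assumes f: "f \<in> cper"
  shows "fcoeff (\<lambda>x. f (x + a)) n = char_fun n a * fcoeff f n"
proof -
  have g: "(\<lambda>y. f y * cnj (char_fun n (y - a))) \<in> cper"
    using cper_mult[OF f cper_cnj[OF cper_shift[OF char_fun_cper, of n "- a"]]] by simp
  have "integral {-pi..pi} (\<lambda>x. f (x + a) * cnj (char_fun n x))
    = integral {-pi..pi} (\<lambda>x. (\<lambda>y. f y * cnj (char_fun n (y - a))) (x + a))"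
    by simp
  also have "\<dots> = integral {-pi..pi} (\<lambda>y. f y * cnj (char_fun n (y - a)))"
    by (rule integral_periodic_shift[OF g])
  also have "\<dots> = integral {-pi..pi} (\<lambda>y. char_fun n a * (f y * cnj (char_fun n y)))"
    by (simp add: char_fun_diff cnj_char_fun mult_ac)
  finally show ?thesis by (simp add: fcoeff_def l2_ip_def)
qed

definition J_density :: "real \<Rightarrow> (real \<Rightarrow> complex) \<Rightarrow> real \<Rightarrow> complex" where
  "J_density l f x = of_real ((1 - 2 * l)\<^sup>2) * f x + second_deriv f x"

lemma J_real_eq:
  "J_real l f \<phi> = J_const (of_real l) *
    integral {0..pi} (\<lambda>u. J_density l f (u + \<phi>) * of_real (sin u) powr of_real (1 - 2 * l))"
  by (simp add: J_real_def J_reg_def J_density_def)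

lemma J_density_cper: "f \<in> C2pi \<Longrightarrow> J_density l f \<in> cper"
  unfolding J_density_def[abs_def] by (intro cper_add cper_scale C2pi_cper second_deriv_cper)

lemma J_real_cper:
  assumes f: "f \<in> C2pi" and l: "\<bar>l\<bar> < 1 / 2"
  shows "J_real l f \<in> cper"
proof -
  have w: "0 < Re (complex_of_real (1 - 2 * l))" using l by auto
  have d: "J_density l f \<in> cper" by (rule J_density_cper[OF f])
  have "continuous_on UNIV (\<lambda>\<phi>. integral (cbox 0 pi) (\<lambda>u. J_density l f (u + \<phi>) * of_real (sin u) powr of_real (1 - 2 * l)))"
  proof (rule integral_continuous_on_param)
    show "continuous_on (UNIV \<times> cbox 0 pi) (\<lambda>(\<phi>, u). J_density l f (u + \<phi>) * complex_of_real (sin u) powr of_real (1 - 2 * l))"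
      unfolding case_prod_unfold
      by (intro continuous_on_mult continuous_on_compose2[OF cper_continuous[OF d, of UNIV]] continuous_on_add
          continuous_on_fst continuous_on_snd continuous_on_id continuous_on_compose2[OF continuous_on_sin_powr[OF w order_refl]]) auto
  qed
  then have "continuous_on UNIV (J_real l f)"
    unfolding J_real_eq[abs_def] cbox_interval by (intro continuous_on_mult continuous_on_const)
  moreover have "J_real l f (x + 2 * pi) = J_real l f x" for x
    using cper_periodic[OF d] by (simp add: J_real_eq add.assoc[symmetric])
  ultimately show ?thesis by (simp add: cper_def)
qed

lemma fcoeff_J_density:
  assumes f: "f \<in> C2pi"
  shows "fcoeff (J_density l f) n = ((1 - 2 * of_real l)\<^sup>2 - (of_int n)\<^sup>2) * fcoeff f n"
proof -
  have m: "f \<in> cper" "second_deriv f \<in> cper" by (rule C2pi_cper[OF f], rule second_deriv_cper[OF f])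
  have "J_density l f = (\<lambda>x. of_real ((1 - 2 * l)\<^sup>2) * f x - (- 1) * second_deriv f x)"
    by (simp add: J_density_def[abs_def])
  then have "fcoeff (J_density l f) n = of_real ((1 - 2 * l)\<^sup>2) * fcoeff f n - (- 1) * fcoeff (second_deriv f) n"
    unfolding fcoeff_def
    by (simp only: L2.ip_diff_left[OF cper_scale[OF m(1)] cper_scale[OF m(2)] char_fun_cper] L2.ip_scale_left[OF m(1) char_fun_cper]
        L2.ip_scale_left[OF m(2) char_fun_cper])
  then show ?thesis by (simp add: fcoeff_second_deriv[OF f] algebra_simps)
qed

text \<open>\<open>J_real\<close> is a correlation with a power of the sine, hence diagonal in the
  characters: the sine gives \<open>sin_moment\<close>, the density the factor
  \<open>(1 - 2 l)^2 - n^2\<close>. \<open>J_spectrum\<close> identifies the product for even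
  \<open>n\<close>; at odd \<open>n\<close> both sides vanish.\<close>

theorem fcoeff_J_real:
  assumes f: "f \<in> C2pi" and l: "\<bar>l\<bar> < 1 / 2"
  shows "fcoeff (J_real l f) n = of_real (J_scale l * weight l n) * fcoeff f n"
proof -
  define sp where "sp u = complex_of_real (sin u) powr of_real (1 - 2 * l)" for u
  define G where "G = J_density l f"
  have w: "0 < Re (complex_of_real (1 - 2 * l))" using l by auto
  have G: "G \<in> cper" unfolding G_def by (rule J_density_cper[OF f])
  have sp: "continuous_on {0..pi} sp" unfolding sp_def[abs_def] by (rule continuous_on_sin_powr[OF w order_refl])
  have "fcoeff (J_real l f) n = J_const (of_real l) * (integral {-pi..pi} (\<lambda>\<phi>. integral {0..pi} (\<lambda>u. G (u + \<phi>) * sp u) * cnj (char_fun n \<phi>)) / (2 * pi))"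
    by (simp add: fcoeff_def l2_ip_def J_real_eq G_def sp_def mult.assoc)
  also have "integral {-pi..pi} (\<lambda>\<phi>. integral {0..pi} (\<lambda>u. G (u + \<phi>) * sp u) * cnj (char_fun n \<phi>))
     = integral {-pi..pi} (\<lambda>\<phi>. integral {0..pi} (\<lambda>u. G (u + \<phi>) * sp u * cnj (char_fun n \<phi>)))"
    by simp
  also have "\<dots> = integral {0..pi} (\<lambda>u. integral {-pi..pi} (\<lambda>\<phi>. G (u + \<phi>) * sp u * cnj (char_fun n \<phi>)))"
  proof -
    have "continuous_on (cbox (-pi, 0) (pi, pi)) (\<lambda>(\<phi>, u). G (u + \<phi>) * sp u * cnj (char_fun n \<phi>))"
      unfolding case_prod_unfold
      by (intro continuous_on_mult continuous_on_cnj continuous_on_compose2[OF cper_continuous[OF G, of UNIV]]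
          continuous_on_compose2[OF cper_continuous[OF char_fun_cper, of UNIV]] continuous_on_add
          continuous_on_fst continuous_on_snd continuous_on_id continuous_on_compose2[OF sp]) auto
    from integral_swap_continuous[OF this] show ?thesis unfolding cbox_interval .
  qed
  also have "\<dots> = integral {0..pi} (\<lambda>u. char_fun n u * sp u * (2 * pi * fcoeff G n))"
  proof (intro arg_cong[where f = "integral _"] ext)
    fix u
    have "integral {-pi..pi} (\<lambda>\<phi>. G (u + \<phi>) * sp u * cnj (char_fun n \<phi>)) = integral {-pi..pi} (\<lambda>\<phi>. sp u * (G (\<phi> + u) * cnj (char_fun n \<phi>)))"
      by (simp add: mult_ac add.commute)
    also have "\<dots> = sp u * (2 * pi * fcoeff (\<lambda>\<phi>. G (\<phi> + u)) n)"
      by (simp add: fcoeff_def l2_ip_def)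
    finally show "integral {-pi..pi} (\<lambda>\<phi>. G (u + \<phi>) * sp u * cnj (char_fun n \<phi>)) = char_fun n u * sp u * (2 * pi * fcoeff G n)"
      by (simp add: fcoeff_shift[OF G])
  qed
  also have "\<dots> = sin_moment (1 - 2 * l) n * (2 * pi * fcoeff G n)"
    by (simp add: sin_moment_def sp_def)
  finally have "fcoeff (J_real l f) n = J_const (of_real l) * (((1 - 2 * of_real l)\<^sup>2 - (of_int n)\<^sup>2) * sin_moment (1 - 2 * l) n) * fcoeff f n"
    by (simp add: G_def fcoeff_J_density[OF f])
  moreover have "J_const (of_real l) * (((1 - 2 * of_real l)\<^sup>2 - (of_int n)\<^sup>2) * sin_moment (1 - 2 * l) n) = of_real (J_scale l * weight l n)" if "even n"
    using J_spectrum(1)[OF l that] by simp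
  moreover have "fcoeff f n = 0" if "odd n"
    by (rule fcoeff_odd[OF C2pi_cper[OF f] C2pi_periodic[OF f] that])
  ultimately show ?thesis by (cases "even n") simp_all
qed

lemma J_real_char_fun:
  assumes l: "\<bar>l\<bar> < 1 / 2" and n: "even n"
  shows "char_fun n \<in> C2pi" and "J_real l (char_fun n) x = of_real (J_scale l * weight l n) * char_fun n x"
proof -
  have d: "(char_fun n has_vector_derivative \<i> * of_int n * char_fun n x) (at x)" for x
    by (rule char_fun_has_vector_derivative)
  have d2: "((\<lambda>x. \<i> * of_int n * char_fun n x) has_vector_derivative - (of_int n)\<^sup>2 * char_fun n x) (at x)" for x
    using has_vector_derivative_mult_right[OF d, of "\<i> * of_int n"] by (simp add: power2_eq_square algebra_simps)
  have C: "C2 (char_fun n) (\<lambda>x. \<i> * of_int n * char_fun n x) (\<lambda>x. - (of_int n)\<^sup>2 * char_fun n x)"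
    unfolding C2_def using d d2 cper_continuous[OF char_fun_cper] by (auto intro!: continuous_intros)
  have per: "char_fun n (x + pi) = char_fun n x" for x using n by (simp add: char_fun_add char_fun_pi)
  show "char_fun n \<in> C2pi" unfolding C2pi_def using C per by blast
  have "J_real l (char_fun n) x = J_const (of_real l) * integral {0..pi} (\<lambda>u. (((1 - 2 * of_real l)\<^sup>2 - (of_int n)\<^sup>2) * char_fun n x) * (char_fun n u * of_real (sin u) powr of_real (1 - 2 * l)))"
    by (simp add: J_real_eq J_density_def second_deriv_eq[OF C] char_fun_add algebra_simps)
  also have "\<dots> = J_const (of_real l) * (((1 - 2 * of_real l)\<^sup>2 - (of_int n)\<^sup>2) * sin_moment (1 - 2 * l) n) * char_fun n x"
    by (simp add: sin_moment_def)
  also have "\<dots> = of_real (J_scale l * weight l n) * char_fun n x"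
    using J_spectrum(1)[OF l n] by simp
  finally show "J_real l (char_fun n) x = of_real (J_scale l * weight l n) * char_fun n x" .
qed

section \<open>Twists preserve C2 regularity\<close>

lemma C2_mult:
  assumes f: "C2 f f' f''" and g: "C2 g g' g''"
  shows "C2 (\<lambda>x. f x * g x) (\<lambda>x. f x * g' x + f' x * g x)
    (\<lambda>x. (f x * g'' x + f' x * g' x) + (f' x * g' x + f'' x * g x))"
proof -
  have d: "(f has_vector_derivative f' x) (at x)" "(f' has_vector_derivative f'' x) (at x)"
    "(g has_vector_derivative g' x) (at x)" "(g' has_vector_derivative g'' x) (at x)" for x
    using f g by (auto simp: C2_def)
  show ?thesis
    unfolding C2_def
    by (intro conjI allI has_vector_derivative_add has_vector_derivative_mult d continuous_on_add continuous_on_mult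
        C2_continuous[OF f] C2_continuous[OF g])
qed

lemma C2_compose:
  assumes f: "C2 f f' f''"
    and h: "\<And>x. (h has_real_derivative h1 x) (at x)" "\<And>x. (h1 has_real_derivative h2 x) (at x)" "continuous_on UNIV h2"
  shows "C2 (\<lambda>x. f (h x)) (\<lambda>x. of_real (h1 x) * f' (h x))
    (\<lambda>x. of_real (h1 x) * (of_real (h1 x) * f'' (h x)) + of_real (h2 x) * f' (h x))"
proof -
  have ch: "((\<lambda>x. g (h x)) has_vector_derivative of_real (h1 x) * g' (h x)) (at x)"
    if "\<And>x. (g has_vector_derivative g' x) (at x)" for g g' :: "real \<Rightarrow> complex" and x
    using vector_diff_chain_at[OF h(1)[unfolded has_real_derivative_iff_has_vector_derivative] that]
    by (simp add: o_def scaleR_conv_of_real)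
  have d1: "((\<lambda>x. complex_of_real (h1 x)) has_vector_derivative of_real (h2 x)) (at x)" for x
    using h(2)[of x] by (intro has_vector_derivative_of_real) (simp add: has_real_derivative_iff_has_vector_derivative)
  have ch0: "continuous_on UNIV h" "continuous_on UNIV h1"
    using h by (auto intro!: continuous_at_imp_continuous_on DERIV_isCont)
  have "((\<lambda>x. of_real (h1 x) * f' (h x)) has_vector_derivative of_real (h1 x) * (of_real (h1 x) * f'' (h x)) + of_real (h2 x) * f' (h x)) (at x)" for x
    using f by (intro has_vector_derivative_mult d1 ch) (auto simp: C2_def)
  moreover have "continuous_on UNIV (\<lambda>x. of_real (h1 x) * (of_real (h1 x) * f'' (h x)) + of_real (h2 x) * f' (h x))"
    by (intro continuous_on_add continuous_on_mult continuous_on_of_real ch0 h(3)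
        continuous_on_compose2[OF C2_continuous(2)[OF f, of UNIV]] continuous_on_compose2[OF C2_continuous(3)[OF f, of UNIV]]) auto
  ultimately show ?thesis using f ch unfolding C2_def by blast
qed

lemma C2_of_real:
  assumes h: "\<And>x. (h has_real_derivative h1 x) (at x)" "\<And>x. (h1 has_real_derivative h2 x) (at x)" "continuous_on UNIV h2"
  shows "C2 (\<lambda>x. of_real (h x)) (\<lambda>x. of_real (h1 x)) (\<lambda>x. of_real (h2 x))"
  using h unfolding C2_def
  by (auto intro!: has_vector_derivative_of_real continuous_on_of_real simp: has_real_derivative_iff_has_vector_derivative)

lemma twist_C2pi:
  assumes f: "f \<in> C2pi"
  shows "twist (of_real w) r t f \<in> C2pi"
proof -
  \<comment> \<open>The power \<open>w\<close> of the radius is the power \<open>w / 2\<close> of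
    \<open>Q = radius^2\<close>, a positive trigonometric polynomial with explicit
    derivatives.\<close>
  define a where "a = w / 2"
  define Q where "Q x = (radius r x)\<^sup>2" for x
  define e where "e = 2 * (exp (2 * r) - exp (- 2 * r))"
  define Q1 where "Q1 x = e * (sin x * cos x)" for x
  define Q2 where "Q2 x = e * ((cos x)\<^sup>2 - (sin x)\<^sup>2)" for x
  have Q0: "0 < Q x" for x by (simp add: Q_def radius_pos)
  have dQ: "(Q has_real_derivative Q1 x) (at x)" for x
    unfolding Q_def[abs_def] radius_sq Q1_def e_def
    by (auto intro!: derivative_eq_intros simp: algebra_simps)
  have dQ1: "(Q1 has_real_derivative Q2 x) (at x)" for x
    unfolding Q1_def[abs_def] Q2_def by (auto intro!: derivative_eq_intros simp: power2_eq_square algebra_simps)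
  have cQ: "continuous_on UNIV Q" "continuous_on UNIV Q1" "continuous_on UNIV Q2"
  proof -
    show "continuous_on UNIV Q" "continuous_on UNIV Q1"
      using dQ dQ1 by (auto intro!: continuous_at_imp_continuous_on DERIV_isCont)
    show "continuous_on UNIV Q2" unfolding Q2_def[abs_def] by (intro continuous_intros)
  qed
  have pw: "((\<lambda>x. Q x powr b) has_real_derivative b * Q x powr (b - 1) * Q1 x) (at x)" for b x
    using DERIV_fun_powr[OF dQ Q0, of b x] by simp
  have cpw: "continuous_on UNIV (\<lambda>x. Q x powr b)" for b
    using Q0 by (intro continuous_on_powr cQ continuous_on_const) (auto simp: less_imp_neq[symmetric])
  have C1: "C2 (\<lambda>x. of_real (Q x powr a)) (\<lambda>x. of_real (a * Q x powr (a - 1) * Q1 x))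
     (\<lambda>x. of_real ((a * ((a - 1) * Q x powr (a - 1 - 1) * Q1 x)) * Q1 x + Q2 x * (a * Q x powr (a - 1))))"
    by (intro C2_of_real pw DERIV_mult' DERIV_cmult dQ1 continuous_intros cpw cQ)
       (use DERIV_mult[OF DERIV_cmult[OF pw, of a "a - 1"] dQ1] in \<open>simp add: algebra_simps\<close>)
  obtain f' where Cf: "C2 f f' (second_deriv f)" using C2pi_E[OF f] by blast
  have dA: "((\<lambda>x. angle r x + t) has_real_derivative inverse (Q x)) (at x)" for x
    using DERIV_add[OF angle_has_derivative DERIV_const] by (simp add: Q_def inverse_eq_divide)
  have dA1: "((\<lambda>x. inverse (Q x)) has_real_derivative - (inverse (Q x) * Q1 x * inverse (Q x))) (at x)" for x
    using Q0[of x] by (intro DERIV_inverse' dQ) simp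
  have cA: "continuous_on UNIV (\<lambda>x. - (inverse (Q x) * Q1 x * inverse (Q x)))"
    using Q0 by (intro continuous_on_minus continuous_on_mult continuous_on_inverse cQ) (auto simp: less_imp_neq[symmetric])
  note C = C2_mult[OF C1 C2_compose[OF Cf dA dA1 cA]]
  have "twist (of_real w) r t f = (\<lambda>x. of_real (Q x powr a) * f (angle r x + t))"
  proof
    fix x
    have "radius r x powr w = Q x powr a"
      using radius_pos[of r x] by (simp add: Q_def a_def powr_powr flip: powr_numeral)
    then show "twist (of_real w) r t f x = of_real (Q x powr a) * f (angle r x + t)"
      using radius_pos[of r x] by (simp add: twist_def powr_of_real)
  qed
  moreover have "twist (of_real w) r t f (x + pi) = twist (of_real w) r t f x" for x
  proof -
    have "f (angle r x + pi + t) = f (angle r x + t)"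
      using C2pi_periodic[OF f, of "angle r x + t"] by (simp only: add_ac)
    then show ?thesis by (simp only: twist_def angle_plus_pi radius_plus_pi)
  qed
  ultimately show ?thesis using C unfolding C2pi_def by auto
qed

section \<open>The intertwining property and the complementary form\<close>

text \<open>The integrand may be unbounded at the end points. Its indefinite integral is continuous
  up to them and differentiable inside, and the fundamental theorem is applied to the composition of
  that integral with \<open>g\<close>.\<close>

lemma has_integral_substitution_interior:
  fixes f :: "real \<Rightarrow> 'a::euclidean_space" and g :: "real \<Rightarrow> real"
  assumes ab: "a \<le> b" and g: "continuous_on {a..b} g"
    and der: "\<And>x. x \<in> {a<..<b} \<Longrightarrow> (g has_real_derivative g' x) (at x)"
    and gab: "g ` {a..b} \<subseteq> {g a..g b}" "\<And>x. x \<in> {a<..<b} \<Longrightarrow> g x \<in> {g a<..<g b}"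
    and f: "f integrable_on {g a..g b}" "\<And>y. y \<in> {g a<..<g b} \<Longrightarrow> isCont f y"
  shows "((\<lambda>x. g' x *\<^sub>R f (g x)) has_integral integral {g a..g b} f) {a..b}"
proof -
  define F where "F y = integral {g a..y} f" for y
  have F: "continuous_on {g a..g b} F"
    unfolding F_def by (rule indefinite_integral_continuous_1[OF f(1)])
  have dF: "(F has_vector_derivative f y) (at y)" if y: "y \<in> {g a<..<g b}" for y
  proof -
    have "(F has_vector_derivative f y) (at y within {g a..g b} - {})"
      unfolding F_def using y
      using integral_has_vector_derivative_continuous_at[OF f(1), of y "{}"]
        continuous_at_imp_continuous_at_within[OF f(2)[OF y]] by auto
    then show ?thesis using y at_within_Icc_at[of "g a" y "g b"] by simp
  qed
  have "((\<lambda>x. g' x *\<^sub>R f (g x)) has_integral ((F \<circ> g) b - (F \<circ> g) a)) {a..b}"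
  proof (rule fundamental_theorem_of_calculus_interior[OF ab])
    show "continuous_on {a..b} (F \<circ> g)"
      by (rule continuous_on_compose[OF g continuous_on_subset[OF F gab(1)]])
    show "((F \<circ> g) has_vector_derivative g' x *\<^sub>R f (g x)) (at x)" if "x \<in> {a<..<b}" for x
      by (rule vector_diff_chain_at[OF der[OF that, unfolded has_real_derivative_iff_has_vector_derivative] dF[OF gab(2)[OF that]]])
  qed
  then show ?thesis by (simp add: F_def)
qed

text \<open>Both sides are the determinant of a pair of vectors, before and after a matrix of
  determinant one.\<close>

lemma sin_diff_angle: "sin (x - y) = radius r x * radius r y * sin (angle r x - angle r y)"
proof -
  have ee: "exp r * exp (- r) = 1" by (simp flip: exp_add)
  have "radius r x * radius r y * sin (angle r x - angle r y)
    = (radius r x * sin (angle r x)) * (radius r y * cos (angle r y)) - (radius r x * cos (angle r x)) * (radius r y * sin (angle r y))"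
    by (simp add: sin_diff algebra_simps)
  also have "\<dots> = exp r * exp (- r) * (sin x * cos y - cos x * sin y)"
    unfolding radius_cos_sin_angle by (simp add: algebra_simps)
  finally show ?thesis by (simp add: ee sin_diff)
qed

definition J_kernel :: "real \<Rightarrow> (real \<Rightarrow> complex) \<Rightarrow> real \<Rightarrow> complex" where
  "J_kernel q f \<phi> = integral {\<phi>..\<phi> + pi} (\<lambda>y. f y * of_real (sin (y - \<phi>)) powr of_real q)"

lemma J_real_kernel:
  assumes f: "f \<in> C2pi" and l: "-1/2 < l" "l < 0"
  shows "J_real l f \<phi> = J_const (of_real l) * of_real ((1 - 2 * l) * (- 2 * l)) * J_kernel (- 1 - 2 * l) f \<phi>"
    and "(\<lambda>y. f y * of_real (sin (y - \<phi>)) powr of_real (- 1 - 2 * l)) integrable_on {\<phi>..\<phi> + pi}"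
proof -
  define q where "q = - 1 - 2 * l"
  have q: "-1 < Re (complex_of_real q)" using l by (simp add: q_def)
  have q2: "complex_of_real q + 2 = of_real (1 - 2 * l)" "complex_of_real q + 1 = of_real (- 2 * l)"
    by (simp_all add: q_def)
  define I where "I = integral {0..pi} (\<lambda>u. J_density l f (u + \<phi>) * of_real (sin u) powr of_real (1 - 2 * l)) / (of_real (1 - 2 * l) * of_real (- 2 * l))"
  obtain f' where C: "C2 f f' (second_deriv f)" using C2pi_E[OF f] by blast
  have "((\<lambda>u. f (u + \<phi>) * of_real (sin u) powr of_real q) has_integral I) {0..pi}"
    using sin_powr_parts[OF C2_shift[OF C] q, of \<phi>] unfolding q2 I_def J_density_def by simp
  from has_integral_translate[OF this, of "- \<phi>"]
  have H: "((\<lambda>y. f y * of_real (sin (y - \<phi>)) powr of_real q) has_integral I) {\<phi>..\<phi> + pi}"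
    by (simp add: add.commute)
  then show "(\<lambda>y. f y * of_real (sin (y - \<phi>)) powr of_real (- 1 - 2 * l)) integrable_on {\<phi>..\<phi> + pi}"
    unfolding q_def by blast
  have nz: "complex_of_real (1 - 2 * l) \<noteq> 0" "complex_of_real (- 2 * l) \<noteq> 0" using l by (auto simp: complex_eq_iff)
  have "J_kernel q f \<phi> = I" unfolding J_kernel_def by (rule integral_unique[OF H])
  then show "J_real l f \<phi> = J_const (of_real l) * of_real ((1 - 2 * l) * (- 2 * l)) * J_kernel (- 1 - 2 * l) f \<phi>"
    using nz unfolding J_real_eq q_def[symmetric] by (simp add: I_def)
qed

text \<open>By \<open>sin_diff_angle\<close> the kernel at \<open>x\<close>, \<open>\<phi>\<close>
  is the kernel at their angles times \<open>R^q R0^q\<close> with \<open>q = - 1 - 2 l\<close>. The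
  power of \<open>R\<close> combines with \<open>R^(2 l - 1)\<close> to the Jacobian
  \<open>R^(-2)\<close>, and \<open>R0^q\<close> comes out as the factor of a twist of degree
  \<open>2 (- l) - 1\<close>.\<close>

lemma J_kernel_twist:
  assumes f: "f \<in> C2pi" and l: "-1/2 < l" "l < 0"
  shows "J_kernel (- 1 - 2 * l) (twist (of_real (2 * l - 1)) r t f) \<phi>
    = of_real (radius r \<phi>) powr of_real (- 1 - 2 * l) * J_kernel (- 1 - 2 * l) f (angle r \<phi> + t)"
proof -
  define q where "q = - 1 - 2 * l"
  define A where "A = angle r \<phi>"
  define g where "g y = f (y + t) * complex_of_real (sin (y - A)) powr of_real q" for y
  have Api: "angle r (\<phi> + pi) = A + pi" by (simp add: A_def angle_plus_pi)
  have intg: "g integrable_on {A..A + pi}" and Ig: "integral {A..A + pi} g = J_kernel q f (A + t)"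
  proof -
    have H: "((\<lambda>y. f y * of_real (sin (y - (A + t))) powr of_real q) has_integral J_kernel q f (A + t)) {A + t..A + t + pi}"
      unfolding J_kernel_def q_def by (intro integrable_integral J_real_kernel(2)[OF f l])
    from has_integral_translate[OF this, of t] have "(g has_integral J_kernel q f (A + t)) {A..A + pi}"
      by (simp add: g_def[abs_def] add_ac)
    then show "g integrable_on {A..A + pi}" "integral {A..A + pi} g = J_kernel q f (A + t)"
      by (auto simp: integral_unique)
  qed
  have pos: "0 < sin (y - A)" if "y \<in> {A<..<A + pi}" for y
    using that by (intro sin_gt_zero) auto
  have "((\<lambda>x. (1 / (radius r x)\<^sup>2) *\<^sub>R g (angle r x)) has_integral integral {angle r \<phi>..angle r (\<phi> + pi)} g) {\<phi>..\<phi> + pi}"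
  proof (rule has_integral_substitution_interior)
    show "isCont g y" if "y \<in> {angle r \<phi><..<angle r (\<phi> + pi)}" for y
    proof -
      have "continuous_on {A<..<A + pi} g"
        unfolding g_def[abs_def]
      proof (rule continuous_on_mult)
        show "continuous_on {A<..<A + pi} (\<lambda>y. f (y + t))"
          by (intro continuous_on_compose2[OF cper_continuous[OF C2pi_cper[OF f], of UNIV]] continuous_intros) auto
        show "continuous_on {A<..<A + pi} (\<lambda>y. complex_of_real (sin (y - A)) powr of_real q)"
        proof (rule continuous_on_powr_complex)
          show "{A<..<A + pi} \<subseteq> {y. 0 \<le> Re (of_real (sin (y - A))) \<or> Im (of_real (sin (y - A))) \<noteq> 0}"
            using less_imp_le[OF pos] by auto
          show "0 < Re (of_real q)" if "y \<in> {A<..<A + pi}" "complex_of_real (sin (y - A)) = 0" for y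
            using pos[OF that(1)] that(2) by simp
        qed (intro continuous_intros)+
      qed
      then show ?thesis
        using that unfolding A_def[symmetric] Api by (simp add: continuous_on_eq_continuous_at)
    qed
    show "angle r ` {\<phi>..\<phi> + pi} \<subseteq> {angle r \<phi>..angle r (\<phi> + pi)}"
      using angle_mono by auto
    show "g integrable_on {angle r \<phi>..angle r (\<phi> + pi)}"
      using intg unfolding A_def[symmetric] Api .
  qed (auto intro: angle_has_derivative angle_strict_mono continuous_on_angle continuous_on_id)
  then have sub: "((\<lambda>x. (1 / (radius r x)\<^sup>2) *\<^sub>R g (angle r x)) has_integral J_kernel q f (A + t)) {\<phi>..\<phi> + pi}"
    unfolding A_def[symmetric] Api Ig .
  have eq: "of_real (radius r \<phi>) powr of_real q * ((1 / (radius r x)\<^sup>2) *\<^sub>R g (angle r x))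
     = twist (of_real (2 * l - 1)) r t f x * of_real (sin (x - \<phi>)) powr of_real q" if x: "x \<in> {\<phi>..\<phi> + pi}" for x
  proof -
    define S where "S = sin (angle r x - A)"
    define R R0 where "R = radius r x" and "R0 = radius r \<phi>"
    have R: "0 < R" "0 < R0" by (simp_all add: R_def R0_def radius_pos)
    have sn: "sin (x - \<phi>) = R * R0 * S" by (simp add: S_def R_def R0_def A_def sin_diff_angle[of x \<phi> r])
    have "0 \<le> sin (x - \<phi>)" using x by (intro sin_ge_zero) auto
    moreover have "R * R0 * S < 0" if "S < 0" using R that by (intro mult_pos_neg) simp_all
    \<comment> \<open>Nonnegativity of the sine at the angles lets real powers be multiplied out
      factor by factor.\<close>
    ultimately have S: "0 \<le> S" unfolding sn by linarith
    have "R powr (2 * l - 1) * (R * R0 * S) powr q = R0 powr q * (1 / R\<^sup>2 * S powr q)"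
    proof -
      have "R powr (2 * l - 1) * R powr q = R powr (- 2)" by (simp add: q_def flip: powr_add)
      also have "R powr (- 2) = 1 / R\<^sup>2" using R by (simp add: powr_minus_divide)
      finally have 1: "R powr (2 * l - 1) * R powr q = 1 / R\<^sup>2" .
      have "(R * R0 * S) powr q = R powr q * R0 powr q * S powr q" using R S by (simp add: powr_mult)
      then have "R powr (2 * l - 1) * (R * R0 * S) powr q = (R powr (2 * l - 1) * R powr q) * (R0 powr q * S powr q)"
        by (simp only: mult_ac)
      then show ?thesis unfolding 1 by simp
    qed
    then have "complex_of_real (R powr (2 * l - 1) * (R * R0 * S) powr q) = of_real (R0 powr q * (1 / R\<^sup>2 * S powr q))" by simp
    then have "of_real R powr of_real (2 * l - 1) * of_real (R * R0 * S) powr complex_of_real q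
      = of_real R0 powr of_real q * (of_real (1 / R\<^sup>2) * complex_of_real S powr of_real q)"
      using R S by (simp only: of_real_mult powr_of_real[symmetric] mult_nonneg_nonneg less_imp_le)
    then show ?thesis
      unfolding twist_def g_def sn S_def[symmetric] R_def[symmetric] R0_def[symmetric] scaleR_conv_of_real
      by (simp add: mult_ac)
  qed
  have "((\<lambda>x. twist (of_real (2 * l - 1)) r t f x * of_real (sin (x - \<phi>)) powr of_real q) has_integral
      of_real (radius r \<phi>) powr of_real q * J_kernel q f (A + t)) {\<phi>..\<phi> + pi}"
    by (rule has_integral_eq[OF _ has_integral_mult_right[OF sub]]) (rule eq)
  then show ?thesis
    unfolding J_kernel_def[of _ "twist _ _ _ _"] q_def[symmetric] A_def[symmetric] by (rule integral_unique)
qed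

theorem J_real_twist:
  assumes f: "f \<in> C2pi" and l: "-1/2 < l" "l < 0"
  shows "J_real l (twist (of_real (2 * l - 1)) r t f) = twist (of_real (2 * (- l) - 1)) r t (J_real l f)"
proof
  fix \<phi>
  have e: "2 * (- l) - 1 = - 1 - 2 * l" by simp
  show "J_real l (twist (of_real (2 * l - 1)) r t f) \<phi> = twist (of_real (2 * (- l) - 1)) r t (J_real l f) \<phi>"
    unfolding J_real_kernel(1)[OF twist_C2pi[OF f] l] J_kernel_twist[OF f l] twist_def[of _ _ _ "J_real l f"] J_real_kernel(1)[OF f l] e
    by (simp only: mult_ac)
qed

text \<open>Division by \<open>J_scale\<close> makes the coefficients of the form equal to
  \<open>weight\<close>, with value 1 at frequency 0, and keeps the Gamma factors out of all
  estimates.\<close>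

definition cs_form :: "real \<Rightarrow> (real \<Rightarrow> complex) \<Rightarrow> (real \<Rightarrow> complex) \<Rightarrow> complex" where
  "cs_form l f g = l2_ip (J_real l f) g / of_real (J_scale l)"

lemma cs_form_has_sum:
  assumes f: "f \<in> C2pi" and g: "g \<in> C2pi" and l: "\<bar>l\<bar> < 1 / 2"
  shows "((\<lambda>n. of_real (weight l n) * fcoeff f n * cnj (fcoeff g n)) has_sum cs_form l f g) UNIV"
proof -
  have s: "0 < J_scale l" using J_spectrum(2)[OF l even_zero] .
  have "((\<lambda>n. fcoeff (J_real l f) n * cnj (fcoeff g n)) has_sum l2_ip (J_real l f) g) UNIV"
    by (rule parseval[OF J_real_cper[OF f l] C2pi_cper[OF g]])
  from has_sum_cmult_right[OF this, of "1 / of_real (J_scale l)"] show ?thesis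
    using s by (simp add: cs_form_def fcoeff_J_real[OF f l] mult.assoc)
qed

lemma cs_form_self:
  assumes f: "f \<in> C2pi" and l: "\<bar>l\<bar> < 1 / 2"
  shows "((\<lambda>n. weight l n * (cmod (fcoeff f n))\<^sup>2) has_sum Re (cs_form l f f)) UNIV"
proof -
  have "((\<lambda>n. Re (of_real (weight l n) * fcoeff f n * cnj (fcoeff f n))) has_sum Re (cs_form l f f)) UNIV"
    by (rule has_sum_Re[OF cs_form_has_sum[OF f f l]])
  moreover have "Re (of_real (weight l n) * fcoeff f n * cnj (fcoeff f n)) = weight l n * (cmod (fcoeff f n))\<^sup>2" for n
    by (simp add: mult.assoc complex_norm_square[symmetric] flip: of_real_mult)
  ultimately show ?thesis by simp
qed

lemma cs_form_finite_le:
  assumes f: "f \<in> C2pi" and l: "\<bar>l\<bar> < 1 / 2" and F: "finite F"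
  shows "(\<Sum>n\<in>F. weight l n * (cmod (fcoeff f n))\<^sup>2) \<le> Re (cs_form l f f)"
  by (rule finite_sum_le_has_sum[OF cs_form_self[OF f l] F]) (auto simp: weight_pos[OF l] less_imp_le)

lemma cs_form_nonneg:
  assumes "f \<in> C2pi" "\<bar>l\<bar> < 1 / 2"
  shows "0 \<le> Re (cs_form l f f)"
  using cs_form_finite_le[OF assms, of "{}"] by simp

text \<open>The intertwining operator carries twists of degree \<open>2 l - 1\<close> to twists of
  degree \<open>- 2 l - 1\<close>, and these are dual for \<open>l2_ip\<close>.\<close>

lemma cs_form_twist_negative:
  assumes f: "f \<in> C2pi" and l: "-1/2 < l" "l < 0"
  shows "cs_form l (twist (of_real (2 * l - 1)) r t f) (twist (of_real (2 * l - 1)) r t f) = cs_form l f f"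
proof -
  have "\<bar>l\<bar> < 1 / 2" using l by simp
  then show ?thesis
    unfolding cs_form_def J_real_twist[OF f l]
    by (subst l2_twist_twist) (auto simp: J_real_cper f C2pi_cper)
qed

lemma weighted_cauchy_schwarz:
  fixes d :: "'a \<Rightarrow> real"
  assumes d: "\<And>n. 0 < d n" and s: "((\<lambda>n. x n * cnj (y n)) has_sum s) UNIV"
    and A: "\<And>F. finite F \<Longrightarrow> (\<Sum>n\<in>F. d n * (cmod (x n))\<^sup>2) \<le> A"
    and B: "\<And>F. finite F \<Longrightarrow> (\<Sum>n\<in>F. (cmod (y n))\<^sup>2 / d n) \<le> B"
  shows "(cmod s)\<^sup>2 \<le> A * B"
proof -
  have A0: "0 \<le> A" using A[of "{}"] by simp
  have fin: "(cmod (\<Sum>n\<in>F. x n * cnj (y n)))\<^sup>2 \<le> A * B" if F: "finite F" for F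
  proof -
    have "cmod (\<Sum>n\<in>F. x n * cnj (y n)) \<le> (\<Sum>n\<in>F. (sqrt (d n) * cmod (x n)) * (cmod (y n) / sqrt (d n)))"
    proof (rule sum_norm_le)
      fix n
      have "0 < sqrt (d n)" using d[of n] by simp
      then show "cmod (x n * cnj (y n)) \<le> (sqrt (d n) * cmod (x n)) * (cmod (y n) / sqrt (d n))"
        by (simp add: norm_mult)
    qed
    then have "(cmod (\<Sum>n\<in>F. x n * cnj (y n)))\<^sup>2 \<le> (\<Sum>n\<in>F. (sqrt (d n) * cmod (x n)) * (cmod (y n) / sqrt (d n)))\<^sup>2"
      by (rule power_mono) simp
    also have "\<dots> \<le> (\<Sum>n\<in>F. (sqrt (d n) * cmod (x n))\<^sup>2) * (\<Sum>n\<in>F. (cmod (y n) / sqrt (d n))\<^sup>2)"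
      by (rule Cauchy_Schwarz_ineq_sum)
    also have "\<dots> = (\<Sum>n\<in>F. d n * (cmod (x n))\<^sup>2) * (\<Sum>n\<in>F. (cmod (y n))\<^sup>2 / d n)"
      using less_imp_le[OF d] by (simp add: power_mult_distrib power_divide)
    also have "\<dots> \<le> A * B"
      by (intro mult_mono A B F A0 sum_nonneg) (simp add: less_imp_le[OF d])
    finally show ?thesis .
  qed
  have "((\<lambda>F. (cmod (\<Sum>n\<in>F. x n * cnj (y n)))\<^sup>2) \<longlongrightarrow> (cmod s)\<^sup>2) (finite_subsets_at_top UNIV)"
    using s unfolding has_sum_def by (intro tendsto_power tendsto_norm)
  then show ?thesis
    by (rule tendsto_upperbound) (auto intro!: eventually_finite_subsets_at_top_weakI fin)
qed

lemma C2pi_add: "f \<in> C2pi \<Longrightarrow> g \<in> C2pi \<Longrightarrow> (\<lambda>x. f x + g x) \<in> C2pi"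
proof -
  assume f: "f \<in> C2pi" and g: "g \<in> C2pi"
  obtain f' g' where C: "C2 f f' (second_deriv f)" "C2 g g' (second_deriv g)" using C2pi_E[OF f] C2pi_E[OF g] by metis
  then have "C2 (\<lambda>x. f x + g x) (\<lambda>x. f' x + g' x) (\<lambda>x. second_deriv f x + second_deriv g x)"
    unfolding C2_def by (intro conjI allI has_vector_derivative_add continuous_on_add) blast+
  then show ?thesis using C2pi_periodic[OF f] C2pi_periodic[OF g] unfolding C2pi_def by auto
qed

lemma C2pi_scale: "f \<in> C2pi \<Longrightarrow> (\<lambda>x. c * f x) \<in> C2pi"
proof -
  assume f: "f \<in> C2pi"
  obtain f' where C: "C2 f f' (second_deriv f)" using C2pi_E[OF f] by metis
  then have "C2 (\<lambda>x. c * f x) (\<lambda>x. c * f' x) (\<lambda>x. c * second_deriv f x)"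
    unfolding C2_def by (intro conjI allI has_vector_derivative_mult_right continuous_on_mult continuous_on_const) blast+
  then show ?thesis using C2pi_periodic[OF f] unfolding C2pi_def by auto
qed

lemma C2pi_zero: "(\<lambda>x. 0) \<in> C2pi"
proof -
  have "C2 (\<lambda>x. 0) (\<lambda>x. 0) (\<lambda>x. 0)" by (simp add: C2_def)
  then show ?thesis unfolding C2pi_def by auto
qed

lemma trig_sum_C2pi:
  assumes F: "finite F" and c: "\<And>n. odd n \<Longrightarrow> c n = 0"
  shows "trig_sum F c \<in> C2pi"
  using F
proof (induction F)
  case empty
  then show ?case using C2pi_zero by (simp add: trig_sum_def[abs_def])
next
  case (insert n F)
  have "(\<lambda>x. c n * char_fun n x) \<in> C2pi"
  proof (cases "even n")
    case True
    then show ?thesis by (intro C2pi_scale J_real_char_fun(1)[of 0]) simp_all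
  next
    case False
    then show ?thesis using c C2pi_zero by simp
  qed
  from C2pi_add[OF this insert.IH] show ?case using insert.hyps by (simp add: trig_sum_def[abs_def])
qed

lemma twist_shift: "twist w r t f = twist w r 0 (\<lambda>x. f (x + t))"
  by (simp add: twist_def[abs_def])

text \<open>
  The intertwining property is available for \<open>l < 0\<close> only; for \<open>l > 0\<close> the bound follows by duality,
  since the weights for \<open>l\<close> and \<open>-l\<close> are inverse to each other.
\<close>

theorem cs_form_twist_le:
  assumes f: "f \<in> C2pi" and l: "\<bar>l\<bar> < 1 / 2" "l \<noteq> 0" and F: "finite F"
  shows "(\<Sum>n\<in>F. weight l n * (cmod (fcoeff (twist (of_real (2 * l - 1)) r t f) n))\<^sup>2) \<le> Re (cs_form l f f)"
proof (cases "l < 0")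
  case True
  then have "- 1 / 2 < l" using l by simp
  from cs_form_finite_le[OF twist_C2pi[OF f, of "2 * l - 1" r t] l(1) F] show ?thesis
    unfolding cs_form_twist_negative[OF f \<open>- 1 / 2 < l\<close> True] .
next
  case False
  then have l': "- 1 / 2 < - l" "- l < 0" "\<bar>- l\<bar> < 1 / 2" using l by auto
  define h where "h = twist (of_real (2 * l - 1)) r t f"
  \<comment> \<open>Coefficients of a test function \<open>g\<close> whose pairing with
    \<open>h\<close> is the partial sum \<open>A\<close> itself and whose squared norm for the
    inverse weights is again \<open>A\<close>. Duality then gives
    \<open>A^2 \<le> Re (cs_form l f f) * A\<close>.\<close>
  define c where "c n = of_real (weight l n) * fcoeff h n" for n
  define g where "g = trig_sum F c"
  define ft where "ft = (\<lambda>x. f (x + t))"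
  define k where "k = twist (of_real (2 * (- l) - 1)) (- r) 0 g"
  define A where "A = (\<Sum>n\<in>F. weight l n * (cmod (fcoeff h n))\<^sup>2)"
  have h: "h \<in> C2pi" unfolding h_def by (rule twist_C2pi[OF f])
  have c0: "c n = 0" if "odd n" for n
    unfolding c_def using fcoeff_odd[OF C2pi_cper[OF h] C2pi_periodic[OF h] that] by simp
  have g: "g \<in> C2pi" unfolding g_def by (rule trig_sum_C2pi[OF F c0])
  have k: "k \<in> C2pi" unfolding k_def by (rule twist_C2pi[OF g])
  have ft: "ft \<in> cper" unfolding ft_def by (rule cper_shift[OF C2pi_cper[OF f]])
  have A0: "0 \<le> A" unfolding A_def by (intro sum_nonneg) (simp add: less_imp_le[OF weight_pos[OF l(1)]])
  have "l2_ip h g = (\<Sum>n\<in>F. fcoeff h n * cnj (c n))"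
    unfolding g_def by (rule l2_trig_sum_right[OF C2pi_cper[OF h]])
  also have "\<dots> = of_real A"
    by (simp add: A_def c_def complex_norm_square mult.left_commute del: of_real_power)
  finally have hg: "l2_ip h g = of_real A" .
  have "l2_ip h g = l2_ip ft k"
    unfolding h_def k_def twist_shift[of _ _ t f] ft_def[symmetric]
    by (rule l2_twist_adjoint[OF ft C2pi_cper[OF g]]) simp
  then have "((\<lambda>n. fcoeff ft n * cnj (fcoeff k n)) has_sum of_real A) UNIV"
    using parseval[OF ft C2pi_cper[OF k]] hg by simp
  then have "(cmod (of_real A))\<^sup>2 \<le> Re (cs_form l f f) * A"
  proof (rule weighted_cauchy_schwarz[OF weight_pos[OF l(1)]])
    fix S :: "int set" assume S: "finite S"
    have "(\<Sum>n\<in>S. weight l n * (cmod (fcoeff ft n))\<^sup>2) = (\<Sum>n\<in>S. weight l n * (cmod (fcoeff f n))\<^sup>2)"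
      by (simp add: ft_def fcoeff_shift[OF C2pi_cper[OF f]] norm_mult)
    then show "(\<Sum>n\<in>S. weight l n * (cmod (fcoeff ft n))\<^sup>2) \<le> Re (cs_form l f f)"
      using cs_form_finite_le[OF f l(1) S] by simp
    have inv: "1 / weight l n = weight (- l) n" for n
      using weight_minus[OF l(1), of n] weight_pos[OF l(1), of n] by (simp add: field_simps)
    have "(\<Sum>n\<in>S. (cmod (fcoeff k n))\<^sup>2 / weight l n) = (\<Sum>n\<in>S. weight (- l) n * (cmod (fcoeff k n))\<^sup>2)"
      by (simp add: inv[symmetric])
    also have "\<dots> \<le> Re (cs_form (- l) k k)" by (rule cs_form_finite_le[OF k l'(3) S])
    \<comment> \<open>The parameter \<open>- l\<close> is negative, so the isometry is available on
      this side of the duality.\<close>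
    also have "cs_form (- l) k k = cs_form (- l) g g"
      unfolding k_def by (rule cs_form_twist_negative[OF g l'(1,2)])
    also have "Re (cs_form (- l) g g) = A"
    proof (rule has_sum_unique[OF cs_form_self[OF g l'(3)]])
      have "((\<lambda>n. weight (- l) n * (cmod (fcoeff g n))\<^sup>2) has_sum (\<Sum>n\<in>F. weight (- l) n * (cmod (fcoeff g n))\<^sup>2)) UNIV"
        by (rule has_sum_finite_neutralI[OF F]) (auto simp: g_def fcoeff_trig_sum[OF F])
      also have "(\<Sum>n\<in>F. weight (- l) n * (cmod (fcoeff g n))\<^sup>2) = A"
        unfolding A_def
      proof (rule sum.cong[OF refl])
        fix n assume "n \<in> F"
        then have "cmod (fcoeff g n) = weight l n * cmod (fcoeff h n)"
          using weight_pos[OF l(1), of n] by (simp add: g_def fcoeff_trig_sum[OF F] c_def norm_mult)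
        then have "weight (- l) n * (cmod (fcoeff g n))\<^sup>2 = (weight (- l) n * weight l n) * (weight l n * (cmod (fcoeff h n))\<^sup>2)"
          by (simp add: power2_eq_square)
        then show "weight (- l) n * (cmod (fcoeff g n))\<^sup>2 = weight l n * (cmod (fcoeff h n))\<^sup>2"
          by (simp add: weight_minus[OF l(1)])
      qed
      finally show "((\<lambda>n. weight (- l) n * (cmod (fcoeff g n))\<^sup>2) has_sum A) UNIV" .
    qed
    finally show "(\<Sum>n\<in>S. (cmod (fcoeff k n))\<^sup>2 / weight l n) \<le> A" .
  qed
  then have "A * A \<le> Re (cs_form l f f) * A" by (simp add: power2_eq_square)
  then have "A \<le> Re (cs_form l f f)"
    using A0 cs_form_nonneg[OF f l(1)] by (cases "A = 0") auto
  then show ?thesis by (simp add: A_def h_def)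
qed

section \<open>Matrix coefficients of the complementary series\<close>

text \<open>Up to \<pi>/3 the derivative cos x - 1/2 is nonnegative; beyond it sin x is at least
  sqrt 3 / 2 \<ge> 0.85, which exceeds \<pi>/4.\<close>

lemma sin_ge_half:
  assumes "0 \<le> x" "x \<le> pi / 2"
  shows "x / 2 \<le> sin x"
proof (cases "x \<le> pi / 3")
  case True
  have "sin 0 - 0 / 2 \<le> sin x - x / 2"
  proof (rule DERIV_nonneg_imp_nondecreasing[OF assms(1)])
    fix u assume u: "0 \<le> u" "u \<le> x"
    have "cos (pi / 3) \<le> cos u" using u True pi_gt_zero by (intro cos_monotone_0_pi_le) auto
    then have "0 \<le> cos u - 1 / 2" by (simp add: cos_60)
    moreover have "((\<lambda>x. sin x - x / 2) has_real_derivative cos u - 1 / 2) (at u)"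
      by (auto intro!: derivative_eq_intros)
    ultimately show "\<exists>y. ((\<lambda>x. sin x - x / 2) has_real_derivative y) (at u) \<and> 0 \<le> y" by blast
  qed
  then show ?thesis by simp
next
  case False
  have "sin (pi / 3) \<le> sin x" using False assms pi_gt_zero by (intro sin_monotone_2pi_le) auto
  moreover have "1.7 \<le> sqrt (3 :: real)" by (rule real_le_rsqrt) (simp add: power2_eq_square)
  ultimately show ?thesis using assms pi_approx by (simp add: sin_60)
qed

text \<open>The radius is at least \<open>exp r * sin x \<ge> exp r * x / 2\<close>, and the
  exponent \<open>2 l - 1\<close> lies in (-1, 0), so the power of \<open>x / 2\<close> is
  integrable at 0. Its integral \<open>(\<pi>/4)^(2 l) / l\<close> is the source of the factor
  \<open>1 / \<bar>l\<bar>\<close>.\<close>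

lemma radius_powr_integral_quarter:
  assumes l: "0 < l" "l < 1 / 2"
  shows "integral {0..pi / 2} (\<lambda>x. radius r x powr (2 * l - 1)) \<le> exp (- ((1 - 2 * l) * r)) / l"
proof -
  define w where "w = 2 * l - 1"
  define F where "F x = radius r x powr w" for x
  define H where "H x = exp (w * r) * (x / 2) powr w" for x
  \<comment> \<open>As \<open>0 powr w\<close> is 0, \<open>H\<close> does not dominate
    \<open>F\<close> at the point 0; changing the value there leaves the integral alone.\<close>
  define H' where "H' x = (if x = 0 then F 0 else H x)" for x
  have cF: "continuous_on S F" for S
    unfolding F_def using radius_pos by (intro continuous_on_powr continuous_intros) (auto simp: less_imp_neq[symmetric])
  have "(H has_integral (exp (w * r) * (2 * ((pi / 2) / 2) powr (w + 1) / (w + 1)) - exp (w * r) * (2 * (0 / 2) powr (w + 1) / (w + 1)))) {0..pi / 2}"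
  proof (rule fundamental_theorem_of_calculus_interior)
    show "continuous_on {0..pi / 2} (\<lambda>x. exp (w * r) * (2 * (x / 2) powr (w + 1) / (w + 1)))"
      using l by (intro continuous_intros continuous_on_powr') (auto simp: w_def)
    fix x assume x: "x \<in> {0<..<pi / 2}"
    have "((\<lambda>x. (x / 2) powr (w + 1)) has_real_derivative (w + 1) * (x / 2) powr (w + 1 - 1) * (1 / 2)) (at x)"
    proof -
      have "((\<lambda>x. x / 2) has_real_derivative 1 / 2) (at x)" by (auto intro!: derivative_eq_intros)
      from DERIV_fun_powr[OF this, of "w + 1"] show ?thesis using x by simp
    qed
    then have "((\<lambda>x. exp (w * r) * (2 * (x / 2) powr (w + 1) / (w + 1))) has_real_derivative
       exp (w * r) * (2 * ((w + 1) * (x / 2) powr (w + 1 - 1) * (1 / 2)) / (w + 1))) (at x)"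
      by (intro DERIV_cmult DERIV_cdivide)
    moreover have "exp (w * r) * (2 * ((w + 1) * (x / 2) powr (w + 1 - 1) * (1 / 2)) / (w + 1)) = H x"
      using l by (simp add: H_def w_def)
    ultimately show "((\<lambda>x. exp (w * r) * (2 * (x / 2) powr (w + 1) / (w + 1))) has_vector_derivative H x) (at x)"
      by (simp add: has_real_derivative_iff_has_vector_derivative)
  qed simp
  then have "(H has_integral (exp (w * r) * ((pi / 4) powr (2 * l) / l))) {0..pi / 2}"
    using l by (simp add: w_def)
  then have H': "(H' has_integral (exp (w * r) * ((pi / 4) powr (2 * l) / l))) {0..pi / 2}"
    by (rule has_integral_spike_finite[of "{0}", rotated 2]) (auto simp: H'_def)
  have "F x \<le> H' x" if x: "x \<in> {0..pi / 2}" for x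
  proof (cases "x = 0")
    case False
    then have x0: "0 < x" using x by simp
    have "exp r * (x / 2) \<le> exp r * \<bar>sin x\<bar>"
      using sin_ge_half[of x] x by (intro mult_left_mono) auto
    then have "exp r * (x / 2) \<le> radius r x" using radius_ge_sin[of r x] by linarith
    then have "F x \<le> (exp r * (x / 2)) powr w"
      unfolding F_def using l x0 by (intro powr_mono2') (auto simp: w_def)
    also have "\<dots> = exp r powr w * (x / 2) powr w"
      by (rule powr_mult)
    also have "\<dots> = H x" by (simp add: H_def powr_def[of "exp r"])
    finally show ?thesis using False by (simp add: H'_def)
  qed (simp add: H'_def)
  then have "integral {0..pi / 2} F \<le> exp (w * r) * ((pi / 4) powr (2 * l) / l)"
    by (intro has_integral_le[OF integrable_integral[OF integrable_continuous_interval[OF cF]] H'])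
  also have "\<dots> \<le> exp (w * r) * (1 / l)"
    using l pi_less_4 by (intro mult_left_mono divide_right_mono powr_le1) auto
  also have "\<dots> = exp (- ((1 - 2 * l) * r)) / l" by (simp add: w_def algebra_simps)
  finally show ?thesis by (simp add: F_def[abs_def] w_def)
qed

lemma radius_powr_cper: "(\<lambda>x. complex_of_real (radius r x powr w)) \<in> cper"
proof -
  have "continuous_on UNIV (\<lambda>x. radius r x powr w)"
    by (intro continuous_on_powr continuous_intros) simp
  then show ?thesis by (auto simp: cper_def radius_plus_2pi intro!: continuous_on_of_real)
qed

lemma radius_powr_integrable: "(\<lambda>x. radius r x powr w) integrable_on {a..b}"
proof (rule integrable_continuous_interval)
  show "continuous_on {a..b} (\<lambda>x. radius r x powr w)"
    by (intro continuous_on_powr continuous_intros) simp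
qed

lemma of_real_radius_powr_integral:
  "integral {a..b} (\<lambda>x. complex_of_real (radius r x powr w)) = of_real (integral {a..b} (\<lambda>x. radius r x powr w))"
  by (intro integral_unique has_integral_of_real integrable_integral radius_powr_integrable)

lemma radius_powr_integral_full:
  "integral {-pi..pi} (\<lambda>x. radius r x powr w) = 4 * integral {0..pi / 2} (\<lambda>x. radius r x powr w)"
proof -
  define F where "F x = radius r x powr w" for x
  have i: "F integrable_on {a..b}" for a b unfolding F_def[abs_def] by (rule radius_powr_integrable)
  have c: "continuous_on S F" for S
    unfolding F_def[abs_def] by (intro continuous_on_powr continuous_intros) simp
  have even: "F (- x) = F x" for x by (simp add: F_def radius_minus)
  have refl: "integral {-b..-a} F = integral {a..b} F" for a b
    using Henstock_Kurzweil_Integration.integral_reflect_real[of b a F] by (simp add: even)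
  have "integral {- (pi / 2)..0} (F \<circ> (\<lambda>x. x + pi)) = integral {- (pi / 2) + pi..0 + pi} F"
    by (rule integral_shift[OF c])
  then have sh: "integral {pi / 2..pi} F = integral {- (pi / 2)..0} F"
    by (simp add: o_def F_def[abs_def] radius_plus_pi)
  have 1: "integral {-pi..pi} F = integral {-pi..0} F + integral {0..pi} F"
    by (rule Henstock_Kurzweil_Integration.integral_combine[symmetric, OF _ _ i]) simp_all
  have 2: "integral {0..pi} F = integral {0..pi / 2} F + integral {pi / 2..pi} F"
    by (rule Henstock_Kurzweil_Integration.integral_combine[symmetric, OF _ _ i]) simp_all
  show ?thesis
    using 1 2 sh refl[of pi 0] refl[of "pi / 2" 0] by (simp add: F_def[abs_def])
qed

text \<open>A quarter turn exchanges the two eigenvalues of \<open>a\<^sub>r\<close>; so integrals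
  of powers of the radius over the circle are even in \<open>r\<close>.\<close>

lemma radius_minus_r: "radius (- r) x = radius r (x + pi / 2)"
  by (simp add: radius_def sin_add cos_add add.commute)

lemma radius_powr_integral_minus:
  "integral {-pi..pi} (\<lambda>x. radius (- r) x powr w) = integral {-pi..pi} (\<lambda>x. radius r x powr w)"
proof -
  have "complex_of_real (integral {-pi..pi} (\<lambda>x. radius (- r) x powr w)) = of_real (integral {-pi..pi} (\<lambda>x. radius r x powr w))"
    using integral_periodic_shift[OF radius_powr_cper[of r w], of "pi / 2"]
    unfolding of_real_radius_powr_integral[symmetric] unfolding radius_minus_r by simp
  then show ?thesis by (simp only: of_real_eq_iff)
qed

lemma mcoeff_le: "cmod (mcoeff (of_real w) r n m) \<le> integral {-pi..pi} (\<lambda>x. radius r x powr w) / (2 * pi)"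
proof -
  have le: "cmod (integral {-pi..pi} (\<lambda>x. twist (of_real w) r 0 (char_fun m) x * cnj (char_fun n x))) \<le> integral {-pi..pi} (\<lambda>x. radius r x powr w)"
  proof (rule integral_norm_bound_integral[OF _ radius_powr_integrable])
    show "(\<lambda>x. twist (of_real w) r 0 (char_fun m) x * cnj (char_fun n x)) integrable_on {-pi..pi}"
      by (intro integrable_continuous_interval cper_continuous cper_mult cper_cnj twist_cper char_fun_cper)
    show "cmod (twist (of_real w) r 0 (char_fun m) x * cnj (char_fun n x)) \<le> radius r x powr w" for x
      by (simp add: twist_def norm_mult norm_radius_powr)
  qed
  have "cmod (complex_of_real (2 * pi)) = 2 * pi" by (simp only: norm_of_real) simp
  then show ?thesis
    unfolding mcoeff_def fcoeff_def l2_ip_def norm_divide using divide_right_mono[OF le, of "2 * pi"] by simp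
qed

text \<open>For \<open>l > 0\<close> absolute values suffice, the four quarters being compensated by
  1 / (2 \<pi>). For \<open>l < 0\<close>, passing to the adjoint changes \<open>l\<close> to
  \<open>- l\<close> and \<open>r\<close> to \<open>- r\<close>, and the integral of absolute values
  is even in \<open>r\<close>.\<close>

lemma mcoeff_complementary_bound:
  assumes l: "\<bar>l\<bar> < 1 / 2" "l \<noteq> 0"
  shows "cmod (mcoeff (of_real (2 * l - 1)) r n m) \<le> exp (- ((1 - 2 * \<bar>l\<bar>) * r)) / \<bar>l\<bar>"
proof -
  have pos: "integral {-pi..pi} (\<lambda>x. radius r x powr (2 * k - 1)) / (2 * pi) \<le> exp (- ((1 - 2 * k) * r)) / k"
    if k: "0 < k" "k < 1 / 2" for k
  proof -
    have "integral {-pi..pi} (\<lambda>x. radius r x powr (2 * k - 1)) / (2 * pi) \<le> 4 * (exp (- ((1 - 2 * k) * r)) / k) / 4"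
      unfolding radius_powr_integral_full using pi_ge_two k radius_powr_integral_quarter[OF k, of r]
      by (intro frac_le mult_left_mono) auto
    then show ?thesis by simp
  qed
  show ?thesis
  proof (cases "0 < l")
    case True
    then show ?thesis using order_trans[OF mcoeff_le pos[of l]] l by simp
  next
    case False
    then have k: "0 < - l" "- l < 1 / 2" using l by auto
    have "mcoeff (of_real (2 * l - 1)) r n m = l2_ip (char_fun m) (twist (of_real (2 * (- l) - 1)) (- r) 0 (char_fun n))"
      unfolding mcoeff_def fcoeff_def by (rule l2_twist_adjoint[OF char_fun_cper char_fun_cper]) simp
    also have "\<dots> = cnj (mcoeff (of_real (2 * (- l) - 1)) (- r) m n)"
      unfolding mcoeff_def fcoeff_def by (rule L2.ip_cnj[OF twist_cper[OF char_fun_cper] char_fun_cper])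
    finally have "cmod (mcoeff (of_real (2 * l - 1)) r n m) = cmod (mcoeff (of_real (2 * (- l) - 1)) (- r) m n)" by simp
    also have "\<dots> \<le> exp (- ((1 - 2 * (- l)) * r)) / (- l)"
      by (rule order_trans[OF mcoeff_le]) (subst radius_powr_integral_minus, rule pos[OF k])
    finally show ?thesis using False by simp
  qed
qed

text \<open>For negative parameter, the \<open>n\<close>-th coefficient of \<open>J_real\<close> of
  the twisted character \<open>m\<close> is computed in two ways: diagonalising after the twist, or
  moving the operator through the twist first. For \<open>l > 0\<close> the relation for
  \<open>- l\<close> is multiplied by the weights for \<open>l\<close>.\<close>

lemma mcoeff_intertwine:
  assumes l: "\<bar>l\<bar> < 1 / 2" "l \<noteq> 0" and nm: "even n" "even m"
  shows "of_real (weight l n) * mcoeff (of_real (2 * l - 1)) r n m = of_real (weight l m) * mcoeff (of_real (2 * (- l) - 1)) r n m"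
proof -
  have neg: "of_real (weight k n) * mcoeff (of_real (2 * k - 1)) r n m = of_real (weight k m) * mcoeff (of_real (2 * (- k) - 1)) r n m"
    if k: "- 1 / 2 < k" "k < 0" for k
  proof -
    have k': "\<bar>k\<bar> < 1 / 2" using k by simp
    have e: "char_fun m \<in> C2pi" by (rule J_real_char_fun(1)[OF k' nm(2)])
    have "fcoeff (J_real k (twist (of_real (2 * k - 1)) r 0 (char_fun m))) n = of_real (J_scale k * weight k n) * mcoeff (of_real (2 * k - 1)) r n m"
      unfolding mcoeff_def by (rule fcoeff_J_real[OF twist_C2pi[OF e] k'])
    moreover have "J_real k (twist (of_real (2 * k - 1)) r 0 (char_fun m))
      = (\<lambda>x. of_real (J_scale k * weight k m) * twist (of_real (2 * (- k) - 1)) r 0 (char_fun m) x)"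
      unfolding J_real_twist[OF e k]
      by (rule ext) (simp only: twist_def J_real_char_fun(2)[OF k' nm(2)] mult.left_commute)
    then have "fcoeff (J_real k (twist (of_real (2 * k - 1)) r 0 (char_fun m))) n = of_real (J_scale k * weight k m) * mcoeff (of_real (2 * (- k) - 1)) r n m"
      unfolding mcoeff_def fcoeff_def by (simp only: L2.ip_scale_left[OF twist_cper[OF char_fun_cper] char_fun_cper])
    ultimately show ?thesis using J_spectrum(2)[OF k' even_zero] by simp
  qed
  show ?thesis
  proof (cases "l < 0")
    case True
    then show ?thesis using l by (intro neg) auto
  next
    case False
    define a b where "a = complex_of_real (weight l n)" and "b = complex_of_real (weight l m)"
    define a' b' where "a' = complex_of_real (weight (- l) n)" and "b' = complex_of_real (weight (- l) m)"
    have ab: "a' * a = 1" "b' * b = 1"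
      unfolding a_def b_def a'_def b'_def using weight_minus[OF l(1)] by (simp_all flip: of_real_mult)
    have "a' * mcoeff (of_real (2 * (- l) - 1)) r n m = b' * mcoeff (of_real (2 * l - 1)) r n m"
      using neg[of "- l"] False l by (simp add: a'_def b'_def)
    then have "a * mcoeff (of_real (2 * l - 1)) r n m = b * mcoeff (of_real (2 * (- l) - 1)) r n m"
      using ab by algebra
    then show ?thesis by (simp add: a_def b_def)
  qed
qed

text \<open>From \<open>a x = b y\<close> follows \<open>a x^2 = b x y \<le> b K^2\<close>: the
  bounds for \<open>l\<close> and \<open>- l\<close> are used once each, and no estimate of the
  weights enters.\<close>

lemma weighted_mcoeff_bound:
  assumes l: "\<bar>l\<bar> < 1 / 2" "l \<noteq> 0" and nm: "even n" "even m"
  shows "weight l n * (cmod (mcoeff (of_real (2 * l - 1)) r n m))\<^sup>2 \<le> (exp (- ((1 - 2 * \<bar>l\<bar>) * r)) / \<bar>l\<bar>)\<^sup>2 * weight l m"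
proof -
  define K x y where "K = exp (- ((1 - 2 * \<bar>l\<bar>) * r)) / \<bar>l\<bar>"
    and "x = cmod (mcoeff (of_real (2 * l - 1)) r n m)" and "y = cmod (mcoeff (of_real (2 * (- l) - 1)) r n m)"
  define a b where "a = weight l n" and "b = weight l m"
  have ab: "0 < a" "0 < b" by (simp_all add: a_def b_def weight_pos[OF l(1)])
  have K: "0 \<le> x" "0 \<le> y" "x \<le> K" "y \<le> K"
    using mcoeff_complementary_bound[OF l] mcoeff_complementary_bound[of "- l"] l
    by (simp_all add: x_def y_def K_def del: mult_minus_right)
  have "a * x = b * y"
    using arg_cong[OF mcoeff_intertwine[OF l nm, of r], of cmod] ab
    by (simp only: norm_mult norm_of_real a_def b_def x_def y_def abs_of_pos)
  have "a * x\<^sup>2 = (b * y) * x" unfolding \<open>a * x = b * y\<close>[symmetric] by (simp add: power2_eq_square)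
  also have "\<dots> = b * (y * x)" by simp
  also have "\<dots> \<le> b * (K * K)" using K ab by (intro mult_left_mono mult_mono) auto
  finally show ?thesis by (simp add: a_def b_def x_def K_def power2_eq_square mult.commute)
qed

lemma C2pi_shift: "f \<in> C2pi \<Longrightarrow> (\<lambda>x. f (x + a)) \<in> C2pi"
proof -
  assume f: "f \<in> C2pi"
  obtain f' where C: "C2 f f' (second_deriv f)" using C2pi_E[OF f] by metis
  have "f (x + pi + a) = f (x + a)" for x using C2pi_periodic[OF f, of "x + a"] by (simp only: add_ac)
  then show ?thesis using C2_shift[OF C, of a] unfolding C2pi_def by blast
qed

text \<open>The operator \<open>k\<^sub>\<theta> a\<^sub>r k\<^sub>t\<close> in the circle model, for the pair \<open>p = (\<theta>, t)\<close>.\<close>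

definition circle_op :: "complex \<Rightarrow> real \<Rightarrow> real \<times> real \<Rightarrow> (real \<Rightarrow> complex) \<Rightarrow> real \<Rightarrow> complex" where
  "circle_op w r p f x = twist w r (snd p) f (x + fst p)"

lemma circle_op_cper: "f \<in> cper \<Longrightarrow> circle_op w r p f \<in> cper"
  unfolding circle_op_def[abs_def] by (intro cper_shift twist_cper)

lemma circle_op_C2pi: "f \<in> C2pi \<Longrightarrow> circle_op (of_real w) r p f \<in> C2pi"
  unfolding circle_op_def[abs_def] by (intro C2pi_shift twist_C2pi)

lemma fcoeff_circle_op: "f \<in> cper \<Longrightarrow> fcoeff (circle_op w r p f) n = char_fun n (fst p) * fcoeff (twist w r (snd p) f) n"
  unfolding circle_op_def[abs_def] by (intro fcoeff_shift twist_cper)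

lemma cs_form_circle_op_le:
  assumes f: "f \<in> C2pi" and l: "\<bar>l\<bar> < 1 / 2" "l \<noteq> 0"
  shows "Re (cs_form l (circle_op (of_real (2 * l - 1)) r p f) (circle_op (of_real (2 * l - 1)) r p f)) \<le> Re (cs_form l f f)"
proof (rule has_sum_le_finite_sums[OF cs_form_self[OF circle_op_C2pi[OF f] l(1)]])
  fix F :: "int set" assume "finite F"
  from cs_form_twist_le[OF f l this, of r "snd p"]
  show "(\<Sum>n\<in>F. weight l n * (cmod (fcoeff (circle_op (of_real (2 * l - 1)) r p f) n))\<^sup>2) \<le> Re (cs_form l f f)"
    by (simp add: fcoeff_circle_op[OF C2pi_cper[OF f]] norm_mult)
qed

theorem cs_circle_bound:
  assumes f: "f \<in> C2pi" and g: "g \<in> C2pi" and l: "\<bar>l\<bar> < 1 / 2" "l \<noteq> 0"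
  shows "(\<lambda>p. cs_form l (circle_op (of_real (2 * l - 1)) r p f) g) \<in> borel_measurable borel" (is ?A)
    and "(LINT p:({-pi..pi} \<times> {-pi..pi})|lborel. (cmod (cs_form l (circle_op (of_real (2 * l - 1)) r p f) g))\<^sup>2)
      \<le> (2 * pi * (exp (- ((1 - 2 * \<bar>l\<bar>) * r)) / \<bar>l\<bar>))\<^sup>2 * Re (cs_form l f f) * Re (cs_form l g g)" (is ?B)
proof -
  have fc: "f \<in> cper" by (rule C2pi_cper[OF f])
  \<comment> \<open>A nonzero coefficient forces an even frequency, and
    \<open>weighted_mcoeff_bound\<close> covers just those; hence the nonvanishing conditions in
    \<open>double_fourier_series_bound\<close>.\<close>
  have odd: "even n" if "fcoeff h n \<noteq> 0" "h \<in> C2pi" for h n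
    using fcoeff_odd[OF C2pi_cper[OF that(2)] C2pi_periodic[OF that(2)]] that(1) by blast
  have hs: "((\<lambda>n. of_real (weight l n) * char_fun n x * fcoeff (twist (of_real (2 * l - 1)) r y f) n * cnj (fcoeff g n))
      has_sum cs_form l (circle_op (of_real (2 * l - 1)) r (x, y) f) g) UNIV" for x y
    using cs_form_has_sum[OF circle_op_C2pi[OF f, of "2 * l - 1" r "(x, y)"] g l(1)] by (simp add: fcoeff_circle_op[OF fc] mult.assoc)
  note D = double_fourier_series_bound[of "weight l", OF weight_pos[OF l(1)] cs_form_self[OF f l(1)] cs_form_self[OF g l(1)]
      fcoeff_twist_cper[OF fc] fcoeff_fcoeff_twist[OF fc] cs_form_twist_le[OF f l]
      weighted_mcoeff_bound[OF l odd[OF _ g] odd[OF _ f]] hs]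
  show ?A ?B using D by auto
qed

lemma l2_circle_op:
  assumes f: "f \<in> cper" and w: "w + cnj w = - 2"
  shows "l2_ip (circle_op w r p f) (circle_op w r p f) = l2_ip f f"
proof -
  have "l2_ip (circle_op w r p f) (circle_op w r p f) = l2_ip (twist w r (snd p) f) (twist w r (snd p) f)"
    unfolding l2_ip_def circle_op_def
    using integral_periodic_shift[of "\<lambda>x. twist w r (snd p) f x * cnj (twist w r (snd p) f x)" "fst p"]
    by (simp add: cper_mult cper_cnj twist_cper f)
  then show ?thesis by (simp add: l2_twist_twist[OF f f w])
qed

lemma parseval_Re:
  assumes f: "f \<in> cper"
  shows "((\<lambda>n. 1 * (cmod (fcoeff f n))\<^sup>2) has_sum Re (l2_ip f f)) UNIV"
  using parseval_norm[OF f] l2_self[OF f] by simp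

text \<open>The double series estimate with all weights equal to 1; unitarity of the twist bounds
  the partial sums.\<close>

theorem ps_circle_bound:
  assumes f: "f \<in> cper" and g: "g \<in> cper" and r: "0 < r" and s: "s \<noteq> 0"
  shows "(\<lambda>p. l2_ip (circle_op (\<i> * of_real s - 1) r p f) g) \<in> borel_measurable borel" (is ?A)
    and "(LINT p:({-pi..pi} \<times> {-pi..pi})|lborel. (cmod (l2_ip (circle_op (\<i> * of_real s - 1) r p f) g))\<^sup>2)
      \<le> (2 * pi * (160 * ((\<bar>s\<bar> + 1) / \<bar>s\<bar>) * exp (- r)))\<^sup>2 * Re (l2_ip f f) * Re (l2_ip g g)" (is ?B)
proof -
  define w where "w = \<i> * of_real s - 1"
  have w: "w + cnj w = - 2" by (simp add: w_def complex_eq_iff)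
  have hs: "((\<lambda>n. of_real 1 * char_fun n x * fcoeff (twist w r y f) n * cnj (fcoeff g n))
      has_sum l2_ip (circle_op w r (x, y) f) g) UNIV" for x y
    using parseval[OF circle_op_cper[OF f, of w r "(x, y)"] g] by (simp add: fcoeff_circle_op[OF f] mult.assoc)
  have fin: "(\<Sum>n\<in>F. 1 * (cmod (fcoeff (twist w r y f) n))\<^sup>2) \<le> Re (l2_ip f f)" if "finite F" for F y
    using finite_sum_le_has_sum[OF parseval_Re[OF twist_cper[OF f, of w r y]] that] l2_twist_twist[OF f f w, of r y] by simp
  have \<Phi>: "1 * (cmod (mcoeff w r n m))\<^sup>2 \<le> (160 * ((\<bar>s\<bar> + 1) / \<bar>s\<bar>) * exp (- r))\<^sup>2 * 1" for n m
    using mcoeff_principal_bound[OF r s, of n m] by (simp add: w_def power_mono)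
  note D = double_fourier_series_bound[of "\<lambda>n. 1", OF zero_less_one parseval_Re[OF f] parseval_Re[OF g]
      fcoeff_twist_cper[OF f] fcoeff_fcoeff_twist[OF f] fin \<Phi> hs]
  show ?A ?B using D by (auto simp: w_def)
qed

section \<open>From the plane to the circle\<close>

lemma times_differentiable_on_cong:
  assumes S: "open S" and f: "times_differentiable_on n f S" and eq: "\<And>x. x \<in> S \<Longrightarrow> f x = g x"
  shows "times_differentiable_on n g S"
  using f eq
proof (induction n arbitrary: f g)
  case 0
  then show ?case using continuous_on_cong[OF refl, of S f g] by simp
next
  case (Suc n)
  have d: "(g has_derivative frechet_derivative f (at x)) (at x)" if "x \<in> S" for x
    using has_derivative_transform_within_open[OF _ S that, of f "frechet_derivative f (at x)" UNIV g] Suc.prems that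
    by (simp add: frechet_derivative_works)
  then have "g differentiable (at x)" if "x \<in> S" for x using that by (auto simp: differentiable_def)
  moreover have "times_differentiable_on n (\<lambda>x. frechet_derivative g (at x) h) S" for h
  proof (rule Suc.IH)
    show "times_differentiable_on n (\<lambda>x. frechet_derivative f (at x) h) S" using Suc.prems by simp
    show "frechet_derivative f (at x) h = frechet_derivative g (at x) h" if "x \<in> S" for x
      using frechet_derivative_at[OF d[OF that]] by simp
  qed
  ultimately show ?case by simp
qed

text \<open>The derivative of the composition at \<open>x\<close> in direction \<open>h\<close> is
  that of \<open>f\<close> at \<open>L x\<close> in direction \<open>L h\<close>, which again has
  the form to which the induction hypothesis applies.\<close>

lemma times_differentiable_on_linear:
  assumes S: "open S" and L: "bounded_linear L" "\<And>x. x \<in> S \<Longrightarrow> L x \<in> S"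
    and f: "times_differentiable_on n f S"
  shows "times_differentiable_on n (\<lambda>x. f (L x)) S"
  using f
proof (induction n arbitrary: f)
  case 0
  have "continuous_on S L" using bounded_linear.continuous_on[OF L(1) continuous_on_id] by simp
  then show ?case using 0 L(2) by (auto intro: continuous_on_compose2)
next
  case (Suc n)
  have d: "((\<lambda>x. f (L x)) has_derivative (\<lambda>h. frechet_derivative f (at (L x)) (L h))) (at x)" if "x \<in> S" for x
  proof -
    have "(f has_derivative frechet_derivative f (at (L x))) (at (L x))"
      using Suc.prems L(2)[OF that] by (simp add: frechet_derivative_works)
    from diff_chain_at[OF bounded_linear_imp_has_derivative[OF L(1)] this] show ?thesis by (simp add: o_def)
  qed
  then have "(\<lambda>x. f (L x)) differentiable (at x)" if "x \<in> S" for x using that by (auto simp: differentiable_def)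
  moreover have "times_differentiable_on n (\<lambda>x. frechet_derivative (\<lambda>x. f (L x)) (at x) h) S" for h
  proof (rule times_differentiable_on_cong[OF S])
    show "times_differentiable_on n (\<lambda>x. frechet_derivative f (at (L x)) (L h)) S"
      using Suc.IH[of "\<lambda>y. frechet_derivative f (at y) (L h)"] Suc.prems by simp
    show "frechet_derivative f (at (L x)) (L h) = frechet_derivative (\<lambda>x. f (L x)) (at x) h" if "x \<in> S" for x
      using fun_cong[OF frechet_derivative_at[OF d[OF that]], of h] .
  qed
  ultimately show ?case by simp
qed

section \<open>Restriction to the unit circle\<close>

lemma circ_nonzero: "circ x \<noteq> 0"
proof
  assume "circ x = 0"
  then have "circ x $ 1 = 0" "circ x $ 2 = 0" by simp_all
  then have "cos x = 0" "sin x = 0" by (simp_all add: circ_def)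
  then show False using sin_cos_squared_add[of x] by simp
qed

lemma circ_eq: "circ x = cos x *\<^sub>R axis 1 1 + sin x *\<^sub>R axis 2 1"
  by (simp add: circ_def vec_eq_iff forall_2 axis_def)

lemma circ_has_vector_derivative:
  "(circ has_vector_derivative (- sin x) *\<^sub>R axis 1 1 + cos x *\<^sub>R axis 2 1) (at x)"
proof -
  have "((\<lambda>x. cos x *\<^sub>R axis 1 1 + sin x *\<^sub>R axis 2 1) has_vector_derivative
     (cos x *\<^sub>R 0 + (- sin x) *\<^sub>R axis 1 1) + (sin x *\<^sub>R 0 + cos x *\<^sub>R axis 2 1)) (at x :: real filter)"
    by (intro has_vector_derivative_add has_vector_derivative_scaleR DERIV_cos DERIV_sin has_vector_derivative_const)
  then show ?thesis by (simp add: circ_eq[abs_def])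
qed

definition partial :: "2 \<Rightarrow> (real^2 \<Rightarrow> complex) \<Rightarrow> real^2 \<Rightarrow> complex" where
  "partial i f v = frechet_derivative f (at v) (axis i 1)"

lemma smooth_partial: "smooth_on_open f S \<Longrightarrow> smooth_on_open (partial i f) S"
proof -
  assume f: "smooth_on_open f S"
  have "times_differentiable_on n (partial i f) S" for n
    using f[unfolded smooth_on_open_def, THEN conjunct2, rule_format, of "Suc n"] by (simp add: partial_def[abs_def])
  then show ?thesis using f by (simp add: smooth_on_open_def)
qed

lemma smooth_circ_continuous:
  assumes "smooth_on_open f (- {0})"
  shows "continuous_on UNIV (\<lambda>x. f (circ x))"
proof -
  have "continuous_on (- {0}) f"
    using assms[unfolded smooth_on_open_def, THEN conjunct2, rule_format, of 0] by simp
  moreover have "continuous_on UNIV circ"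
    using circ_has_vector_derivative by (auto intro!: continuous_at_imp_continuous_on has_vector_derivative_continuous)
  ultimately show ?thesis using circ_nonzero by (auto intro: continuous_on_compose2)
qed

lemma smooth_circ_derivative:
  assumes f: "smooth_on_open f (- {0})"
  shows "((\<lambda>x. f (circ x)) has_vector_derivative
    of_real (cos x) * partial 2 f (circ x) - of_real (sin x) * partial 1 f (circ x)) (at x)"
proof -
  define D where "D = frechet_derivative f (at (circ x))"
  have "f differentiable (at (circ x))"
    using f[unfolded smooth_on_open_def, THEN conjunct2, rule_format, of "Suc 0"] circ_nonzero[of x] by simp
  then have D: "(f has_derivative D) (at (circ x))" unfolding D_def frechet_derivative_works .
  then interpret D: bounded_linear D by (rule has_derivative_bounded_linear)
  have "((f \<circ> circ) has_derivative (D \<circ> (\<lambda>h. h *\<^sub>R ((- sin x) *\<^sub>R axis 1 1 + cos x *\<^sub>R axis 2 1)))) (at x)"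
    by (rule diff_chain_at[OF circ_has_vector_derivative[unfolded has_vector_derivative_def] D])
  moreover have "D (h *\<^sub>R ((- sin x) *\<^sub>R axis 1 1 + cos x *\<^sub>R axis 2 1))
     = h *\<^sub>R (of_real (cos x) * partial 2 f (circ x) - of_real (sin x) * partial 1 f (circ x))" for h
    unfolding D.scaleR D.add by (simp add: partial_def D_def[symmetric] scaleR_conv_of_real)
  ultimately show ?thesis by (simp add: has_vector_derivative_def o_def)
qed

text \<open>A derivative along the circle is a trigonometric combination of partial derivatives,
  which are smooth again, so the same formula applies a second time.\<close>

lemma smooth_circ_C2:
  assumes f: "smooth_on_open f (- {0})"
  shows "\<exists>f' f''. C2 (\<lambda>x. f (circ x)) f' f''"
proof -
  define d where "d g x = of_real (cos x) * partial 2 g (circ x) - of_real (sin x) * partial 1 g (circ x)"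
    for g :: "real^2 \<Rightarrow> complex" and x
  have d: "((\<lambda>x. g (circ x)) has_vector_derivative d g x) (at x)" if "smooth_on_open g (- {0})" for g x
    unfolding d_def by (rule smooth_circ_derivative[OF that])
  have trig: "((\<lambda>x. complex_of_real (cos x)) has_vector_derivative of_real (- sin x)) (at x)"
    "((\<lambda>x. complex_of_real (sin x)) has_vector_derivative of_real (cos x)) (at x)" for x
    by (intro has_vector_derivative_of_real; simp add: has_real_derivative_iff_has_vector_derivative[symmetric])+
  have p: "smooth_on_open (partial i f) (- {0})" for i by (rule smooth_partial[OF f])
  have c: "continuous_on UNIV (d g)" if "smooth_on_open g (- {0})" for g
    unfolding d_def using smooth_circ_continuous[OF smooth_partial[OF that]]
    by (intro continuous_on_diff continuous_on_mult continuous_on_of_real continuous_on_cos continuous_on_sin continuous_on_id)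
  have "C2 (\<lambda>x. f (circ x)) (d f)
     (\<lambda>x. (of_real (cos x) * d (partial 2 f) x + of_real (- sin x) * partial 2 f (circ x))
       - (of_real (sin x) * d (partial 1 f) x + of_real (cos x) * partial 1 f (circ x)))"
    unfolding C2_def
  proof (intro conjI allI)
    show "((\<lambda>x. f (circ x)) has_vector_derivative d f x) (at x)" for x by (rule d[OF f])
    show "(d f has_vector_derivative (of_real (cos x) * d (partial 2 f) x + of_real (- sin x) * partial 2 f (circ x))
       - (of_real (sin x) * d (partial 1 f) x + of_real (cos x) * partial 1 f (circ x))) (at x)" for x
      unfolding d_def[of f, abs_def] by (intro has_vector_derivative_diff has_vector_derivative_mult trig d p)
    show "continuous_on UNIV (\<lambda>x. (of_real (cos x) * d (partial 2 f) x + of_real (- sin x) * partial 2 f (circ x))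
       - (of_real (sin x) * d (partial 1 f) x + of_real (cos x) * partial 1 f (circ x)))"
      using c[OF p] smooth_circ_continuous[OF p]
      by (intro continuous_on_diff continuous_on_add continuous_on_mult continuous_on_of_real continuous_on_minus
          continuous_on_cos continuous_on_sin continuous_on_id)
  qed
  then show ?thesis by blast
qed

lemma Vspace_zero: "f \<in> Vspace \<zeta> \<epsilon> \<Longrightarrow> f 0 = 0"
  and Vspace_smooth: "f \<in> Vspace \<zeta> \<epsilon> \<Longrightarrow> smooth_on_open f (- {0})"
  and Vspace_homogeneous: "f \<in> Vspace \<zeta> \<epsilon> \<Longrightarrow> v \<noteq> 0 \<Longrightarrow> \<delta> \<noteq> 0 \<Longrightarrow>
      f (\<delta> *\<^sub>R v) = of_real (sgn \<delta>) ^ \<epsilon> * of_real \<bar>\<delta>\<bar> powr (2 * \<zeta> - 1) * f v"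
  by (auto simp: Vspace_def)

lemma circ_plus_pi: "circ (x + pi) = (- 1) *\<^sub>R circ x"
  by (simp add: circ_def vec_eq_iff forall_2)

lemma circ_plus_2pi: "circ (x + 2 * pi) = circ x"
  by (simp add: circ_def)

lemma Vspace_circ_cper: "f \<in> Vspace \<zeta> \<epsilon> \<Longrightarrow> (\<lambda>x. f (circ x)) \<in> cper"
  by (simp add: cper_def circ_plus_2pi smooth_circ_continuous Vspace_smooth)

lemma Vspace_circ_C2pi: "f \<in> Vspace \<zeta> 0 \<Longrightarrow> (\<lambda>x. f (circ x)) \<in> C2pi"
proof -
  assume f: "f \<in> Vspace \<zeta> 0"
  have "f (circ (x + pi)) = f (circ x)" for x
    unfolding circ_plus_pi using Vspace_homogeneous[OF f circ_nonzero, of "- 1"] by simp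
  then show ?thesis using smooth_circ_C2[OF Vspace_smooth[OF f]] by (simp add: C2pi_def)
qed

section \<open>The group action on homogeneous functions\<close>

lemma vector_matrix_mult_2:
  fixes v :: "real^2" and A :: "real^2^2"
  shows "(v v* A) $ j = v $ 1 * A $ 1 $ j + v $ 2 * A $ 2 $ j"
  by (simp add: vector_matrix_mult_def sum_2 mult.commute)

lemma scaleR_vector_matrix_mult_2:
  fixes v :: "real^2" and A :: "real^2^2"
  shows "(c *\<^sub>R v) v* A = c *\<^sub>R (v v* A)"
  by (simp add: vec_eq_iff vector_matrix_mult_2 algebra_simps)

lemma circ_mat_k: "circ x v* mat_k \<theta> = circ (x + \<theta>)"
  by (simp add: vec_eq_iff forall_2 vector_matrix_mult_2 circ_def mat_k_def cos_add sin_add algebra_simps)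

lemma circ_mat_a: "circ x v* mat_a r = radius r x *\<^sub>R circ (angle r x)"
  by (simp add: vec_eq_iff forall_2 vector_matrix_mult_2 circ_def mat_a_def radius_cos_sin_angle mult.commute)

lemma mat_k_nonzero: "v v* mat_k \<theta> = 0 \<Longrightarrow> v = 0"
proof -
  assume "v v* mat_k \<theta> = 0"
  then have "(v v* mat_k \<theta>) $ 1 = 0" "(v v* mat_k \<theta>) $ 2 = 0" by simp_all
  then have "v $ 1 * cos \<theta> - v $ 2 * sin \<theta> = 0" "v $ 1 * sin \<theta> + v $ 2 * cos \<theta> = 0"
    by (simp_all add: vector_matrix_mult_2 mat_k_def)
  then have "v $ 1 = 0" "v $ 2 = 0" using sin_cos_squared_add[of \<theta>] by algebra+
  then show "v = 0" by (simp add: vec_eq_iff forall_2)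
qed

lemma mat_a_nonzero: "v v* mat_a r = 0 \<Longrightarrow> v = 0"
  by (simp add: vec_eq_iff forall_2 vector_matrix_mult_2 mat_a_def)

lemma kak_nonzero: "v v* (mat_k \<theta> ** mat_a r ** mat_k t) = 0 \<Longrightarrow> v = 0"
  unfolding vector_matrix_mul_assoc[symmetric] using mat_k_nonzero mat_a_nonzero by blast

lemma rep_Vspace:
  assumes f: "f \<in> Vspace \<zeta> \<epsilon>" and X: "\<And>v. v v* X = 0 \<Longrightarrow> v = 0"
  shows "rep X f \<in> Vspace \<zeta> \<epsilon>"
proof -
  have lin: "linear (\<lambda>v. v v* X)"
    by (auto simp: linear_iff vec_eq_iff vector_matrix_mult_2 algebra_simps)
  have "times_differentiable_on n (\<lambda>v. f (v v* X)) (- {0})" for n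
  proof (rule times_differentiable_on_linear[of "- {0}" "\<lambda>v. v v* X"])
    show "bounded_linear (\<lambda>v. v v* X)" using lin by (simp add: linear_conv_bounded_linear)
    show "v v* X \<in> - {0}" if "v \<in> - {0}" for v using X that by auto
    show "times_differentiable_on n f (- {0})"
      using Vspace_smooth[OF f] by (simp only: smooth_on_open_def)
  qed (rule open_Compl[OF closed_singleton])
  then have smooth: "smooth_on_open (rep X f) (- {0})" using open_Compl[OF closed_singleton, of 0] by (simp add: smooth_on_open_def rep_def)
  have "rep X f (\<delta> *\<^sub>R v) = of_real (sgn \<delta>) ^ \<epsilon> * of_real \<bar>\<delta>\<bar> powr (2 * \<zeta> - 1) * rep X f v"
    if "v \<noteq> 0" "\<delta> \<noteq> 0" for v \<delta>
  proof -
    have "v v* X \<noteq> 0" using X that(1) by blast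
    from Vspace_homogeneous[OF f this that(2)] show ?thesis by (simp only: rep_def linear_cmul[OF lin])
  qed
  then show ?thesis
    using smooth Vspace_zero[OF f] linear_0[OF lin] unfolding Vspace_def rep_def by simp
qed

lemma rep_kak_circ:
  assumes f: "f \<in> Vspace \<zeta> \<epsilon>"
  shows "rep (mat_k (fst p) ** mat_a r ** mat_k (snd p)) f (circ x) = circle_op (2 * \<zeta> - 1) r p (\<lambda>x. f (circ x)) x"
proof -
  have "circ x v* (mat_k (fst p) ** mat_a r ** mat_k (snd p)) = radius r (x + fst p) *\<^sub>R circ (angle r (x + fst p) + snd p)"
    unfolding vector_matrix_mul_assoc[symmetric] circ_mat_k circ_mat_a scaleR_vector_matrix_mult_2 ..
  then show ?thesis
    using Vspace_homogeneous[OF f circ_nonzero, of "radius r (x + fst p)"] radius_pos[of r "x + fst p"]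
    by (simp add: rep_def circle_op_def twist_def)
qed

text \<open>Functions on the plane are not determined by their values on the image of
  \<open>\<rho>\<close>, so the pulled back form is only semidefinite. Its domain inherits the
  linear structure of \<open>W\<close>; of \<open>Vspace\<close> just the inclusion has to be
  checked later.\<close>

lemma semi_ip_pullback:
  assumes q: "semi_ip W q" and c: "0 < c"
    and ip: "\<And>f g. (\<lambda>x. f (\<rho> x)) \<in> W \<Longrightarrow> (\<lambda>x. g (\<rho> x)) \<in> W \<Longrightarrow> ip f g = of_real c * q (\<lambda>x. f (\<rho> x)) (\<lambda>x. g (\<rho> x))"
  shows "semi_ip {f. (\<lambda>x. f (\<rho> x)) \<in> W} ip"
proof -
  interpret q: semi_ip W q by (rule q)
  show ?thesis
  proof
    fix f g h and a :: complex
    assume f: "f \<in> {f. (\<lambda>x. f (\<rho> x)) \<in> W}"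
    show "(\<lambda>v. a * f v) \<in> {f. (\<lambda>x. f (\<rho> x)) \<in> W}" using f by (simp add: q.scale_mem)
    show "0 \<le> Re (ip f f)" using f q.ip_pos c by (simp add: ip)
    show "ip (\<lambda>v. a * f v) h = a * ip f h" if "h \<in> {f. (\<lambda>x. f (\<rho> x)) \<in> W}"
      using f that by (simp add: ip q.scale_mem q.ip_scale_left)
    assume g: "g \<in> {f. (\<lambda>x. f (\<rho> x)) \<in> W}"
    show "(\<lambda>v. f v - g v) \<in> {f. (\<lambda>x. f (\<rho> x)) \<in> W}" using f g by (simp add: q.diff_mem)
    show "ip g f = cnj (ip f g)" using f g q.ip_cnj[of "\<lambda>x. f (\<rho> x)" "\<lambda>x. g (\<rho> x)"] by (simp add: ip)
    show "ip (\<lambda>v. f v - g v) h = ip f h - ip g h" if "h \<in> {f. (\<lambda>x. f (\<rho> x)) \<in> W}"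
      using f g that by (simp add: ip q.diff_mem q.ip_diff_left right_diff_distrib)
  qed
qed

lemma C2pi_diff: "f \<in> C2pi \<Longrightarrow> g \<in> C2pi \<Longrightarrow> (\<lambda>x. f x - g x) \<in> C2pi"
  using C2pi_add[of f "\<lambda>x. (- 1) * g x"] C2pi_scale[of g "- 1"] by simp

lemma semi_ip_cs_form:
  assumes l: "\<bar>l\<bar> < 1 / 2"
  shows "semi_ip C2pi (cs_form l)"
proof
  fix f g h and c :: complex
  assume f: "f \<in> C2pi"
  show "(\<lambda>v. c * f v) \<in> C2pi" by (rule C2pi_scale[OF f])
  show "0 \<le> Re (cs_form l f f)" by (rule cs_form_nonneg[OF f l])
  show "cs_form l (\<lambda>v. c * f v) h = c * cs_form l f h" if h: "h \<in> C2pi"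
  proof (rule has_sum_unique[OF cs_form_has_sum[OF C2pi_scale[OF f] h l]])
    show "((\<lambda>n. of_real (weight l n) * fcoeff (\<lambda>v. c * f v) n * cnj (fcoeff h n)) has_sum c * cs_form l f h) UNIV"
      using has_sum_cmult_right[OF cs_form_has_sum[OF f h l], of c]
      by (simp add: fcoeff_def L2.ip_scale_left[OF C2pi_cper[OF f] char_fun_cper] mult_ac)
  qed
  assume g: "g \<in> C2pi"
  show "(\<lambda>v. f v - g v) \<in> C2pi" by (rule C2pi_diff[OF f g])
  show "cs_form l (\<lambda>v. f v - g v) h = cs_form l f h - cs_form l g h" if h: "h \<in> C2pi"
  proof (rule has_sum_unique[OF cs_form_has_sum[OF C2pi_diff[OF f g] h l]])
    show "((\<lambda>n. of_real (weight l n) * fcoeff (\<lambda>v. f v - g v) n * cnj (fcoeff h n)) has_sum cs_form l f h - cs_form l g h) UNIV"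
      using has_sum_add[OF cs_form_has_sum[OF f h l] has_sum_cmult_right[OF cs_form_has_sum[OF g h l], of "- 1"]]
      by (simp add: fcoeff_def L2.ip_diff_left[OF C2pi_cper[OF f] C2pi_cper[OF g] char_fun_cper] algebra_simps)
  qed
  show "cs_form l g f = cnj (cs_form l f g)"
  proof (rule has_sum_unique[OF cs_form_has_sum[OF g f l]])
    show "((\<lambda>n. of_real (weight l n) * fcoeff g n * cnj (fcoeff f n)) has_sum cnj (cs_form l f g)) UNIV"
      using has_sum_cnj_iff[of "\<lambda>n. of_real (weight l n) * fcoeff f n * cnj (fcoeff g n)"] cs_form_has_sum[OF f g l]
      by (simp add: mult_ac)
  qed
qed

lemma pairing_cnj_eq:
  assumes "F \<in> cper" "G \<in> cper" "\<And>x. f (circ x) = F x" "\<And>x. g (circ x) = G x"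
  shows "pairing f (\<lambda>v. cnj (g v)) = of_real pi * l2_ip F G"
proof -
  have "set_integrable lborel {-pi..pi} (\<lambda>x. F x * cnj (G x))"
    by (intro borel_integrable_atLeastAtMost' cper_continuous cper_mult cper_cnj assms)
  then show ?thesis
    by (simp add: pairing_def assms set_borel_integral_eq_integral l2_ip_def)
qed

lemma cs_ip_eq:
  assumes l: "\<bar>l\<bar> < 1 / 2" "l \<noteq> 0" and f: "(\<lambda>x. f (circ x)) \<in> C2pi" and g: "(\<lambda>x. g (circ x)) \<in> C2pi"
  shows "cs_ip l f g = of_real (pi * J_scale l) * cs_form l (\<lambda>x. f (circ x)) (\<lambda>x. g (circ x))"
proof -
  define F where "F x = f (circ x)" for x
  have F: "F \<in> C2pi" using f by (simp add: F_def[abs_def])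
  obtain F' where C: "C2 F F' (second_deriv F)" using C2pi_E[OF F] by metis
  have "J_op l f (circ \<phi>) = J_real l F \<phi>" for \<phi>
    unfolding J_op_circ J_real_def
    by (rule J_circle_eq_reg[OF C C2pi_periodic[OF F]]) (use l in \<open>auto simp: F_def\<close>)
  then have "cs_ip l f g = of_real pi * l2_ip (J_real l F) (\<lambda>x. g (circ x))"
    unfolding cs_ip_def by (intro pairing_cnj_eq J_real_cper[OF F l(1)] C2pi_cper[OF g]) simp_all
  then show ?thesis
    using J_spectrum(2)[OF l(1) even_zero] by (simp add: cs_form_def F_def[abs_def])
qed

lemma circle_op_diff: "circle_op w r p (\<lambda>x. f x - g x) x = circle_op w r p f x - circle_op w r p g x"
  by (simp add: circle_op_def twist_def right_diff_distrib)

text \<open>Common reduction for both series: facts about a form on circle functions give the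
  assertion on the completion. The constant \<open>c\<close> cancels, since squared coefficients and
  products of two squared norms both scale by \<open>c^2\<close>.\<close>

lemma coefficient_bound_transfer:
  assumes q: "semi_ip W q" and c: "0 < c"
    and ip: "\<And>f g. (\<lambda>x. f (circ x)) \<in> W \<Longrightarrow> (\<lambda>x. g (circ x)) \<in> W \<Longrightarrow>
      ip f g = of_real c * q (\<lambda>x. f (circ x)) (\<lambda>x. g (circ x))"
    and V: "\<And>f. f \<in> Vspace \<zeta> \<epsilon> \<Longrightarrow> (\<lambda>x. f (circ x)) \<in> W"
    and op: "\<And>F p. F \<in> W \<Longrightarrow> circle_op (2 * \<zeta> - 1) r p F \<in> W"
    and contr: "\<And>F p. F \<in> W \<Longrightarrow> Re (q (circle_op (2 * \<zeta> - 1) r p F) (circle_op (2 * \<zeta> - 1) r p F)) \<le> Re (q F F)"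
    and meas: "\<And>F G. F \<in> W \<Longrightarrow> G \<in> W \<Longrightarrow> (\<lambda>p. q (circle_op (2 * \<zeta> - 1) r p F) G) \<in> borel_measurable borel"
    and bound: "\<And>F G. F \<in> W \<Longrightarrow> G \<in> W \<Longrightarrow>
      (LINT p:({-pi..pi} \<times> {-pi..pi})|lborel. (cmod (q (circle_op (2 * \<zeta> - 1) r p F) G))\<^sup>2) \<le> B\<^sup>2 * Re (q F F) * Re (q G G)"
    and B: "0 \<le> B" "B \<le> B'"
    and X: "X \<in> completion (Vspace \<zeta> \<epsilon>) ip" and Y: "Y \<in> completion (Vspace \<zeta> \<epsilon>) ip"
  shows "set_integrable lborel ({-pi..pi} \<times> {-pi..pi}) (\<lambda>(\<theta>\<^sub>1, \<theta>\<^sub>2).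
      (cmod (completion_inner ip (completion_ext (Vspace \<zeta> \<epsilon>) ip (rep (mat_k \<theta>\<^sub>1 ** mat_a r ** mat_k \<theta>\<^sub>2)) X) Y))\<^sup>2) \<and>
    sqrt (LINT (\<theta>\<^sub>1, \<theta>\<^sub>2):({-pi..pi} \<times> {-pi..pi})|lborel.
      (cmod (completion_inner ip (completion_ext (Vspace \<zeta> \<epsilon>) ip (rep (mat_k \<theta>\<^sub>1 ** mat_a r ** mat_k \<theta>\<^sub>2)) X) Y))\<^sup>2)
      \<le> B' * completion_norm ip X * completion_norm ip Y"
proof -
  define T where "T p = rep (mat_k (fst p) ** mat_a r ** mat_k (snd p))" for p
  define U where "U = {f. (\<lambda>x. f (circ x)) \<in> W}"
  define rs where "rs f = (\<lambda>x. f (circ x))" for f :: "real^2 \<Rightarrow> complex"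
  interpret q: semi_ip W q by (rule q)
  interpret I: semi_ip U ip unfolding U_def by (rule semi_ip_pullback[OF q c ip])
  have VU: "Vspace \<zeta> \<epsilon> \<subseteq> U" using V by (auto simp: U_def)
  have TV: "T p f \<in> Vspace \<zeta> \<epsilon>" if "f \<in> Vspace \<zeta> \<epsilon>" for p f
    unfolding T_def by (rule rep_Vspace[OF that kak_nonzero])
  have Tc: "rs (T p f) = circle_op (2 * \<zeta> - 1) r p (rs f)" if "f \<in> Vspace \<zeta> \<epsilon>" for p f
    unfolding rs_def T_def using rep_kak_circ[OF that] by auto
  have rsW: "rs f \<in> W" if "f \<in> U" for f using that by (simp add: U_def rs_def)
  have ip': "ip f g = of_real c * q (rs f) (rs g)" if "f \<in> U" "g \<in> U" for f g
    unfolding rs_def using that by (intro ip) (simp_all add: U_def)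
  have nrm: "ip_norm ip f = sqrt (c * Re (q (rs f) (rs f)))" if "f \<in> U" for f
    by (simp add: ip_norm_def ip'[OF that that])
  have T_le: "ip_norm ip h \<le> ip_norm ip g" if "h \<in> U" "g \<in> U" "rs h = circle_op (2 * \<zeta> - 1) r p (rs g)" for h g p
    unfolding nrm[OF that(1)] nrm[OF that(2)] that(3) using contr[OF rsW[OF that(2)], of p] c
    by (intro real_sqrt_le_mono mult_left_mono) auto
  have S: "{-pi..pi} \<times> {-pi..pi} \<in> sets borel" "emeasure lborel ({-pi..pi} \<times> {-pi..pi}) < \<infinity>"
  proof -
    have sq: "{-pi..pi} \<times> {-pi..pi} = cbox (-pi, -pi) (pi, pi)" by (simp add: cbox_Pair_eq)
    show "{-pi..pi} \<times> {-pi..pi} \<in> sets borel" unfolding sq by simp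
    show "emeasure lborel ({-pi..pi} \<times> {-pi..pi}) < \<infinity>" unfolding sq by (rule emeasure_lborel_cbox_finite)
  qed
  have VU': "f \<in> U" "T p f \<in> U" if "f \<in> Vspace \<zeta> \<epsilon>" for p f
    by (rule subsetD[OF VU that], rule subsetD[OF VU TV[OF that]])
  have T_contr: "ip_norm ip (T p f) \<le> ip_norm ip f" if "f \<in> Vspace \<zeta> \<epsilon>" for p f
    by (rule T_le[OF VU'(2,1) Tc]; rule that)
  have T_lip: "ip_norm ip (\<lambda>v. T p f v - T p g v) \<le> ip_norm ip (\<lambda>v. f v - g v)"
    if f: "f \<in> Vspace \<zeta> \<epsilon>" and g: "g \<in> Vspace \<zeta> \<epsilon>" for p f g
  proof (rule T_le[OF I.diff_mem[OF VU'(2)[OF f] VU'(2)[OF g]] I.diff_mem[OF VU'(1)[OF f] VU'(1)[OF g]]])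
    show "rs (\<lambda>v. T p f v - T p g v) = circle_op (2 * \<zeta> - 1) r p (rs (\<lambda>v. f v - g v))"
      using Tc[OF f, of p] Tc[OF g, of p] by (auto simp: rs_def fun_eq_iff circle_op_diff)
  qed
  have eq: "ip (T p f) g = of_real c * q (circle_op (2 * \<zeta> - 1) r p (rs f)) (rs g)"
    if "f \<in> Vspace \<zeta> \<epsilon>" "g \<in> Vspace \<zeta> \<epsilon>" for p f g
    unfolding ip'[OF VU'(2)[OF that(1)] VU'(1)[OF that(2)]] Tc[OF that(1)] ..
  have T_meas: "(\<lambda>p. ip (T p f) g) \<in> borel_measurable borel"
    if "f \<in> Vspace \<zeta> \<epsilon>" "g \<in> Vspace \<zeta> \<epsilon>" for f g
    unfolding eq[OF that] using meas[OF rsW rsW, OF VU'(1) VU'(1), OF that] by simp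
  have T_bound: "(LINT p:({-pi..pi} \<times> {-pi..pi})|lborel. (cmod (ip (T p f) g))\<^sup>2) \<le> (B' * ip_norm ip f * ip_norm ip g)\<^sup>2"
    if f: "f \<in> Vspace \<zeta> \<epsilon>" and g: "g \<in> Vspace \<zeta> \<epsilon>" for f g
  proof -
    note fU = VU'(1)[OF f] and gU = VU'(1)[OF g]
    have sq: "(ip_norm ip h)\<^sup>2 = c * Re (q (rs h) (rs h))" if "h \<in> U" for h
      unfolding nrm[OF that] using c q.ip_pos[OF rsW[OF that]] by (intro real_sqrt_pow2 mult_nonneg_nonneg) auto
    have "(LINT p:({-pi..pi} \<times> {-pi..pi})|lborel. (cmod (ip (T p f) g))\<^sup>2)
      = c\<^sup>2 * (LINT p:({-pi..pi} \<times> {-pi..pi})|lborel. (cmod (q (circle_op (2 * \<zeta> - 1) r p (rs f)) (rs g)))\<^sup>2)"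
      by (simp add: eq[OF that] norm_mult power_mult_distrib)
    also have "\<dots> \<le> c\<^sup>2 * (B\<^sup>2 * Re (q (rs f) (rs f)) * Re (q (rs g) (rs g)))"
      by (intro mult_left_mono bound rsW fU gU) simp
    also have "\<dots> = (B * ip_norm ip f * ip_norm ip g)\<^sup>2"
      unfolding power_mult_distrib sq[OF fU] sq[OF gU] power2_eq_square[of c] by (simp only: mult_ac)
    also have "\<dots> \<le> (B' * ip_norm ip f * ip_norm ip g)\<^sup>2"
      using B I.ip_norm_nonneg[OF fU] I.ip_norm_nonneg[OF gU] by (intro power_mono mult_right_mono) auto
    finally show ?thesis .
  qed
  have "0 \<le> B'" using B by simp
  note main = I.completion_coefficient_bound[OF VU TV T_contr T_lip T_meas T_bound S this X Y]
  show ?thesis using main unfolding T_def case_prod_unfold by simp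
qed

theorem corollary4p2:
  shows "\<exists>C::real. C > 0 \<and>
    (\<forall>s::real. \<forall>\<epsilon>::nat. \<forall>r::real. \<forall>f g.
       s \<noteq> 0 \<longrightarrow> \<epsilon> \<in> {0, 1} \<longrightarrow> r > 0 \<longrightarrow> f \<in> ps_hilbert s \<epsilon> \<longrightarrow> g \<in> ps_hilbert s \<epsilon> \<longrightarrow>
         set_integrable lborel ({-pi..pi} \<times> {-pi..pi}) (\<lambda>(\<theta>\<^sub>1, \<theta>\<^sub>2).
           (cmod (completion_inner ps_ip (ps_rep s \<epsilon> (mat_k \<theta>\<^sub>1 ** mat_a r ** mat_k \<theta>\<^sub>2) f) g))\<^sup>2) \<and>
         sqrt (LINT (\<theta>\<^sub>1, \<theta>\<^sub>2):({-pi..pi} \<times> {-pi..pi})|lborel.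
           (cmod (completion_inner ps_ip (ps_rep s \<epsilon> (mat_k \<theta>\<^sub>1 ** mat_a r ** mat_k \<theta>\<^sub>2) f) g))\<^sup>2)
         \<le> C * ((\<bar>s\<bar> + 1) / \<bar>s\<bar>) * exp (- r) * completion_norm ps_ip f * completion_norm ps_ip g) \<and>
    (\<forall>l::real. \<forall>r::real. \<forall>f g.
       l \<in> {-1/2<..<0} \<union> {0<..<1/2} \<longrightarrow> r > 0 \<longrightarrow> f \<in> cs_hilbert l \<longrightarrow> g \<in> cs_hilbert l \<longrightarrow>
         set_integrable lborel ({-pi..pi} \<times> {-pi..pi}) (\<lambda>(\<theta>\<^sub>1, \<theta>\<^sub>2).
           (cmod (completion_inner (cs_ip l) (cs_rep l (mat_k \<theta>\<^sub>1 ** mat_a r ** mat_k \<theta>\<^sub>2) f) g))\<^sup>2) \<and>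
         sqrt (LINT (\<theta>\<^sub>1, \<theta>\<^sub>2):({-pi..pi} \<times> {-pi..pi})|lborel.
           (cmod (completion_inner (cs_ip l) (cs_rep l (mat_k \<theta>\<^sub>1 ** mat_a r ** mat_k \<theta>\<^sub>2) f) g))\<^sup>2)
         \<le> C / \<bar>l\<bar> * exp (- ((1 - 2 * \<bar>l\<bar>) * r))
             * completion_norm (cs_ip l) f * completion_norm (cs_ip l) g)"
\<comment> \<open>160 comes from \<open>mcoeff_principal_bound\<close>; Parseval in each of the two
  angles multiplies the squared integral by 2 \<pi>, hence its root by 2 \<pi> in all. The
  complementary bound holds with 2 \<pi> alone.\<close>
proof (intro exI[of _ "2 * pi * 160"] conjI[OF _ conjI] allI impI)
  show "0 < 2 * pi * 160" by simp
next
  fix s :: real and \<epsilon> :: nat and r :: real and f g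
  assume s: "s \<noteq> 0" and r: "0 < r" and f: "f \<in> ps_hilbert s \<epsilon>" and g: "g \<in> ps_hilbert s \<epsilon>"
  have w: "2 * (\<i> * of_real s / 2) - 1 = \<i> * of_real s - 1" by simp
  note transfer = coefficient_bound_transfer[where W = cper and q = l2_ip and c = pi and ip = ps_ip and \<zeta> = "\<i> * of_real s / 2"
      and \<epsilon> = \<epsilon> and r = r and B = "2 * pi * (160 * ((\<bar>s\<bar> + 1) / \<bar>s\<bar>) * exp (- r))", unfolded w]
  show "set_integrable lborel ({-pi..pi} \<times> {-pi..pi}) (\<lambda>(\<theta>\<^sub>1, \<theta>\<^sub>2).
           (cmod (completion_inner ps_ip (ps_rep s \<epsilon> (mat_k \<theta>\<^sub>1 ** mat_a r ** mat_k \<theta>\<^sub>2) f) g))\<^sup>2) \<and>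
         sqrt (LINT (\<theta>\<^sub>1, \<theta>\<^sub>2):({-pi..pi} \<times> {-pi..pi})|lborel.
           (cmod (completion_inner ps_ip (ps_rep s \<epsilon> (mat_k \<theta>\<^sub>1 ** mat_a r ** mat_k \<theta>\<^sub>2) f) g))\<^sup>2)
         \<le> 2 * pi * 160 * ((\<bar>s\<bar> + 1) / \<bar>s\<bar>) * exp (- r) * completion_norm ps_ip f * completion_norm ps_ip g"
    unfolding ps_rep_def ps_space_def
  proof (rule transfer[OF L2.semi_ip_axioms pi_gt_zero])
    show "ps_ip f g = of_real pi * l2_ip (\<lambda>x. f (circ x)) (\<lambda>x. g (circ x))"
      if "(\<lambda>x. f (circ x)) \<in> cper" "(\<lambda>x. g (circ x)) \<in> cper" for f g
      unfolding ps_ip_def by (rule pairing_cnj_eq[OF that]) simp_all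
    show "Re (l2_ip (circle_op (\<i> * of_real s - 1) r p F) (circle_op (\<i> * of_real s - 1) r p F)) \<le> Re (l2_ip F F)"
      if "F \<in> cper" for F p
      by (subst l2_circle_op[OF that]) (simp_all add: complex_eq_iff)
    show "(LINT p:({-pi..pi} \<times> {-pi..pi})|lborel. (cmod (l2_ip (circle_op (\<i> * of_real s - 1) r p F) G))\<^sup>2)
        \<le> (2 * pi * (160 * ((\<bar>s\<bar> + 1) / \<bar>s\<bar>) * exp (- r)))\<^sup>2 * Re (l2_ip F F) * Re (l2_ip G G)"
      if "F \<in> cper" "G \<in> cper" for F G
      by (rule ps_circle_bound(2)[OF that r s])
    show "2 * pi * (160 * ((\<bar>s\<bar> + 1) / \<bar>s\<bar>) * exp (- r)) \<le> 2 * pi * 160 * ((\<bar>s\<bar> + 1) / \<bar>s\<bar>) * exp (- r)"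
      by (simp only: mult.assoc order_refl)
  qed (use f g in \<open>auto simp: ps_hilbert_def ps_space_def intro: Vspace_circ_cper circle_op_cper ps_circle_bound(1)[OF _ _ r s]\<close>)
next
  fix l r :: real and f g
  assume "l \<in> {-1/2<..<0} \<union> {0<..<1/2}" and f: "f \<in> cs_hilbert l" and g: "g \<in> cs_hilbert l"
  then have l: "\<bar>l\<bar> < 1 / 2" "l \<noteq> 0" by auto
  have c: "0 < pi * J_scale l" using J_spectrum(2)[OF l(1) even_zero] by simp
  have w: "2 * complex_of_real l - 1 = of_real (2 * l - 1)" by simp
  note transfer = coefficient_bound_transfer[where W = C2pi and q = "cs_form l" and ip = "cs_ip l" and \<zeta> = "of_real l"
      and \<epsilon> = 0 and r = r and B = "2 * pi * (exp (- ((1 - 2 * \<bar>l\<bar>) * r)) / \<bar>l\<bar>)", unfolded w, OF semi_ip_cs_form[OF l(1)] c]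
  show "set_integrable lborel ({-pi..pi} \<times> {-pi..pi}) (\<lambda>(\<theta>\<^sub>1, \<theta>\<^sub>2).
           (cmod (completion_inner (cs_ip l) (cs_rep l (mat_k \<theta>\<^sub>1 ** mat_a r ** mat_k \<theta>\<^sub>2) f) g))\<^sup>2) \<and>
         sqrt (LINT (\<theta>\<^sub>1, \<theta>\<^sub>2):({-pi..pi} \<times> {-pi..pi})|lborel.
           (cmod (completion_inner (cs_ip l) (cs_rep l (mat_k \<theta>\<^sub>1 ** mat_a r ** mat_k \<theta>\<^sub>2) f) g))\<^sup>2)
         \<le> 2 * pi * 160 / \<bar>l\<bar> * exp (- ((1 - 2 * \<bar>l\<bar>) * r))
             * completion_norm (cs_ip l) f * completion_norm (cs_ip l) g"
    unfolding cs_rep_def cs_space_def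
  proof (rule transfer)
    show "cs_ip l f g = of_real (pi * J_scale l) * cs_form l (\<lambda>x. f (circ x)) (\<lambda>x. g (circ x))"
      if "(\<lambda>x. f (circ x)) \<in> C2pi" "(\<lambda>x. g (circ x)) \<in> C2pi" for f g
      by (rule cs_ip_eq[OF l that])
    show "f \<in> completion (Vspace (of_real l) 0) (cs_ip l)" "g \<in> completion (Vspace (of_real l) 0) (cs_ip l)"
      using f g by (simp_all add: cs_hilbert_def cs_space_def)
    show "2 * pi * (exp (- ((1 - 2 * \<bar>l\<bar>) * r)) / \<bar>l\<bar>) \<le> 2 * pi * 160 / \<bar>l\<bar> * exp (- ((1 - 2 * \<bar>l\<bar>) * r))"
      using l by (simp add: field_simps)
    show "(\<lambda>x. f (circ x)) \<in> C2pi" if "f \<in> Vspace (of_real l) 0" for f by (rule Vspace_circ_C2pi[OF that])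
    show "circle_op (of_real (2 * l - 1)) r p F \<in> C2pi" if "F \<in> C2pi" for F p by (rule circle_op_C2pi[OF that])
    show "Re (cs_form l (circle_op (of_real (2 * l - 1)) r p F) (circle_op (of_real (2 * l - 1)) r p F)) \<le> Re (cs_form l F F)"
      if "F \<in> C2pi" for F p by (rule cs_form_circle_op_le[OF that l])
    show "(\<lambda>p. cs_form l (circle_op (of_real (2 * l - 1)) r p F) G) \<in> borel_measurable borel"
      if "F \<in> C2pi" "G \<in> C2pi" for F G by (rule cs_circle_bound(1)[OF that l])
    show "(LINT p:({-pi..pi} \<times> {-pi..pi})|lborel. (cmod (cs_form l (circle_op (of_real (2 * l - 1)) r p F) G))\<^sup>2)
        \<le> (2 * pi * (exp (- ((1 - 2 * \<bar>l\<bar>) * r)) / \<bar>l\<bar>))\<^sup>2 * Re (cs_form l F F) * Re (cs_form l G G)"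
      if "F \<in> C2pi" "G \<in> C2pi" for F G by (rule cs_circle_bound(2)[OF that l])
    show "0 \<le> 2 * pi * (exp (- ((1 - 2 * \<bar>l\<bar>) * r)) / \<bar>l\<bar>)" by simp
  qed
qed

end
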